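(* Let $n\ge3$. Then there exists a matrix $A=(a_{ij})_{1\le i,j\le n}$ such that $\det(A)>0$, $a_{ij}=a_{ji}>0$ for $1\le i<j\le n$ and $a_{ii}=0$ for $1\le i\le n$, for which the system $-\Delta u_i+\lambda u_i=\sum_{j=1}^na_{ij}u_iu_j^2$ in $\Omega$, $u_i\in H$, $1\le i\le n$, admits a positive vector solution of the form $\vec u=(c_1,c_2,\dots,c_n)U$ of Morse index $n-2$.
   Context: $\Omega\subset\mathbb{R}^N$ is a domain, $N\le 3$, $\lambda>0$. $H=H^1_0(\Omega)$, except that if $\Omega=\mathbb{R}^N$ then $H$ is the subspace of radially symmetric functions in $H^1(\mathbb{R}^N)$; $\mathbf{H}=H^n$. $U\in H$ is a least energy positive solution of $\Delta u-\lambda u+u^3=0$ in $\Omega$, $u=0$ on $\partial\Omega$. A positive vector solution is a solution with $u_i>0$ in $\Omega$ for every $i$. With $I(\vec u)=\frac12\sum_{i=1}^n\int_\Omega(|\nabla u_i|^2+\lambda u_i^2)\,dx-\frac14\int_\Omega\sum_{i,j=1}^na_{ij}u_i^2u_j^2\,dx$ on $\mathbf{H}$, the Morse index of a solution $\vec u$ is the maximal dimension of a subspace $W\subset\mathbf{H}$ with $I''(\vec u)(\vec\phi,\vec\phi)<0$ for all $\vec\phi\in W\setminus\{0\}$. *)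

theory Defs
  imports "HOL-Analysis.Analysis" "HOL-Library.Function_Algebras" "HOL-Library.Extended_Nat"
begin

section \<open>Sobolev spaces\<close>

text \<open>Elements of the Lebesgue and Sobolev spaces over \<open>\<Omega>\<close> are represented by functions on the whole
  space, of which only the values almost everywhere on \<open>\<Omega>\<close> matter.\<close>

definition gradient :: "(real ^ 'N \<Rightarrow> real) \<Rightarrow> real ^ 'N \<Rightarrow> real ^ 'N" where
  "gradient f x = (\<chi> i. frechet_derivative f (at x) (axis i 1))"

fun Ck :: "nat \<Rightarrow> (real ^ 'N \<Rightarrow> real) \<Rightarrow> bool" where
  "Ck 0 f \<longleftrightarrow> continuous_on UNIV f"
| "Ck (Suc k) f \<longleftrightarrow> f differentiable_on UNIV \<and> (\<forall>i. Ck k (\<lambda>x. gradient f x $ i))"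

definition test_functions :: "(real ^ 'N) set \<Rightarrow> (real ^ 'N \<Rightarrow> real) set" where
  "test_functions \<Omega> = {\<eta>. (\<forall>k. Ck k \<eta>) \<and> compact (closure {x. \<eta> x \<noteq> 0})
     \<and> closure {x. \<eta> x \<noteq> 0} \<subseteq> \<Omega>}"

definition square_integrable ::
    "(real ^ 'N) set \<Rightarrow> (real ^ 'N \<Rightarrow> 'b :: euclidean_space) \<Rightarrow> bool" where
  "square_integrable \<Omega> f \<longleftrightarrow> f \<in> borel_measurable (lebesgue_on \<Omega>)
     \<and> integrable (lebesgue_on \<Omega>) (\<lambda>x. (norm (f x))\<^sup>2)"

definition is_weak_gradient ::
    "(real ^ 'N) set \<Rightarrow> (real ^ 'N \<Rightarrow> real) \<Rightarrow> (real ^ 'N \<Rightarrow> real ^ 'N) \<Rightarrow> bool" where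
  "is_weak_gradient \<Omega> u g \<longleftrightarrow> square_integrable \<Omega> g
     \<and> (\<forall>\<eta> \<in> test_functions \<Omega>. \<forall>i.
          (\<integral>x. u x * gradient \<eta> x $ i \<partial>lebesgue_on \<Omega>) = - (\<integral>x. g x $ i * \<eta> x \<partial>lebesgue_on \<Omega>))"

definition H1 :: "(real ^ 'N) set \<Rightarrow> (real ^ 'N \<Rightarrow> real) set" where
  "H1 \<Omega> = {u. square_integrable \<Omega> u \<and> (\<exists>g. is_weak_gradient \<Omega> u g)}"

text \<open>The weak gradient is unique up to null sets; the choice below is used only under integrals.\<close>

definition weak_gradient ::
    "(real ^ 'N) set \<Rightarrow> (real ^ 'N \<Rightarrow> real) \<Rightarrow> real ^ 'N \<Rightarrow> real ^ 'N" where
  "weak_gradient \<Omega> u = (SOME g. is_weak_gradient \<Omega> u g)"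

definition H10 :: "(real ^ 'N) set \<Rightarrow> (real ^ 'N \<Rightarrow> real) set" where
  "H10 \<Omega> = {u \<in> H1 \<Omega>. \<exists>\<eta> :: nat \<Rightarrow> real ^ 'N \<Rightarrow> real. (\<forall>k. \<eta> k \<in> test_functions \<Omega>)
     \<and> (\<lambda>k. \<integral>x. (u x - \<eta> k x)\<^sup>2 + (norm (weak_gradient \<Omega> u x - gradient (\<eta> k) x))\<^sup>2 \<partial>lebesgue_on \<Omega>)
         \<longlonglongrightarrow> 0}"

definition radially_symmetric :: "(real ^ 'N \<Rightarrow> real) \<Rightarrow> bool" where
  "radially_symmetric u \<longleftrightarrow> (\<exists>v. AE x in lebesgue. u x = v (norm x))"

definition Hsp :: "(real ^ 'N) set \<Rightarrow> (real ^ 'N \<Rightarrow> real) set" where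
  "Hsp \<Omega> = (if \<Omega> = UNIV then {u \<in> H1 UNIV. radially_symmetric u} else H10 \<Omega>)"


section \<open>The scalar equation\<close>

definition scalar_solution :: "(real ^ 'N) set \<Rightarrow> real \<Rightarrow> (real ^ 'N \<Rightarrow> real) \<Rightarrow> bool" where
  "scalar_solution \<Omega> lam u \<longleftrightarrow> u \<in> Hsp \<Omega>
     \<and> (\<forall>\<eta> \<in> test_functions \<Omega>.
          (\<integral>x. weak_gradient \<Omega> u x \<bullet> gradient \<eta> x + lam * u x * \<eta> x \<partial>lebesgue_on \<Omega>)
        = (\<integral>x. u x ^ 3 * \<eta> x \<partial>lebesgue_on \<Omega>))"

definition scalar_energy :: "(real ^ 'N) set \<Rightarrow> real \<Rightarrow> (real ^ 'N \<Rightarrow> real) \<Rightarrow> real" where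
  "scalar_energy \<Omega> lam u =
     1/2 * (\<integral>x. (norm (weak_gradient \<Omega> u x))\<^sup>2 + lam * (u x)\<^sup>2 \<partial>lebesgue_on \<Omega>)
   - 1/4 * (\<integral>x. u x ^ 4 \<partial>lebesgue_on \<Omega>)"

definition nehari_manifold :: "(real ^ 'N) set \<Rightarrow> real \<Rightarrow> (real ^ 'N \<Rightarrow> real) set" where
  "nehari_manifold \<Omega> lam = {v \<in> Hsp \<Omega>. \<not> (AE x in lebesgue_on \<Omega>. v x = 0)
     \<and> (\<integral>x. (norm (weak_gradient \<Omega> v x))\<^sup>2 + lam * (v x)\<^sup>2 \<partial>lebesgue_on \<Omega>)
       = (\<integral>x. v x ^ 4 \<partial>lebesgue_on \<Omega>)}"

text \<open>As usual for superlinear problems, \<^emph>\<open>least energy\<close> refers to the ground state level, the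
  infimum of the energy over the Nehari manifold, which contains all nontrivial solutions. If
  \<open>\<Omega>\<close> is bounded or the whole space (with radial functions), this level is attained, by solutions,
  so that it is the least energy among all nontrivial (equivalently, positive) solutions. On other
  unbounded domains the level need not be attained, and then no least energy solution exists.\<close>

definition least_energy_positive_solution ::
    "(real ^ 'N) set \<Rightarrow> real \<Rightarrow> (real ^ 'N \<Rightarrow> real) \<Rightarrow> bool" where
  "least_energy_positive_solution \<Omega> lam U \<longleftrightarrow> scalar_solution \<Omega> lam U
     \<and> (AE x in lebesgue_on \<Omega>. U x > 0)
     \<and> (\<forall>v \<in> nehari_manifold \<Omega> lam. scalar_energy \<Omega> lam U \<le> scalar_energy \<Omega> lam v)"


section \<open>The system\<close>

text \<open>An \<open>n\<close>-tuple \<open>(u\<^sub>1, \<dots>, u\<^sub>n)\<close> of functions is a function \<open>u\<close> with values in \<open>real ^ 'n\<close>.\<close>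

definition Hvec :: "(real ^ 'N) set \<Rightarrow> (real ^ 'N \<Rightarrow> real ^ 'n) set" where
  "Hvec \<Omega> = {u. \<forall>i. (\<lambda>x. u x $ i) \<in> Hsp \<Omega>}"

definition system_solution ::
    "(real ^ 'N) set \<Rightarrow> real \<Rightarrow> real ^ 'n ^ 'n \<Rightarrow> (real ^ 'N \<Rightarrow> real ^ 'n) \<Rightarrow> bool" where
  "system_solution \<Omega> lam A u \<longleftrightarrow> u \<in> Hvec \<Omega>
     \<and> (\<forall>i. \<forall>\<eta> \<in> test_functions \<Omega>.
          (\<integral>x. weak_gradient \<Omega> (\<lambda>y. u y $ i) x \<bullet> gradient \<eta> x + lam * u x $ i * \<eta> x
             \<partial>lebesgue_on \<Omega>)
        = (\<integral>x. (\<Sum>j\<in>UNIV. A $ i $ j * u x $ i * (u x $ j)\<^sup>2) * \<eta> x \<partial>lebesgue_on \<Omega>))"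

definition positive_vector_solution ::
    "(real ^ 'N) set \<Rightarrow> real \<Rightarrow> real ^ 'n ^ 'n \<Rightarrow> (real ^ 'N \<Rightarrow> real ^ 'n) \<Rightarrow> bool" where
  "positive_vector_solution \<Omega> lam A u \<longleftrightarrow> system_solution \<Omega> lam A u
     \<and> (\<forall>i. AE x in lebesgue_on \<Omega>. u x $ i > 0)"

definition system_energy ::
    "(real ^ 'N) set \<Rightarrow> real \<Rightarrow> real ^ 'n ^ 'n \<Rightarrow> (real ^ 'N \<Rightarrow> real ^ 'n) \<Rightarrow> real" where
  "system_energy \<Omega> lam A u =
     1/2 * (\<Sum>i\<in>UNIV. \<integral>x. (norm (weak_gradient \<Omega> (\<lambda>y. u y $ i) x))\<^sup>2 + lam * (u x $ i)\<^sup>2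
              \<partial>lebesgue_on \<Omega>)
   - 1/4 * (\<integral>x. (\<Sum>i\<in>UNIV. \<Sum>j\<in>UNIV. A $ i $ j * (u x $ i)\<^sup>2 * (u x $ j)\<^sup>2) \<partial>lebesgue_on \<Omega>)"


section \<open>Morse index\<close>

text \<open>The diagonal \<open>F''(u)(\<phi>,\<phi>)\<close> of the second derivative.\<close>

definition second_variation ::
    "(('a \<Rightarrow> 'b :: real_vector) \<Rightarrow> real) \<Rightarrow> ('a \<Rightarrow> 'b) \<Rightarrow> ('a \<Rightarrow> 'b) \<Rightarrow> real" where
  "second_variation F u \<phi> = (deriv ^^ 2) (\<lambda>t. F (\<lambda>x. u x + t *\<^sub>R \<phi> x)) 0"

interpretation funs: vector_space "\<lambda>(r :: real) (f :: 'a \<Rightarrow> 'b :: real_vector) x. r *\<^sub>R f x"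
  by unfold_locales (auto simp: fun_eq_iff algebra_simps)

text \<open>Working with representatives instead of classes does not affect the dimensions: the second
  variation vanishes at any \<open>\<phi>\<close> that is zero almost everywhere on \<open>\<Omega>\<close>, so no such \<open>\<phi> \<noteq> 0\<close> lies in
  a subspace \<open>W\<close> as below. Restricting to finite-dimensional \<open>W\<close> is harmless as well, since an
  infinite-dimensional \<open>W\<close> has subspaces of every finite dimension, making the supremum infinite.\<close>

definition morse_index ::
    "(real ^ 'N) set \<Rightarrow> real \<Rightarrow> real ^ 'n ^ 'n \<Rightarrow> (real ^ 'N \<Rightarrow> real ^ 'n) \<Rightarrow> enat" where
  "morse_index \<Omega> lam A u = Sup {enat (funs.dim W) | W.
     funs.subspace W \<and> (\<exists>B. finite B \<and> W = funs.span B) \<and> W \<subseteq> Hvec \<Omega>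
     \<and> (\<forall>\<phi> \<in> W - {0}. second_variation (system_energy \<Omega> lam A) u \<phi> < 0)}"

end

theory Submission
  imports Defs "HOL-Computational_Algebra.Polynomial"
begin

text \<open>For constant \<open>c = (1, \<dots>, 1)\<close> and a symmetric matrix \<open>A\<close> with row sums 1, the vector \<open>c U\<close> solves the
  system. Writing \<open>\<phi>\<^sub>i = s\<^sub>i U + \<chi>\<^sub>i\<close> with \<open>\<integral>U\<^sup>3\<chi>\<^sub>i = 0\<close>, the second variation splits into
  \<open>- 2 \<parallel>U\<parallel>\<^sup>2 (s, A s)\<close> and a part in the \<open>\<chi>\<^sub>i\<close>. The latter is nonnegative if \<open>A \<le> 1\<close>, since the minimality
  of \<open>U\<close> gives \<open>\<parallel>\<chi>\<parallel>\<^sup>2 \<ge> 3 \<integral>U\<^sup>2\<chi>\<^sup>2\<close>. Hence the Morse index is the number of positive eigenvalues of \<open>A\<close>.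
  A circulant \<open>A\<close> with eigenvalues 1, a small \<open>\<epsilon> > 0\<close> (\<open>n - 3\<close> times) and a negative one on the plane
  spanned by \<open>cos (2\<pi>i/n)\<close> and \<open>sin (2\<pi>i/n)\<close> has zero diagonal and positive off-diagonal entries.

  No Sobolev embedding is needed: testing minimality with the bounded functions \<open>sin (\<delta> u) / \<delta>\<close> and
  letting \<open>\<delta> \<rightarrow> 0\<close> yields \<open>u \<in> L\<^sup>4\<close> for all \<open>u \<in> H\<close>.\<close>

section \<open>Smooth functions\<close>

text \<open>The trace ties the determinant to the Morse index. A zero diagonal makes the eigenvalues
  of \<open>A\<close> add up to zero, and the negative one has multiplicity two, so it is
  \<open>- (1 + (n - 3) \<epsilon>) / 2\<close>. Its square makes the determinant positive, and
  \<open>n - 2\<close> positive eigenvalues remain. The condition \<open>A \<le> 1\<close> is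
  exactly what the constant 3 in the inequality for \<open>\<chi>\<close> affords: the part in
  \<open>\<chi>\<close> is at least \<open>3 - 1 - 2 = 0\<close> times the weighted norm, without
  slack. The obstacle is analytic. Elements of \<open>H\<close> are representatives with a merely
  chosen weak gradient, and nonintegrable functions have integral 0 by convention, so neither the
  linearity of the gradient, nor testing the equation with \<open>U\<close>, nor the finiteness of
  quartic integrals comes for free. The remedy is to describe every element of \<open>H\<close> as a
  limit of test functions, also on the whole space, where the definition supplies no such sequence.
  The sine is the truncation of choice since it is smooth, bounded, Lipschitz and zero at 0, so that
  it maps test functions to test functions.\<close>

lemma gradient_eqI:
  assumes "(f has_derivative (\<lambda>h. G \<bullet> h)) (at x)"
  shows "gradient f x = G"
  by (simp add: gradient_def frechet_derivative_at[OF assms, symmetric] vec_eq_iff inner_axis)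

lemma has_derivative_gradient:
  assumes "f differentiable (at x)"
  shows "(f has_derivative (\<lambda>h. gradient f x \<bullet> h)) (at x)"
proof -
  have D: "(f has_derivative frechet_derivative f (at x)) (at x)"
    using assms frechet_derivative_works by blast
  then have "linear (frechet_derivative f (at x))"
    by (simp add: has_derivative_bounded_linear bounded_linear.linear)
  then interpret linear "frechet_derivative f (at x)" .
  have "frechet_derivative f (at x) h = gradient f x \<bullet> h" for h
  proof -
    have "frechet_derivative f (at x) h
        = frechet_derivative f (at x) (\<Sum>i\<in>UNIV. h $ i *\<^sub>R axis i 1)"
      by (simp add: basis_expansion scalar_mult_eq_scaleR[symmetric])
    also have "\<dots> = gradient f x \<bullet> h"
      by (simp add: sum scaleR gradient_def inner_vec_def mult.commute)
    finally show ?thesis .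
  qed
  then have "frechet_derivative f (at x) = (\<lambda>h. gradient f x \<bullet> h)" by auto
  with D show ?thesis by simp
qed

lemma gradient_const [simp]: "gradient (\<lambda>x. c) x = 0"
  by (rule gradient_eqI) simp

lemma Ck_differentiable: "Ck (Suc k) f \<Longrightarrow> f differentiable (at x)"
  by (auto simp: differentiable_on_def)

lemma Ck_SucI:
  assumes "\<And>x. (f has_derivative (\<lambda>h. G x \<bullet> h)) (at x)" and "\<And>i. Ck k (\<lambda>x. G x $ i)"
  shows "Ck (Suc k) f"
proof -
  have "gradient f = G" using assms(1) gradient_eqI by blast
  moreover have "f differentiable_on UNIV"
    using assms(1) by (auto simp: differentiable_on_def differentiable_def)
  ultimately show ?thesis using assms(2) by simp
qed

lemma Ck_Suc_lower: "Ck (Suc k) f \<Longrightarrow> Ck k f"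
proof (induction k arbitrary: f)
  case 0
  then show ?case by (simp add: differentiable_imp_continuous_on)
next
  case (Suc k)
  then show ?case by simp
qed

lemma Ck_continuous: "Ck k f \<Longrightarrow> continuous_on UNIV f"
  by (induction k) (use Ck_Suc_lower in auto)

lemma Ck_const: "Ck k (\<lambda>x. c)"
  by (induction k arbitrary: c) auto

lemma gradient_mult:
  assumes "f differentiable (at x)" "g differentiable (at x)"
  shows "gradient (\<lambda>x. f x * g x) x = f x *\<^sub>R gradient g x + g x *\<^sub>R gradient f x"
proof (rule gradient_eqI)
  show "((\<lambda>x. f x * g x) has_derivative
      (\<lambda>h. (f x *\<^sub>R gradient g x + g x *\<^sub>R gradient f x) \<bullet> h)) (at x)"
    using has_derivative_mult[OF assms[THEN has_derivative_gradient]]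
    by (simp add: inner_add_left mult.commute)
qed

lemma Ck_add: "Ck k f \<Longrightarrow> Ck k g \<Longrightarrow> Ck k (\<lambda>x. f x + g x)"
proof (induction k arbitrary: f g)
  case 0
  then show ?case by (auto intro: continuous_on_add)
next
  case (Suc k)
  show ?case
  proof (rule Ck_SucI[where G = "\<lambda>x. gradient f x + gradient g x"])
    show "((\<lambda>x. f x + g x) has_derivative (\<lambda>h. (gradient f x + gradient g x) \<bullet> h)) (at x)" for x
      using has_derivative_add[OF Suc.prems[THEN Ck_differentiable, THEN has_derivative_gradient]]
      by (simp add: inner_add_left)
    show "Ck k (\<lambda>x. (gradient f x + gradient g x) $ i)" for i
      using Suc by simp
  qed
qed

lemma Ck_mult: "Ck k f \<Longrightarrow> Ck k g \<Longrightarrow> Ck k (\<lambda>x. f x * g x)"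
proof (induction k arbitrary: f g)
  case 0
  then show ?case by (auto intro: continuous_on_mult)
next
  case (Suc k)
  show ?case
  proof (rule Ck_SucI[where G = "\<lambda>x. f x *\<^sub>R gradient g x + g x *\<^sub>R gradient f x"])
    show "((\<lambda>x. f x * g x) has_derivative
        (\<lambda>h. (f x *\<^sub>R gradient g x + g x *\<^sub>R gradient f x) \<bullet> h)) (at x)" for x
      using has_derivative_mult[OF Suc.prems[THEN Ck_differentiable, THEN has_derivative_gradient]]
      by (simp add: inner_add_left mult.commute)
    show "Ck k (\<lambda>x. (f x *\<^sub>R gradient g x + g x *\<^sub>R gradient f x) $ i)" for i
      using Suc.prems Suc.prems[THEN Ck_Suc_lower]
      by (auto intro!: Ck_add Suc.IH)
  qed
qed

lemma gradient_compose:
  assumes "(F has_real_derivative F') (at (q x))" "q differentiable (at x)"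
  shows "((\<lambda>x. F (q x)) has_derivative (\<lambda>h. (F' *\<^sub>R gradient q x) \<bullet> h)) (at x)"
  using has_derivative_compose[OF has_derivative_gradient[OF assms(2)]
      assms(1)[unfolded has_field_derivative_def]]
  by simp

text \<open>The derivatives of the outer function are supplied as a sequence \<open>F\<close>, so
  the induction on \<open>k\<close> runs over all \<open>j\<close> at once: the chain rule leads
  from \<open>F j\<close> to \<open>F (Suc j)\<close>, and \<open>Ck_mult\<close> takes care of the
  inner derivative.\<close>

lemma Ck_compose:
  fixes F :: "nat \<Rightarrow> real \<Rightarrow> real"
  assumes F: "\<And>j t. (F j has_real_derivative F (Suc j) t) (at t)" and q: "\<And>k. Ck k q"
  shows "Ck k (\<lambda>x. F j (q x))"
proof (induction k arbitrary: j)
  case 0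
  have "continuous_on UNIV (F j)"
    using F DERIV_isCont continuous_at_imp_continuous_on by blast
  with q[of 0] show ?case
    by (auto intro: continuous_on_compose2[where g = "F j"])
next
  case (Suc k)
  show ?case
  proof (rule Ck_SucI[where G = "\<lambda>x. F (Suc j) (q x) *\<^sub>R gradient q x"])
    show "((\<lambda>x. F j (q x)) has_derivative (\<lambda>h. (F (Suc j) (q x) *\<^sub>R gradient q x) \<bullet> h)) (at x)" for x
      using gradient_compose[OF F] q[of "Suc 0"] Ck_differentiable by blast
    show "Ck k (\<lambda>x. (F (Suc j) (q x) *\<^sub>R gradient q x) $ i)" for i
      using Ck_mult[OF Suc.IH] q[of "Suc k"] by simp
  qed
qed

text \<open>The functions \<open>p (1/t) e\<^sup>-\<^sup>1\<^sup>/\<^sup>t\<close> with a polynomial \<open>p\<close>, extended by zero to \<open>t \<le> 0\<close>, are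
  closed under differentiation.\<close>

definition flat_exp :: "real poly \<Rightarrow> real \<Rightarrow> real" where
  "flat_exp p t = (if t \<le> 0 then 0 else poly p (1/t) * exp (- (1/t)))"

text \<open>With \<open>s = 1/t\<close> one has \<open>ds/dt = - s\<^sup>2\<close>, so the
  derivative of \<open>p(s) exp (- s)\<close> is \<open>s\<^sup>2 (p(s) - p'(s)) exp (- s)\<close>;
  this is its polynomial factor.\<close>

definition flat_exp_deriv :: "real poly \<Rightarrow> real poly" where
  "flat_exp_deriv p = [:0, 0, 1:] * (p - pderiv p)"

lemma poly_exp_tendsto_0: "((\<lambda>s :: real. poly p s * exp (- s)) \<longlongrightarrow> 0) at_top"
proof -
  have "((\<lambda>s. \<Sum>i\<le>degree p. coeff p i * (s ^ i / exp s)) \<longlongrightarrow> (\<Sum>i\<le>degree p. coeff p i * 0)) at_top"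
    by (intro tendsto_sum tendsto_mult tendsto_const tendsto_power_div_exp_0)
  then show ?thesis
    by (simp add: poly_altdef exp_minus divide_inverse sum_distrib_right mult.assoc)
qed

lemma flat_exp_has_derivative:
  "(flat_exp p has_real_derivative flat_exp (flat_exp_deriv p) t) (at t)"
proof (cases t "0 :: real" rule: linorder_cases)
  case less
  have "((\<lambda>_. 0) has_real_derivative 0) (at t)" by simp
  then show ?thesis
    using less by (rule_tac has_field_derivative_transform_within_open[where S = "{..<0}" and f = "\<lambda>_. 0"])
      (auto simp: flat_exp_def)
next
  case greater
  have "((\<lambda>t. poly p (1/t) * exp (- (1/t))) has_real_derivative flat_exp (flat_exp_deriv p) t) (at t)"
    using greater
    by (auto intro!: derivative_eq_intros simp: flat_exp_def flat_exp_deriv_def field_simps power2_eq_square)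
  then show ?thesis
    using greater by (rule_tac has_field_derivative_transform_within_open[where S = "{0<..}"])
      (auto simp: flat_exp_def)
next
  case equal
  have "((\<lambda>h. flat_exp p h / h) \<longlongrightarrow> 0) (at_right 0)"
  proof -
    \<comment> \<open>Dividing by \<open>h\<close> amounts to multiplying the polynomial by its
      variable \<open>1/h\<close>, and exponential decay still wins.\<close>
    have "((\<lambda>h. poly ([:0,1:] * p) (inverse h) * exp (- inverse h)) \<longlongrightarrow> 0) (at_right 0)"
      by (rule filterlim_compose[OF poly_exp_tendsto_0 filterlim_inverse_at_top_right])
    then show ?thesis
      by (rule Lim_transform_eventually)
        (auto simp: eventually_at_right_less eventually_at_filter flat_exp_def field_simps)
  qed
  moreover have "((\<lambda>h. flat_exp p h / h) \<longlongrightarrow> 0) (at_left 0)"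
    by (rule Lim_transform_eventually[OF tendsto_const])
      (auto simp: eventually_at_filter flat_exp_def)
  ultimately have "((\<lambda>h. flat_exp p h / h) \<longlongrightarrow> 0) (at 0)"
    by (simp add: filterlim_split_at)
  then show ?thesis using equal by (simp add: DERIV_def flat_exp_def)
qed

lemma flat_exp_Ck:
  assumes "\<And>k. Ck k q"
  shows "Ck k (\<lambda>x. flat_exp p (q x))"
proof -
  have "Ck k (\<lambda>x. (flat_exp ((flat_exp_deriv ^^ 0) p)) (q x))"
    by (rule Ck_compose[where F = "\<lambda>j. flat_exp ((flat_exp_deriv ^^ j) p)"])
      (use flat_exp_has_derivative assms in auto)
  then show ?thesis by simp
qed

section \<open>Bump functions and cut-offs\<close>

definition bump :: "real \<Rightarrow> real ^ 'N \<Rightarrow> real" where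
  "bump R x = flat_exp 1 (1 - (x \<bullet> x) / R\<^sup>2)"

lemma has_derivative_one_minus_square:
  "((\<lambda>x :: real ^ 'N. 1 - (x \<bullet> x) / R\<^sup>2) has_derivative (\<lambda>h. ((- 2 / R\<^sup>2) *\<^sub>R x) \<bullet> h)) (at x)"
proof -
  have "((\<lambda>x :: real ^ 'N. 1 - (x \<bullet> x) * d) has_derivative (\<lambda>h. ((- 2 * d) *\<^sub>R x) \<bullet> h)) (at x)" for d
    by (auto intro!: derivative_eq_intros simp: inner_commute algebra_simps)
  from this[of "inverse (R\<^sup>2)"] show ?thesis by (simp add: divide_inverse)
qed

lemma Ck_one_minus_square: "Ck k (\<lambda>x :: real ^ 'N. 1 - (x \<bullet> x) / R\<^sup>2)"
proof -
  have lin: "Ck k (\<lambda>x :: real ^ 'N. ((- 2 / R\<^sup>2) *\<^sub>R x) $ i)" for i k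
  proof (cases k)
    case 0
    have "continuous_on UNIV (\<lambda>x :: real ^ 'N. (- 2 / R\<^sup>2) * x $ i)"
      by (intro continuous_intros)
    with 0 show ?thesis by simp
  next
    case (Suc j)
    have "((\<lambda>x :: real ^ 'N. ((- 2 / R\<^sup>2) *\<^sub>R x) $ i) has_derivative
        (\<lambda>h. ((- 2 / R\<^sup>2) *\<^sub>R axis i 1) \<bullet> h)) (at x)" for x
      using bounded_linear_imp_has_derivative[OF bounded_linear_inner_right[of "(- 2 / R\<^sup>2) *\<^sub>R (axis i 1 :: real ^ 'N)"]]
      by (simp add: inner_axis' inner_real_def)
    then show ?thesis unfolding Suc by (rule Ck_SucI) (rule Ck_const)
  qed
  have "Ck (Suc k) (\<lambda>x :: real ^ 'N. 1 - (x \<bullet> x) / R\<^sup>2)"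
    by (rule Ck_SucI[OF has_derivative_one_minus_square lin])
  then show ?thesis by (rule Ck_Suc_lower)
qed

lemma Ck_bump: "Ck k (bump R)"
  unfolding bump_def[abs_def] by (rule flat_exp_Ck) (rule Ck_one_minus_square)

lemma gradient_bump:
  "gradient (bump R) x = (- 2 * flat_exp (flat_exp_deriv 1) (1 - (x \<bullet> x) / R\<^sup>2) / R\<^sup>2) *\<^sub>R x"
proof (rule gradient_eqI)
  have "((\<lambda>x. flat_exp 1 (1 - (x \<bullet> x) / R\<^sup>2)) has_derivative
     (\<lambda>h. flat_exp (flat_exp_deriv 1) (1 - (x \<bullet> x) / R\<^sup>2) * (((- 2 / R\<^sup>2) *\<^sub>R x) \<bullet> h))) (at x)"
    by (rule has_derivative_compose[OF has_derivative_one_minus_square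
          flat_exp_has_derivative[unfolded has_field_derivative_def]])
  then show "(bump R has_derivative
      (\<lambda>h. ((- 2 * flat_exp (flat_exp_deriv 1) (1 - (x \<bullet> x) / R\<^sup>2) / R\<^sup>2) *\<^sub>R x) \<bullet> h)) (at x)"
    by (simp add: bump_def[abs_def] field_simps)
qed

lemma bump_nonneg: "bump R x \<ge> 0"
  by (simp add: bump_def flat_exp_def)

lemma bump_eq_0:
  assumes "R > 0" "norm x \<ge> R"
  shows "bump R x = 0"
proof -
  have "R\<^sup>2 \<le> (norm x)\<^sup>2" using assms by (intro power_mono) auto
  then show ?thesis using assms
    by (simp add: bump_def flat_exp_def dot_square_norm field_simps)
qed

lemma bump_pos: "R > 0 \<Longrightarrow> norm x < R \<Longrightarrow> bump R x > 0"
  by (simp add: bump_def flat_exp_def dot_square_norm power_strict_mono field_simps not_le)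

lemma bump_le: "bump R x \<le> exp (- 1)"
proof (cases "1 - (x \<bullet> x) / R\<^sup>2 \<le> 0")
  case False
  have "1 \<le> 1 / (1 - (x \<bullet> x) / R\<^sup>2)" using False by (simp add: field_simps)
  then show ?thesis by (simp add: bump_def flat_exp_def)
qed (simp add: bump_def flat_exp_def)

text \<open>The argument of the profile tends to 1, where \<open>flat_exp 1\<close> has the value
  \<open>exp (- 1)\<close>. Multiplied by \<open>exp 1\<close>, these bumps become cut-offs with
  values in \<open>{0..1}\<close> that converge to 1 everywhere.\<close>

lemma bump_tendsto: "(\<lambda>k. bump (real (Suc k)) x) \<longlonglongrightarrow> exp (- 1)"
proof -
  have "(\<lambda>k. x \<bullet> x * (inverse (real (Suc k)))\<^sup>2) \<longlonglongrightarrow> x \<bullet> x * 0\<^sup>2"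
    by (intro tendsto_intros LIMSEQ_inverse_real_of_nat)
  then have "(\<lambda>k. 1 - (x \<bullet> x) / (real (Suc k))\<^sup>2) \<longlonglongrightarrow> 1 - 0"
    by (intro tendsto_intros) (simp add: divide_inverse power_inverse)
  moreover have "isCont (flat_exp 1) 1"
    using flat_exp_has_derivative DERIV_isCont by blast
  ultimately have "(\<lambda>k. flat_exp 1 (1 - (x \<bullet> x) / (real (Suc k))\<^sup>2)) \<longlonglongrightarrow> flat_exp 1 1"
    using isCont_tendsto_compose by force
  then show ?thesis by (simp add: bump_def flat_exp_def)
qed

text \<open>The chain rule produces the factor \<open>2 * norm x / R\<^sup>2\<close>, at most
  \<open>2 / R\<close> on the ball, and the derivative of the profile is bounded on
  \<open>{0..1}\<close> independently of \<open>R\<close>. The decay in \<open>R\<close> makes the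
  gradient of the cut-offs disappear in the limit.\<close>

lemma gradient_bump_bound:
  obtains C where "C \<ge> 0"
    "\<And>(R :: real) (x :: real ^ 'N). R > 0 \<Longrightarrow> norm (gradient (bump R) x) \<le> C / R"
proof -
  define f where "f = flat_exp (flat_exp_deriv 1)"
  have "continuous_on {0..1} f"
    using flat_exp_has_derivative DERIV_isCont continuous_at_imp_continuous_on f_def by blast
  then have "compact (f ` {0..1})"
    using compact_continuous_image compact_Icc by blast
  then have "bounded (f ` {0..1})" by (rule compact_imp_bounded)
  then obtain B where "\<forall>t \<in> {0..1}. \<bar>f t\<bar> \<le> B"
    by (auto simp: bounded_iff)
  then have B: "\<And>t. t \<in> {0..1} \<Longrightarrow> \<bar>f t\<bar> \<le> B" by blast
  have "B \<ge> 0" using B[of 0] by auto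
  have "norm (gradient (bump R) x) \<le> 2 * B / R" if "R > 0" for R and x :: "real ^ 'N"
  proof (cases "norm x < R")
    case True
    have "(norm x)\<^sup>2 \<le> R\<^sup>2" using True by (intro power_mono) auto
    then have "\<bar>f (1 - (x \<bullet> x) / R\<^sup>2)\<bar> \<le> B"
      using that by (intro B) (auto simp: dot_square_norm field_simps)
    then have "\<bar>f (1 - (x \<bullet> x) / R\<^sup>2)\<bar> * norm x \<le> B * R"
      using True by (intro mult_mono) auto
    then show ?thesis using that
      by (simp add: gradient_bump f_def[symmetric] abs_mult field_simps power2_eq_square)
  next
    case False
    then have "R\<^sup>2 \<le> (norm x)\<^sup>2" using that by (intro power_mono) auto
    then have "f (1 - (x \<bullet> x) / R\<^sup>2) = 0" using that
      by (simp add: f_def flat_exp_def dot_square_norm field_simps)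
    then show ?thesis using that \<open>B \<ge> 0\<close>
      by (simp add: gradient_bump f_def[symmetric])
  qed
  with \<open>B \<ge> 0\<close> show ?thesis using that[of "2 * B"] by auto
qed

section \<open>Square integrable functions\<close>

text \<open>The notion \<open>square_integrable\<close> over an arbitrary measure: translation,
  reflection and Tonelli are used on \<open>lborel\<close>, the Sobolev spaces live on
  \<open>lebesgue_on \<Omega>\<close>.\<close>

definition l2 :: "'a measure \<Rightarrow> ('a \<Rightarrow> 'b :: euclidean_space) \<Rightarrow> bool" where
  "l2 M f \<longleftrightarrow> f \<in> borel_measurable M \<and> integrable M (\<lambda>x. (norm (f x))\<^sup>2)"

lemma square_integrable_iff_l2: "square_integrable \<Omega> f \<longleftrightarrow> l2 (lebesgue_on \<Omega>) f"
  by (simp add: square_integrable_def l2_def)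

lemma l2_measurable [measurable_dest]: "l2 M f \<Longrightarrow> f \<in> borel_measurable M"
  and l2_integrable: "l2 M f \<Longrightarrow> integrable M (\<lambda>x. (norm (f x))\<^sup>2)"
  by (auto simp: l2_def)

lemma power2_norm_add_le:
  fixes a b :: "'a :: real_normed_vector"
  shows "(norm (a + b))\<^sup>2 \<le> 2 * (norm a)\<^sup>2 + 2 * (norm b)\<^sup>2"
proof -
  have "(norm (a + b))\<^sup>2 \<le> (norm a + norm b)\<^sup>2"
    by (intro power_mono norm_triangle_ineq) auto
  also have "\<dots> \<le> 2 * (norm a)\<^sup>2 + 2 * (norm b)\<^sup>2"
    using sum_squares_bound[of "norm a" "norm b"] by (simp add: power2_sum)
  finally show ?thesis .
qed

lemma l2_mono:
  assumes "l2 M f" "g \<in> borel_measurable M" "AE x in M. norm (g x) \<le> C * norm (f x)"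
  shows "l2 M g"
  unfolding l2_def
proof
  have "integrable M (\<lambda>x. C\<^sup>2 * (norm (f x))\<^sup>2)"
    using assms(1) by (auto simp: l2_def)
  then show "integrable M (\<lambda>x. (norm (g x))\<^sup>2)"
  proof (rule Bochner_Integration.integrable_bound)
    show "AE x in M. norm ((norm (g x))\<^sup>2) \<le> norm (C\<^sup>2 * (norm (f x))\<^sup>2)"
      using assms(3)
    proof eventually_elim
      case (elim x)
      then have "(norm (g x))\<^sup>2 \<le> (C * norm (f x))\<^sup>2" by (intro power_mono) auto
      then show ?case by (simp add: power_mult_distrib)
    qed
  qed (use assms(2) in measurable)
qed (use assms in auto)

lemma l2_add:
  assumes "l2 M f" "l2 M g"
  shows "l2 M (\<lambda>x. f x + g x)"
  unfolding l2_def
proof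
  note [measurable] = assms[THEN l2_measurable]
  show "(\<lambda>x. f x + g x) \<in> borel_measurable M" by measurable
  have "integrable M (\<lambda>x. 2 * (norm (f x))\<^sup>2 + 2 * (norm (g x))\<^sup>2)"
    using assms by (auto simp: l2_def)
  then show "integrable M (\<lambda>x. (norm (f x + g x))\<^sup>2)"
    by (rule Bochner_Integration.integrable_bound) (auto simp: power2_norm_add_le)
qed

lemma l2_bounded_mult:
  assumes "l2 M f" "h \<in> borel_measurable M" "\<And>x. \<bar>h x\<bar> \<le> B"
  shows "l2 M (\<lambda>x. h x *\<^sub>R f x)"
proof (rule l2_mono[OF assms(1)])
  show "(\<lambda>x. h x *\<^sub>R f x) \<in> borel_measurable M"
    using assms(2) l2_measurable[OF assms(1)] by (rule borel_measurable_scaleR)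
  show "AE x in M. norm (h x *\<^sub>R f x) \<le> B * norm (f x)"
    using assms(3) by (auto intro!: mult_right_mono)
qed

lemma l2_scaleR: "l2 M f \<Longrightarrow> l2 M (\<lambda>x. c *\<^sub>R f x)"
  using l2_bounded_mult[of M f "\<lambda>_. c" "\<bar>c\<bar>"] by simp

lemma l2_scale: "l2 M f \<Longrightarrow> l2 M (\<lambda>x. c * f x :: real)"
  using l2_scaleR[of M f c] by simp

lemma l2_diff: "l2 M f \<Longrightarrow> l2 M g \<Longrightarrow> l2 M (\<lambda>x. f x - g x)"
  using l2_add[of M f "\<lambda>x. (-1) *\<^sub>R g x"] l2_scaleR[of M g "-1"] by simp

lemma l2_zero [simp]: "l2 M (\<lambda>x. 0)"
  by (simp add: l2_def)

lemma l2_sum: "(\<And>i. i \<in> I \<Longrightarrow> l2 M (f i)) \<Longrightarrow> l2 M (\<lambda>x. \<Sum>i\<in>I. f i x)"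
  by (induction I rule: infinite_finite_induct) (auto intro: l2_add)

lemma l2_cong_AE:
  assumes "l2 M f" "g \<in> borel_measurable M" "AE x in M. f x = g x"
  shows "l2 M g"
  by (rule l2_mono[where C = 1, OF assms(1,2)]) (use assms(3) in auto)

lemma l2_component: "l2 M f \<Longrightarrow> l2 M (\<lambda>x. f x $ i)" for f :: "_ \<Rightarrow> real ^ 'N"
proof (rule l2_mono[where C = 1])
  assume "l2 M f"
  then have "(\<lambda>x. f x \<bullet> axis i 1) \<in> borel_measurable M" by (auto simp: l2_def)
  then show "(\<lambda>x. f x $ i) \<in> borel_measurable M" by (simp add: inner_axis)
qed (auto simp: component_le_norm_cart)

lemma integrable_inner:
  assumes "l2 M f" "l2 M g"
  shows "integrable M (\<lambda>x. f x \<bullet> g x)"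
proof (rule Bochner_Integration.integrable_bound)
  note [measurable] = assms[THEN l2_measurable]
  show "integrable M (\<lambda>x. (norm (f x))\<^sup>2 + (norm (g x))\<^sup>2)" using assms by (auto simp: l2_def)
  show "(\<lambda>x. f x \<bullet> g x) \<in> borel_measurable M" by measurable
  show "AE x in M. norm (f x \<bullet> g x) \<le> norm ((norm (f x))\<^sup>2 + (norm (g x))\<^sup>2)"
  proof (rule AE_I2)
    fix x
    have "norm (f x \<bullet> g x) \<le> norm (f x) * norm (g x)" using Cauchy_Schwarz_ineq2 by simp
    also have "\<dots> \<le> (norm (f x))\<^sup>2 + (norm (g x))\<^sup>2"
      using sum_squares_bound[of "norm (f x)" "norm (g x)"]
        zero_le_power2[of "norm (f x)"] zero_le_power2[of "norm (g x)"] by linarith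
    finally show "norm (f x \<bullet> g x) \<le> norm ((norm (f x))\<^sup>2 + (norm (g x))\<^sup>2)" by simp
  qed
qed

lemma integrable_mult:
  fixes f g :: "'a \<Rightarrow> real"
  shows "l2 M f \<Longrightarrow> l2 M g \<Longrightarrow> integrable M (\<lambda>x. f x * g x)"
  using integrable_inner[of M f g] by simp

lemma quadratic_nonneg_imp_discriminant:
  fixes a b c :: real
  assumes "\<And>t. 0 \<le> a + 2 * t * b + t\<^sup>2 * c"
  shows "b\<^sup>2 \<le> a * c"
proof (cases "c = 0")
  case True
  have "b = 0"
  proof (rule ccontr)
    assume "b \<noteq> 0"
    \<comment> \<open>For \<open>c = 0\<close> the expression is affine in \<open>t\<close>, and at
      this point its value is -1.\<close>
    then show False using assms[of "- (a + 1) / (2 * b)"] True by (simp add: field_simps)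
  qed
  with True show ?thesis by simp
next
  case False
  have "c \<ge> 0"
  proof (rule ccontr)
    assume "\<not> c \<ge> 0"
    \<comment> \<open>A \<open>t \<ge> 1\<close> so large that \<open>t * (- c)\<close> is at least
      \<open>\<bar>a\<bar> + 2 * \<bar>b\<bar> + 1\<close>; the quadratic is then at most
      \<open>- t\<close>.\<close>
    define t where "t = (\<bar>a\<bar> + 2 * \<bar>b\<bar> + 1) / (- c) + 1"
    have "t \<ge> 1" using \<open>\<not> c \<ge> 0\<close> by (simp add: t_def divide_nonneg_neg)
    have "t * (- c) \<ge> \<bar>a\<bar> + 2 * \<bar>b\<bar> + 1" using \<open>\<not> c \<ge> 0\<close> by (simp add: t_def field_simps)
    then have "t * (t * (- c)) \<ge> t * (\<bar>a\<bar> + 2 * \<bar>b\<bar> + 1)" using \<open>t \<ge> 1\<close> by (intro mult_left_mono) auto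
    moreover have "t * \<bar>a\<bar> \<ge> a" using \<open>t \<ge> 1\<close> mult_right_mono[of 1 t "\<bar>a\<bar>"] by simp
    moreover have "t * b \<le> t * \<bar>b\<bar>" using \<open>t \<ge> 1\<close> by (intro mult_left_mono) auto
    moreover have "t * (\<bar>a\<bar> + 2 * \<bar>b\<bar> + 1) = t * \<bar>a\<bar> + 2 * (t * \<bar>b\<bar>) + t"
      "0 \<le> a + 2 * (t * b) - t * (t * (- c))"
      using assms[of t] by (simp_all add: algebra_simps power2_eq_square)
    ultimately show False using \<open>t \<ge> 1\<close> by linarith
  qed
  with False have "c > 0" by simp
  \<comment> \<open>The minimum of the quadratic is at \<open>- b / c\<close>; multiplying by
    \<open>c\<close> clears the denominator.\<close>
  then have "0 \<le> (a + 2 * (- b / c) * b + (- b / c)\<^sup>2 * c) * c"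
    using assms[of "- b / c"] by (intro mult_nonneg_nonneg) auto
  also have "\<dots> = a * c - b\<^sup>2" using \<open>c > 0\<close> by (simp add: field_simps power2_eq_square)
  finally show ?thesis by simp
qed

text \<open>The squared norm of \<open>f + t *\<^sub>R g\<close> is a nonnegative quadratic
  polynomial in \<open>t\<close>, and the inequality is the sign of its discriminant.\<close>

lemma l2_Cauchy_Schwarz:
  assumes "l2 M f" "l2 M g"
  shows "(\<integral>x. f x \<bullet> g x \<partial>M)\<^sup>2 \<le> (\<integral>x. (norm (f x))\<^sup>2 \<partial>M) * (\<integral>x. (norm (g x))\<^sup>2 \<partial>M)"
proof (rule quadratic_nonneg_imp_discriminant)
  fix t :: real
  have "0 \<le> (\<integral>x. (norm (f x + t *\<^sub>R g x))\<^sup>2 \<partial>M)" by (intro Bochner_Integration.integral_nonneg) auto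
  also have "\<dots> = (\<integral>x. (norm (f x))\<^sup>2 + 2 * t * (f x \<bullet> g x) + t\<^sup>2 * (norm (g x))\<^sup>2 \<partial>M)"
    by (intro Bochner_Integration.integral_cong refl, subst power2_norm_eq_inner)
      (simp add: power2_norm_eq_inner inner_add_left inner_add_right inner_commute algebra_simps
        power2_eq_square[of t])
  also have "\<dots> = (\<integral>x. (norm (f x))\<^sup>2 \<partial>M) + 2 * t * (\<integral>x. f x \<bullet> g x \<partial>M) + t\<^sup>2 * (\<integral>x. (norm (g x))\<^sup>2 \<partial>M)"
    using assms by (simp add: integrable_inner l2_integrable)
  finally show "0 \<le> (\<integral>x. (norm (f x))\<^sup>2 \<partial>M) + 2 * t * (\<integral>x. f x \<bullet> g x \<partial>M) + t\<^sup>2 * (\<integral>x. (norm (g x))\<^sup>2 \<partial>M)" .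
qed

section \<open>Convergence in mean square\<close>

definition l2_lim ::
    "'a measure \<Rightarrow> (nat \<Rightarrow> 'a \<Rightarrow> 'b :: euclidean_space) \<Rightarrow> ('a \<Rightarrow> 'b) \<Rightarrow> bool" where
  "l2_lim M F f \<longleftrightarrow> (\<forall>k. l2 M (F k)) \<and> l2 M f \<and> (\<lambda>k. \<integral>x. (norm (F k x - f x))\<^sup>2 \<partial>M) \<longlonglongrightarrow> 0"

lemma l2_lim_l2: "l2_lim M F f \<Longrightarrow> l2 M (F k)" and l2_lim_l2': "l2_lim M F f \<Longrightarrow> l2 M f"
  by (auto simp: l2_lim_def)

lemma l2_lim_inner:
  assumes "l2_lim M F f" "l2 M g"
  shows "(\<lambda>k. \<integral>x. F k x \<bullet> g x \<partial>M) \<longlonglongrightarrow> (\<integral>x. f x \<bullet> g x \<partial>M)"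
proof -
  have l2: "l2 M (F k)" "l2 M f" for k using assms by (auto simp: l2_lim_def)
  have "(\<lambda>k. (\<integral>x. (F k x - f x) \<bullet> g x \<partial>M)\<^sup>2) \<longlonglongrightarrow> 0"
  proof (rule tendsto_sandwich[OF _ _ tendsto_const])
    show "(\<lambda>k. (\<integral>x. (norm (F k x - f x))\<^sup>2 \<partial>M) * (\<integral>x. (norm (g x))\<^sup>2 \<partial>M)) \<longlonglongrightarrow> 0"
      using assms(1) by (auto simp: l2_lim_def intro!: tendsto_mult_left_zero)
    show "\<forall>\<^sub>F k in sequentially. (\<integral>x. (F k x - f x) \<bullet> g x \<partial>M)\<^sup>2
        \<le> (\<integral>x. (norm (F k x - f x))\<^sup>2 \<partial>M) * (\<integral>x. (norm (g x))\<^sup>2 \<partial>M)"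
      using l2 assms(2) by (intro always_eventually allI l2_Cauchy_Schwarz l2_diff)
  qed auto
  then have "(\<lambda>k. sqrt ((\<integral>x. (F k x - f x) \<bullet> g x \<partial>M)\<^sup>2)) \<longlonglongrightarrow> sqrt 0" by (rule tendsto_real_sqrt)
  then have "(\<lambda>k. \<integral>x. (F k x - f x) \<bullet> g x \<partial>M) \<longlonglongrightarrow> 0" by (simp add: tendsto_rabs_zero_iff)
  moreover have "(\<integral>x. (F k x - f x) \<bullet> g x \<partial>M) = (\<integral>x. F k x \<bullet> g x \<partial>M) - (\<integral>x. f x \<bullet> g x \<partial>M)" for k
    using l2 assms(2) by (simp add: inner_diff_left integrable_inner)
  ultimately show ?thesis by (simp add: LIM_zero_cancel)
qed

lemma l2_lim_mult:
  fixes F :: "nat \<Rightarrow> 'a \<Rightarrow> real"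
  shows "l2_lim M F f \<Longrightarrow> l2 M g \<Longrightarrow> (\<lambda>k. \<integral>x. F k x * g x \<partial>M) \<longlonglongrightarrow> (\<integral>x. f x * g x \<partial>M)"
  using l2_lim_inner[of M F f g] by simp

text \<open>A pointwise comparison of the errors transfers convergence. Passing to components,
  multiplying by scalars, changing the limit on a null set and composing with a Lipschitz function
  are all instances.\<close>

lemma l2_lim_bound:
  assumes "\<And>k. l2 M (F k)" "l2 M f" "l2_lim M G g"
    and "\<And>k. AE x in M. norm (F k x - f x) \<le> C * norm (G k x - g x)"
  shows "l2_lim M F f"
  unfolding l2_lim_def
proof (intro conjI allI assms)
  have l2: "l2 M (G k)" "l2 M g" for k using assms(3) by (auto simp: l2_lim_def)
  show "(\<lambda>k. \<integral>x. (norm (F k x - f x))\<^sup>2 \<partial>M) \<longlonglongrightarrow> 0"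
  proof (rule tendsto_sandwich[OF _ _ tendsto_const])
    show "(\<lambda>k. C\<^sup>2 * (\<integral>x. (norm (G k x - g x))\<^sup>2 \<partial>M)) \<longlonglongrightarrow> 0"
      using assms(3) by (auto simp: l2_lim_def intro!: tendsto_mult_right_zero)
    have "(\<integral>x. (norm (F k x - f x))\<^sup>2 \<partial>M) \<le> C\<^sup>2 * (\<integral>x. (norm (G k x - g x))\<^sup>2 \<partial>M)" for k
    proof -
      have "(\<integral>x. (norm (F k x - f x))\<^sup>2 \<partial>M) \<le> (\<integral>x. C\<^sup>2 * (norm (G k x - g x))\<^sup>2 \<partial>M)"
      proof (rule integral_mono_AE)
        show "AE x in M. (norm (F k x - f x))\<^sup>2 \<le> C\<^sup>2 * (norm (G k x - g x))\<^sup>2"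
          using assms(4)[of k]
        proof eventually_elim
          case (elim x)
          then have "(norm (F k x - f x))\<^sup>2 \<le> (C * norm (G k x - g x))\<^sup>2" by (intro power_mono) auto
          then show ?case by (simp add: power_mult_distrib)
        qed
      qed (use l2 assms(1,2) in \<open>auto intro!: l2_integrable l2_diff\<close>)
      then show ?thesis by simp
    qed
    then show "\<forall>\<^sub>F k in sequentially. (\<integral>x. (norm (F k x - f x))\<^sup>2 \<partial>M) \<le> C\<^sup>2 * (\<integral>x. (norm (G k x - g x))\<^sup>2 \<partial>M)"
      by simp
  qed auto
qed

lemma l2_lim_add:
  assumes "l2_lim M F f" "l2_lim M G g"
  shows "l2_lim M (\<lambda>k x. F k x + G k x) (\<lambda>x. f x + g x)"
  unfolding l2_lim_def
proof (intro conjI allI)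
  have l2: "l2 M (F k)" "l2 M f" "l2 M (G k)" "l2 M g" for k
    using assms by (auto simp: l2_lim_def)
  then show "l2 M (\<lambda>x. F k x + G k x)" "l2 M (\<lambda>x. f x + g x)" for k by (auto intro: l2_add)
  show "(\<lambda>k. \<integral>x. (norm (F k x + G k x - (f x + g x)))\<^sup>2 \<partial>M) \<longlonglongrightarrow> 0"
  proof (rule tendsto_sandwich[OF _ _ tendsto_const])
    have "(\<lambda>k. 2 * (\<integral>x. (norm (F k x - f x))\<^sup>2 \<partial>M) + 2 * (\<integral>x. (norm (G k x - g x))\<^sup>2 \<partial>M)) \<longlonglongrightarrow> 2 * 0 + 2 * 0"
      using assms by (intro tendsto_intros) (auto simp: l2_lim_def)
    then show "(\<lambda>k. 2 * (\<integral>x. (norm (F k x - f x))\<^sup>2 \<partial>M) + 2 * (\<integral>x. (norm (G k x - g x))\<^sup>2 \<partial>M)) \<longlonglongrightarrow> 0" by simp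
    have "(\<integral>x. (norm (F k x + G k x - (f x + g x)))\<^sup>2 \<partial>M)
        \<le> 2 * (\<integral>x. (norm (F k x - f x))\<^sup>2 \<partial>M) + 2 * (\<integral>x. (norm (G k x - g x))\<^sup>2 \<partial>M)" for k
    proof -
      have i: "integrable M (\<lambda>x. (norm (F k x - f x))\<^sup>2)" "integrable M (\<lambda>x. (norm (G k x - g x))\<^sup>2)"
        using l2 by (auto intro!: l2_integrable l2_diff)
      have "(\<integral>x. (norm (F k x + G k x - (f x + g x)))\<^sup>2 \<partial>M)
          \<le> (\<integral>x. 2 * (norm (F k x - f x))\<^sup>2 + 2 * (norm (G k x - g x))\<^sup>2 \<partial>M)"
      proof (rule integral_mono)
        show "integrable M (\<lambda>x. (norm (F k x + G k x - (f x + g x)))\<^sup>2)"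
          using l2 by (auto intro!: l2_integrable l2_diff l2_add)
        show "(norm (F k x + G k x - (f x + g x)))\<^sup>2
            \<le> 2 * (norm (F k x - f x))\<^sup>2 + 2 * (norm (G k x - g x))\<^sup>2" for x
          using power2_norm_add_le[of "F k x - f x" "G k x - g x"] by (simp add: algebra_simps)
      qed (use i in auto)
      then show ?thesis using i by simp
    qed
    then show "\<forall>\<^sub>F k in sequentially. (\<integral>x. (norm (F k x + G k x - (f x + g x)))\<^sup>2 \<partial>M)
        \<le> 2 * (\<integral>x. (norm (F k x - f x))\<^sup>2 \<partial>M) + 2 * (\<integral>x. (norm (G k x - g x))\<^sup>2 \<partial>M)" by simp
  qed auto
qed

lemma l2_lim_scaleR:
  assumes "l2_lim M F f"
  shows "l2_lim M (\<lambda>k x. c *\<^sub>R F k x) (\<lambda>x. c *\<^sub>R f x)"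
  by (rule l2_lim_bound[OF _ _ assms, where C = "\<bar>c\<bar>"])
    (use assms in \<open>auto simp: scaleR_diff_right[symmetric] l2_lim_def intro!: l2_scaleR\<close>)

lemma l2_lim_subseq: "l2_lim M F f \<Longrightarrow> strict_mono r \<Longrightarrow> l2_lim M (\<lambda>k. F (r k)) f"
  unfolding l2_lim_def using LIMSEQ_subseq_LIMSEQ by (fastforce simp: o_def)

lemma l2_lim_AE_subseq:
  assumes "l2_lim M F f"
  obtains r where "strict_mono r" "AE x in M. (\<lambda>k. F (r k) x) \<longlonglongrightarrow> f x"
proof -
  have "\<exists>r. strict_mono r \<and> (AE x in M. (\<lambda>k. (norm (F (r k) x - f x))\<^sup>2) \<longlonglongrightarrow> 0)"
    using assms by (intro tendsto_L1_AE_subseq) (auto simp: l2_lim_def intro!: l2_integrable l2_diff)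
  then obtain r where r: "strict_mono r" "AE x in M. (\<lambda>k. (norm (F (r k) x - f x))\<^sup>2) \<longlonglongrightarrow> 0" by blast
  have "AE x in M. (\<lambda>k. F (r k) x) \<longlonglongrightarrow> f x"
    using r(2)
  proof eventually_elim
    case (elim x)
    then have "(\<lambda>k. sqrt ((norm (F (r k) x - f x))\<^sup>2)) \<longlonglongrightarrow> sqrt 0" by (rule tendsto_real_sqrt)
    then show ?case by (simp add: tendsto_norm_zero_iff LIM_zero_cancel)
  qed
  with r(1) show ?thesis using that by blast
qed

text \<open>The limit inherits the bound \<open>norm (h x)\<close>, so the squared errors are
  dominated by \<open>4 * (norm (h x))\<^sup>2\<close>.\<close>

lemma l2_lim_dominated:
  assumes "l2 M h" "\<And>k. F k \<in> borel_measurable M" "f \<in> borel_measurable M"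
    and "\<And>k. AE x in M. norm (F k x) \<le> norm (h x)" "AE x in M. (\<lambda>k. F k x) \<longlonglongrightarrow> f x"
  shows "l2_lim M F f"
  unfolding l2_lim_def
proof (intro conjI allI)
  note [measurable] = assms(2,3)
  show lF: "l2 M (F k)" for k using assms(4) by (intro l2_mono[OF assms(1,2), where C = 1]) auto
  have "AE x in M. \<forall>k. norm (F k x) \<le> norm (h x)" using assms(4) by (simp add: AE_all_countable)
  with assms(5) have fb: "AE x in M. norm (f x) \<le> norm (h x)"
    by eventually_elim (blast intro: Lim_norm_ubound[OF sequentially_bot] always_eventually)
  then show lf: "l2 M f" by (intro l2_mono[OF assms(1,3), where C = 1]) auto
  have "(\<lambda>k. \<integral>x. (norm (F k x - f x))\<^sup>2 \<partial>M) \<longlonglongrightarrow> (\<integral>x. 0 \<partial>M)"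
  proof (rule integral_dominated_convergence)
    show "integrable M (\<lambda>x. 4 * (norm (h x))\<^sup>2)" using assms(1) by (auto simp: l2_def)
    show "AE x in M. (\<lambda>k. (norm (F k x - f x))\<^sup>2) \<longlonglongrightarrow> 0"
      using assms(5)
    proof eventually_elim
      case (elim x)
      then have "(\<lambda>k. (norm (F k x - f x))\<^sup>2) \<longlonglongrightarrow> (norm (f x - f x))\<^sup>2" by (intro tendsto_intros)
      then show ?case by simp
    qed
    show "AE x in M. norm ((norm (F k x - f x))\<^sup>2) \<le> 4 * (norm (h x))\<^sup>2" for k
      using assms(4)[of k] fb
    proof eventually_elim
      case (elim x)
      have "norm (F k x - f x) \<le> 2 * norm (h x)"
        using norm_triangle_ineq4[of "F k x" "f x"] elim by linarith
      then have "(norm (F k x - f x))\<^sup>2 \<le> (2 * norm (h x))\<^sup>2" by (intro power_mono) auto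
      then show ?case by (simp add: power_mult_distrib)
    qed
  qed auto
  then show "(\<lambda>k. \<integral>x. (norm (F k x - f x))\<^sup>2 \<partial>M) \<longlonglongrightarrow> 0" by simp
qed

text \<open>In \<open>H k F k - h f = H k (F k - f) + (H k - h) f\<close> the first term is small
  because \<open>H k\<close> is bounded by \<open>B\<close>, the second by dominated convergence
  with majorant \<open>B f\<close>. The bounded factors are later the cut-offs with their gradients,
  and the cosine in the chain rule.\<close>

lemma l2_lim_mult_bounded:
  assumes "l2_lim M F f" "\<And>k. H k \<in> borel_measurable M" "h \<in> borel_measurable M"
    and "\<And>k x. \<bar>H k x\<bar> \<le> B" "AE x in M. (\<lambda>k. H k x) \<longlonglongrightarrow> h x"
  shows "l2_lim M (\<lambda>k x. H k x *\<^sub>R F k x) (\<lambda>x. h x *\<^sub>R f x)"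
proof -
  note [measurable] = assms(2,3)
  have [measurable]: "f \<in> borel_measurable M" using assms(1) by (auto simp: l2_lim_def l2_def)
  have l2: "l2 M (F k)" "l2 M f" for k using assms(1) by (auto simp: l2_lim_def)
  have B: "norm (H k x *\<^sub>R y) \<le> B * norm y" for k x y
    using assms(4) by (auto intro!: mult_right_mono)
  have "l2_lim M (\<lambda>k x. H k x *\<^sub>R (F k x - f x)) (\<lambda>x. 0)"
    by (rule l2_lim_bound[OF _ _ assms(1), where C = B])
      (use B l2 assms in \<open>auto intro!: l2_bounded_mult l2_diff\<close>)
  moreover have "l2_lim M (\<lambda>k x. H k x *\<^sub>R f x) (\<lambda>x. h x *\<^sub>R f x)"
  proof (rule l2_lim_dominated)
    show "l2 M (\<lambda>x. B *\<^sub>R f x)" using l2 by (intro l2_scaleR)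
    show "AE x in M. norm (H k x *\<^sub>R f x) \<le> norm (B *\<^sub>R f x)" for k
    proof (rule AE_I2)
      show "norm (H k x *\<^sub>R f x) \<le> norm (B *\<^sub>R f x)" for x
        using B[of k x "f x"] mult_right_mono[OF abs_ge_self[of B], of "norm (f x)"] by simp
    qed
    show "AE x in M. (\<lambda>k. H k x *\<^sub>R f x) \<longlonglongrightarrow> h x *\<^sub>R f x"
      using assms(5) by eventually_elim (intro tendsto_intros)
  qed measurable
  ultimately show ?thesis using l2_lim_add by (fastforce simp: algebra_simps)
qed

section \<open>Test functions\<close>

lemma test_functionsI:
  assumes "\<And>k. Ck k \<eta>" "compact S" "S \<subseteq> \<Omega>" "\<And>x. x \<notin> S \<Longrightarrow> \<eta> x = 0"
  shows "\<eta> \<in> test_functions \<Omega>"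
proof -
  have *: "closure {x. \<eta> x \<noteq> 0} \<subseteq> S"
    using assms(2,4) by (intro closure_minimal) (auto dest: compact_imp_closed)
  have "compact (S \<inter> closure {x. \<eta> x \<noteq> 0})" using assms(2) by (intro compact_Int_closed) auto
  then show ?thesis
    using * assms(1,3) by (auto simp: test_functions_def Int_absorb1)
qed

lemma test_functionsE:
  assumes "\<eta> \<in> test_functions \<Omega>"
  obtains S where "compact S" "S \<subseteq> \<Omega>" "\<And>x. x \<notin> S \<Longrightarrow> \<eta> x = 0" "\<And>x. x \<notin> S \<Longrightarrow> gradient \<eta> x = 0"
proof
  let ?S = "closure {x. \<eta> x \<noteq> 0}"
  show "compact ?S" "?S \<subseteq> \<Omega>" using assms by (auto simp: test_functions_def)
  show 0: "\<eta> x = 0" if "x \<notin> ?S" for x using that closure_subset[of "{x. \<eta> x \<noteq> 0}"] by auto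
  show "gradient \<eta> x = 0" if "x \<notin> ?S" for x
  proof (rule gradient_eqI)
    have "(\<eta> has_derivative (\<lambda>_. 0)) (at x)"
    proof (rule has_derivative_transform_within_open)
      show "((\<lambda>_. 0 :: real) has_derivative (\<lambda>_. 0)) (at x)" by (rule has_derivative_const)
      show "open (- ?S)" "x \<in> - ?S" using that by auto
      show "0 = \<eta> y" if "y \<in> - ?S" for y using 0[of y] that by simp
    qed
    then show "(\<eta> has_derivative (\<lambda>h. 0 \<bullet> h)) (at x)" by simp
  qed
qed

lemma test_functions_Ck: "\<eta> \<in> test_functions \<Omega> \<Longrightarrow> Ck k \<eta>"
  by (simp add: test_functions_def)

lemma test_functions_gradient:
  assumes "\<eta> \<in> test_functions \<Omega>"
  shows "(\<lambda>x. gradient \<eta> x $ i) \<in> test_functions \<Omega>"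
proof -
  obtain S where S: "compact S" "S \<subseteq> \<Omega>" "\<And>x. x \<notin> S \<Longrightarrow> gradient \<eta> x = 0"
    using assms by (rule test_functionsE) blast
  show ?thesis
    by (rule test_functionsI[OF _ S(1,2)])
      (use S(3) test_functions_Ck[OF assms, of "Suc _"] in auto)
qed

lemma test_functions_mult:
  assumes "\<eta> \<in> test_functions \<Omega>" "\<And>k. Ck k f"
  shows "(\<lambda>x. f x * \<eta> x) \<in> test_functions \<Omega>"
proof -
  obtain S where S: "compact S" "S \<subseteq> \<Omega>" "\<And>x. x \<notin> S \<Longrightarrow> \<eta> x = 0"
    using assms(1) by (rule test_functionsE) blast
  show ?thesis
    by (rule test_functionsI[OF _ S(1,2)])
      (simp_all add: S(3) Ck_mult[OF assms(2) test_functions_Ck[OF assms(1)]])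
qed

lemma test_functions_add:
  assumes "\<eta> \<in> test_functions \<Omega>" "\<zeta> \<in> test_functions \<Omega>"
  shows "(\<lambda>x. \<eta> x + \<zeta> x) \<in> test_functions \<Omega>"
proof -
  obtain S where S: "compact S" "S \<subseteq> \<Omega>" "\<And>x. x \<notin> S \<Longrightarrow> \<eta> x = 0"
    using assms(1) by (rule test_functionsE) blast
  obtain T where T: "compact T" "T \<subseteq> \<Omega>" "\<And>x. x \<notin> T \<Longrightarrow> \<zeta> x = 0"
    using assms(2) by (rule test_functionsE) blast
  show ?thesis
    by (rule test_functionsI[of _ "S \<union> T"])
      (use S T in \<open>auto intro: Ck_add[OF assms[THEN test_functions_Ck]]\<close>)
qed

lemma test_functions_mono: "\<Omega> \<subseteq> \<Omega>' \<Longrightarrow> test_functions \<Omega> \<subseteq> test_functions \<Omega>'"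
  by (auto simp: test_functions_def)

lemma Ck_reflect:
  fixes f :: "real ^ 'N \<Rightarrow> real"
  assumes "Ck k f"
  shows "Ck k (\<lambda>y. f (x - y))"
  using assms
proof (induction k arbitrary: f)
  case 0
  then have "continuous_on UNIV f" by simp
  then have "continuous_on UNIV (\<lambda>y. f (x - y))"
    by (rule continuous_on_compose2) (simp_all add: continuous_on_diff)
  then show ?case by simp
next
  case (Suc k)
  show ?case
  proof (rule Ck_SucI[where G = "\<lambda>y. (- 1) *\<^sub>R gradient f (x - y)"])
    show "((\<lambda>y. f (x - y)) has_derivative (\<lambda>h. ((- 1) *\<^sub>R gradient f (x - y)) \<bullet> h)) (at y)" for y
    proof -
      have "((\<lambda>y. x - y) has_derivative (\<lambda>h. - h)) (at y)" by (auto intro!: derivative_eq_intros)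
      from has_derivative_compose[OF this has_derivative_gradient[OF Ck_differentiable[OF Suc.prems]]]
      show ?thesis by simp
    qed
    have "Ck k (\<lambda>y. gradient f (x - y) $ i)" for i using Suc.IH[of "\<lambda>x. gradient f x $ i"] Suc.prems by simp
    from Ck_mult[OF Ck_const[of k "- 1"] this] show "Ck k (\<lambda>y. ((- 1) *\<^sub>R gradient f (x - y)) $ i)" for i by simp
  qed
qed

lemma gradient_reflect:
  fixes f :: "real ^ 'N \<Rightarrow> real"
  assumes "f differentiable (at (x - y))"
  shows "gradient (\<lambda>y. f (x - y)) y = - gradient f (x - y)"
proof (rule gradient_eqI)
  have "((\<lambda>y. x - y) has_derivative (\<lambda>h. - h)) (at y)" by (auto intro!: derivative_eq_intros)
  from has_derivative_compose[OF this has_derivative_gradient[OF assms]]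
  show "((\<lambda>y. f (x - y)) has_derivative (\<lambda>h. (- gradient f (x - y)) \<bullet> h)) (at y)" by simp
qed

lemma continuous_on_gradient:
  assumes "Ck (Suc 0) f"
  shows "continuous_on UNIV (gradient f)"
  using assms continuous_on_vec_lambda[of UNIV "\<lambda>i x. gradient f x $ i"] by simp

lemma continuous_compact_support_bounded:
  fixes f :: "'a :: euclidean_space \<Rightarrow> 'b :: real_normed_vector"
  assumes "continuous_on UNIV f" "compact S" "\<And>x. x \<notin> S \<Longrightarrow> f x = 0"
  obtains B where "B \<ge> 0" "\<And>x. norm (f x) \<le> B"
proof -
  have "bounded (f ` S)"
    using assms by (intro compact_imp_bounded compact_continuous_image) (auto intro: continuous_on_subset)
  then obtain B where "\<forall>y \<in> f ` S. norm y \<le> B" unfolding bounded_iff by blast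
  then have "norm (f x) \<le> max B 0" for x
    using assms(3) by (cases "x \<in> S") (auto simp: max.coboundedI1)
  then show ?thesis using that[of "max B 0"] by simp
qed

text \<open>Compactness handles the ball of radius \<open>R + 1\<close>. If one of two points at
  distance below 1 lies outside this ball, then both have norm above \<open>R\<close>, where the
  function vanishes.\<close>

lemma continuous_compact_support_uniformly:
  fixes f :: "'a :: euclidean_space \<Rightarrow> 'b :: real_normed_vector"
  assumes "continuous_on UNIV f" "\<And>x. norm x > R \<Longrightarrow> f x = 0" "e > 0"
  obtains d where "d > 0" "\<And>x y. norm (x - y) < d \<Longrightarrow> norm (f x - f y) < e"
proof -
  have "uniformly_continuous_on (cball 0 (R + 1)) f"
    using assms(1) by (intro compact_uniformly_continuous) (auto intro: continuous_on_subset)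
  then obtain d where d: "d > 0"
    "\<forall>x \<in> cball 0 (R + 1). \<forall>y \<in> cball 0 (R + 1). dist y x < d \<longrightarrow> dist (f y) (f x) < e"
    using assms(3) unfolding uniformly_continuous_on_def by blast
  have "norm (f x - f y) < e" if "norm (x - y) < min d 1" for x y
  proof (cases "norm x \<le> R + 1 \<and> norm y \<le> R + 1")
    case True
    then show ?thesis using d(2)[rule_format, of y x] that by (simp add: dist_norm)
  next
    case False
    have "norm x - norm y < 1" "norm y - norm x < 1"
      using that norm_triangle_ineq2[of x y] norm_triangle_ineq2[of y x] by (auto simp: norm_minus_commute)
    then have "norm x > R" "norm y > R" using False by auto
    then show ?thesis using assms by simp
  qed
  then show ?thesis using that[of "min d 1"] d(1) by simp
qed

section \<open>Mollification\<close>

lemma lborel_integral_translate: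
  fixes f :: "'a :: euclidean_space \<Rightarrow> real"
  assumes [measurable]: "f \<in> borel_measurable borel"
  shows "(\<integral>x. f (x - w) \<partial>lborel) = (\<integral>x. f x \<partial>lborel)"
    and "integrable lborel (\<lambda>x. f (x - w)) \<longleftrightarrow> integrable lborel f"
proof -
  have "(\<integral>x. f x \<partial>lborel) = (\<integral>x. f x \<partial>distr lborel borel ((+) (- w)))"
    "integrable lborel f \<longleftrightarrow> integrable (distr lborel borel ((+) (- w))) f"
    by (simp_all only: lborel_distr_plus)
  moreover have "(\<integral>x. f x \<partial>distr lborel borel ((+) (- w))) = (\<integral>x. f (x - w) \<partial>lborel)"
    "integrable (distr lborel borel ((+) (- w))) f \<longleftrightarrow> integrable lborel (\<lambda>x. f (x - w))"
    by (simp_all add: integral_distr integrable_distr_eq)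
  ultimately show "(\<integral>x. f (x - w) \<partial>lborel) = (\<integral>x. f x \<partial>lborel)"
    "integrable lborel (\<lambda>x. f (x - w)) \<longleftrightarrow> integrable lborel f"
    by argo+
qed

lemma lborel_integral_reflect:
  fixes f :: "'a :: euclidean_space \<Rightarrow> real"
  assumes [measurable]: "f \<in> borel_measurable borel"
  shows "(\<integral>y. f (x - y) \<partial>lborel) = (\<integral>y. f y \<partial>lborel)"
    and "integrable lborel (\<lambda>y. f (x - y)) \<longleftrightarrow> integrable lborel f"
proof -
  have L: "distr lborel borel (\<lambda>y. x - y :: 'a) = lborel"
    using lborel_affine[of "-1" x, symmetric] by (simp add: density_1)
  have "(\<integral>y. f y \<partial>lborel) = (\<integral>y. f y \<partial>distr lborel borel (\<lambda>y. x - y))"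
    "integrable lborel f \<longleftrightarrow> integrable (distr lborel borel (\<lambda>y. x - y)) f"
    by (simp_all only: L)
  moreover have "(\<integral>y. f y \<partial>distr lborel borel (\<lambda>y. x - y)) = (\<integral>y. f (x - y) \<partial>lborel)"
    "integrable (distr lborel borel (\<lambda>y. x - y)) f \<longleftrightarrow> integrable lborel (\<lambda>y. f (x - y))"
    by (simp_all add: integral_distr integrable_distr_eq)
  ultimately show "(\<integral>y. f (x - y) \<partial>lborel) = (\<integral>y. f y \<partial>lborel)"
    "integrable lborel (\<lambda>y. f (x - y)) \<longleftrightarrow> integrable lborel f"
    by argo+
qed

definition clamp1 :: "real \<Rightarrow> real \<Rightarrow> real" where
  "clamp1 n t = max (- n) (min n t)"

lemma l2_indicator_cball: "l2 lborel (\<lambda>x :: 'a :: euclidean_space. indicator (cball a r) x :: real)"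
proof -
  have "(\<lambda>x :: 'a. (norm (indicator (cball a r) x :: real))\<^sup>2) = indicator (cball a r)"
    by (auto simp: indicator_def)
  then show ?thesis
    using emeasure_bounded_finite[OF bounded_cball, of a r]
    by (simp only: l2_def) (auto simp: integrable_indicator_iff intro!: borel_measurable_indicator)
qed

text \<open>Truncating the values and the support of \<open>f\<close> costs little in mean square.
  What remains is bounded with bounded support and is an almost everywhere limit of continuous
  functions; clamping these and cutting them off makes them dominated by a multiple of an indicator,
  so the limit holds in mean square as well.\<close>

lemma l2_dense_Cc:
  fixes f :: "'a :: euclidean_space \<Rightarrow> real"
  assumes "l2 lborel f" "e > 0"
  obtains \<phi> R where "continuous_on UNIV \<phi>" "\<And>x. norm x > R \<Longrightarrow> \<phi> x = 0" "l2 lborel \<phi>"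
    "(\<integral>x. (f x - \<phi> x)\<^sup>2 \<partial>lborel) < e"
proof -
  have [measurable]: "f \<in> borel_measurable borel" using assms by (simp add: l2_def)
  define f1 where "f1 n x = clamp1 (real n) (f x) * indicator (cball 0 (real n)) x" for n :: nat and x
  have "l2_lim lborel f1 f"
  proof (rule l2_lim_dominated[OF assms(1)])
    show "f1 n \<in> borel_measurable lborel" for n unfolding f1_def clamp1_def
      by (intro borel_measurable_times borel_measurable_indicator borel_measurable_max borel_measurable_min) auto
    show "AE x in lborel. norm (f1 n x) \<le> norm (f x)" for n
      by (auto simp: f1_def clamp1_def indicator_def)
    have "(\<lambda>n. f1 n x) \<longlonglongrightarrow> f x" for x
    proof (rule tendsto_eventually)
      obtain m :: nat where m: "real m > \<bar>f x\<bar> + norm x" using reals_Archimedean2 by blast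
      have "f1 n x = f x" if "n \<ge> m" for n
      proof -
        have "real n \<ge> real m" using that by simp
        then have "\<bar>f x\<bar> \<le> real n" "norm x \<le> real n" using m norm_ge_zero[of x] abs_ge_zero[of "f x"] by linarith+
        then show ?thesis by (auto simp: f1_def clamp1_def indicator_def)
      qed
      then show "\<forall>\<^sub>F n in sequentially. f1 n x = f x" using eventually_sequentially by blast
    qed
    then show "AE x in lborel. (\<lambda>n. f1 n x) \<longlonglongrightarrow> f x" by simp
  qed simp
  then have "(\<lambda>n. \<integral>x. (norm (f1 n x - f x))\<^sup>2 \<partial>lborel) \<longlonglongrightarrow> 0" by (simp add: l2_lim_def)
  then obtain n where n: "(\<integral>x. (f1 n x - f x)\<^sup>2 \<partial>lborel) < e / 4"
    using order_tendstoD(2)[of _ 0 _ "e/4"] assms(2) eventually_sequentially by fastforce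
  have lf1: "l2 lborel (f1 n)" using \<open>l2_lim lborel f1 f\<close> by (rule l2_lim_l2)
  have "f1 n \<in> borel_measurable (lebesgue_on UNIV)"
    using l2_measurable[OF lf1] by (simp add: lebesgue_on_UNIV_eq measurable_completion)
  \<comment> \<open>The predicate \<open>measurable_on\<close> asserts precisely the pointwise
    approximation by continuous functions off a negligible set.\<close>
  then have "f1 n measurable_on UNIV"
    using measurable_on_iff_borel_measurable[of UNIV "f1 n"] by simp
  then obtain N g where g: "negligible N" "\<And>k. continuous_on UNIV (g k :: 'a \<Rightarrow> real)"
    "\<And>x. x \<notin> N \<Longrightarrow> (\<lambda>k. g k x) \<longlonglongrightarrow> f1 n x"
    unfolding measurable_on_def by auto
  \<comment> \<open>A continuous cut-off that equals 1 on \<open>cball 0 (real n)\<close>, the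
    carrier of \<open>f1 n\<close>, and 0 beyond radius \<open>n + 1\<close>.\<close>
  define c where "c x = max 0 (min 1 (real n + 1 - norm x))" for x :: 'a
  define \<phi> where "\<phi> k x = clamp1 (real n) (g k x) * c x" for k x
  have cont: "continuous_on UNIV (\<phi> k)" for k
    unfolding \<phi>_def c_def clamp1_def by (intro continuous_intros g)
  then have meas: "\<phi> k \<in> borel_measurable lborel" for k
    using borel_measurable_continuous_onI by auto
  have lind: "l2 lborel (\<lambda>x :: 'a. real n * indicator (cball 0 (real n + 1)) x)"
    by (rule l2_scale[OF l2_indicator_cball])
  have lim2: "l2_lim lborel \<phi> (f1 n)"
  proof (rule l2_lim_dominated[OF lind meas l2_measurable[OF lf1]])
    show "AE x in lborel. norm (\<phi> k x) \<le> norm (real n * indicator (cball 0 (real n + 1)) x)" for k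
    proof (rule AE_I2)
      fix x :: 'a
      have "\<bar>clamp1 (real n) (g k x)\<bar> \<le> real n" "0 \<le> c x" "c x \<le> 1" by (auto simp: clamp1_def c_def)
      then have "\<bar>clamp1 (real n) (g k x)\<bar> * \<bar>c x\<bar> \<le> real n * 1" by (intro mult_mono) auto
      moreover have "c x = 0" if "norm x > real n + 1" using that by (simp add: c_def)
      ultimately show "norm (\<phi> k x) \<le> norm (real n * indicator (cball 0 (real n + 1)) x)"
        by (auto simp: \<phi>_def abs_mult indicator_def)
    qed
    have "(\<lambda>k. \<phi> k x) \<longlonglongrightarrow> f1 n x" if "x \<notin> N" for x
    proof -
      have "(\<lambda>k. \<phi> k x) \<longlonglongrightarrow> clamp1 (real n) (f1 n x) * c x"
        unfolding \<phi>_def clamp1_def by (intro tendsto_intros g that)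
      also have "clamp1 (real n) (f1 n x) * c x = f1 n x"
        by (auto simp: f1_def clamp1_def c_def indicator_def)
      finally show ?thesis .
    qed
    moreover have "AE x in lborel. x \<notin> N"
    proof -
      have "AE x in lebesgue. x \<notin> N"
        using g(1) by (simp add: negligible_iff_null_sets AE_not_in)
      then show ?thesis by (simp add: AE_completion_iff)
    qed
    ultimately show "AE x in lborel. (\<lambda>k. \<phi> k x) \<longlonglongrightarrow> f1 n x" by auto
  qed
  then have "(\<lambda>k. \<integral>x. (norm (\<phi> k x - f1 n x))\<^sup>2 \<partial>lborel) \<longlonglongrightarrow> 0" by (simp add: l2_lim_def)
  then obtain k where k: "(\<integral>x. (\<phi> k x - f1 n x)\<^sup>2 \<partial>lborel) < e / 4"
    using order_tendstoD(2)[of _ 0 _ "e/4"] assms(2) eventually_sequentially by fastforce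
  have l\<phi>: "l2 lborel (\<phi> k)" using lim2 by (rule l2_lim_l2)
  have "(\<integral>x. (f x - \<phi> k x)\<^sup>2 \<partial>lborel) \<le> (\<integral>x. 2 * (f1 n x - f x)\<^sup>2 + 2 * (\<phi> k x - f1 n x)\<^sup>2 \<partial>lborel)"
  proof (rule integral_mono)
    show "integrable lborel (\<lambda>x. (f x - \<phi> k x)\<^sup>2)"
      "integrable lborel (\<lambda>x. 2 * (f1 n x - f x)\<^sup>2 + 2 * (\<phi> k x - f1 n x)\<^sup>2)"
      using l2_integrable[OF l2_diff[OF assms(1) l\<phi>]] l2_integrable[OF l2_diff[OF lf1 assms(1)]]
        l2_integrable[OF l2_diff[OF l\<phi> lf1]] by auto
    show "(f x - \<phi> k x)\<^sup>2 \<le> 2 * (f1 n x - f x)\<^sup>2 + 2 * (\<phi> k x - f1 n x)\<^sup>2" for x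
      using power2_norm_add_le[of "f x - f1 n x" "f1 n x - \<phi> k x"] by (simp add: power2_commute)
  qed
  also have "\<dots> = 2 * (\<integral>x. (f1 n x - f x)\<^sup>2 \<partial>lborel) + 2 * (\<integral>x. (\<phi> k x - f1 n x)\<^sup>2 \<partial>lborel)"
    using l2_integrable[OF l2_diff[OF lf1 assms(1)]] l2_integrable[OF l2_diff[OF l\<phi> lf1]] by simp
  also have "\<dots> < e" using n k by simp
  finally have "(\<integral>x. (f x - \<phi> k x)\<^sup>2 \<partial>lborel) < e" .
  moreover have "\<phi> k x = 0" if "norm x > real n + 1" for x using that by (simp add: \<phi>_def c_def)
  ultimately show ?thesis using that[OF cont _ l\<phi>] by blast
qed

text \<open>Convolutions are needed both for square integrable functions and for the constant 1.
  Local integrability covers the two, and it suffices for integration against a test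
  function.\<close>

definition loc_int :: "('a :: euclidean_space \<Rightarrow> real) \<Rightarrow> bool" where
  "loc_int f \<longleftrightarrow> f \<in> borel_measurable borel
     \<and> (\<forall>r. integrable lborel (\<lambda>x. indicator (cball 0 r) x * f x))"

lemma loc_int_l2: "l2 lborel f \<Longrightarrow> loc_int f"
  using integrable_mult[OF l2_indicator_cball] by (auto simp: loc_int_def l2_def)

lemma loc_int_const: "loc_int (\<lambda>x :: 'a :: euclidean_space. c)"
proof -
  have "integrable lborel (indicator (cball 0 r) :: 'a \<Rightarrow> real)" for r
    using emeasure_bounded_finite[OF bounded_cball, of "0 :: 'a" r]
    by (auto simp: integrable_indicator_iff)
  then show ?thesis unfolding loc_int_def by auto
qed

lemma loc_int_mult:
  assumes "loc_int f" "h \<in> borel_measurable borel" "\<And>x. \<bar>h x\<bar> \<le> B" "\<And>x. norm x > r \<Longrightarrow> h x = 0"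
  shows "integrable lborel (\<lambda>x. h x * f x)"
proof (rule Bochner_Integration.integrable_bound)
  show "integrable lborel (\<lambda>x. B * (indicator (cball 0 r) x * f x))"
    using assms(1) by (auto simp: loc_int_def)
  show "(\<lambda>x. h x * f x) \<in> borel_measurable lborel"
    using assms(1,2) by (auto simp: loc_int_def)
  show "AE x in lborel. norm (h x * f x) \<le> norm (B * (indicator (cball 0 r) x * f x))"
  proof (rule AE_I2)
    fix x
    have "\<bar>h x\<bar> * \<bar>f x\<bar> \<le> \<bar>B\<bar> * \<bar>f x\<bar>"
      using assms(3)[of x] by (intro mult_right_mono) auto
    then show "norm (h x * f x) \<le> norm (B * (indicator (cball 0 r) x * f x))"
      using assms(4)[of x] by (auto simp: abs_mult indicator_def)
  qed
qed

lemma test_functionsE_norm: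
  assumes "\<eta> \<in> test_functions \<Omega>"
  obtains R where "R \<ge> 0" "\<And>x. norm x > R \<Longrightarrow> \<eta> x = 0" "\<And>x. norm x > R \<Longrightarrow> gradient \<eta> x = 0"
proof -
  obtain S where S: "compact S" "S \<subseteq> \<Omega>" "\<And>x. x \<notin> S \<Longrightarrow> \<eta> x = 0" "\<And>x. x \<notin> S \<Longrightarrow> gradient \<eta> x = 0"
    using test_functionsE[OF assms] by metis
  obtain R where "\<forall>x \<in> S. norm x \<le> R" using compact_imp_bounded[OF S(1)] by (auto simp: bounded_iff)
  then have "x \<notin> S" if "norm x > max R 0" for x using that by force
  then show ?thesis using that[of "max R 0"] S by simp
qed

lemma test_functions_bounded:
  assumes "\<eta> \<in> test_functions \<Omega>"
  obtains B where "B \<ge> 0" "\<And>x. \<bar>\<eta> x\<bar> \<le> B"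
proof -
  obtain S where S: "compact S" "\<And>x. x \<notin> S \<Longrightarrow> \<eta> x = 0"
    using test_functionsE[OF assms] by metis
  have "continuous_on UNIV \<eta>" using test_functions_Ck[OF assms] by (rule Ck_continuous)
  from continuous_compact_support_bounded[OF this S] show ?thesis using that by auto
qed

lemma test_functions_borel: "\<eta> \<in> test_functions \<Omega> \<Longrightarrow> \<eta> \<in> borel_measurable borel"
  by (intro borel_measurable_continuous_onI Ck_continuous test_functions_Ck)

lemma test_functions_reflect:
  assumes "K \<in> test_functions UNIV"
  shows "(\<lambda>y. K (x - y)) \<in> test_functions UNIV"
proof -
  obtain R where R: "\<And>z. norm z > R \<Longrightarrow> K z = 0" using test_functionsE_norm[OF assms] by metis
  show ?thesis
  proof (rule test_functionsI[of _ "cball x R"])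
    show "K (x - y) = 0" if "y \<notin> cball x R" for y using R that by (simp add: dist_norm)
  qed (use assms in \<open>auto intro: Ck_reflect test_functions_Ck\<close>)
qed

section \<open>Convolution with a test function\<close>

definition conv :: "('a :: euclidean_space \<Rightarrow> real) \<Rightarrow> ('a \<Rightarrow> real) \<Rightarrow> 'a \<Rightarrow> real" where
  "conv K f x = (\<integral>y. K (x - y) * f y \<partial>lborel)"

lemma conv_integrable:
  assumes "K \<in> test_functions UNIV" "loc_int f"
  shows "integrable lborel (\<lambda>y. K (x - y) * f y)"
proof -
  note K = test_functions_reflect[OF assms(1), of x]
  obtain B where "\<And>y. \<bar>K (x - y)\<bar> \<le> B" using test_functions_bounded[OF K] by metis
  moreover obtain R where "\<And>y. norm y > R \<Longrightarrow> K (x - y) = 0" using test_functionsE_norm[OF K] by metis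
  ultimately show ?thesis by (rule loc_int_mult[OF assms(2) test_functions_borel[OF K]])
qed

text \<open>Differentiation under the integral sign. The gradient of \<open>K\<close> is uniformly
  continuous, so the linearization error of the kernel is at most \<open>e' * norm h\<close>
  uniformly in \<open>y\<close>; for \<open>norm h < 1\<close> it vanishes when \<open>y\<close> is
  outside a fixed ball, over which \<open>f\<close> is integrable.\<close>

lemma conv_has_derivative:
  fixes K :: "real ^ 'N \<Rightarrow> real"
  assumes K: "K \<in> test_functions UNIV" and f: "loc_int f"
  shows "(conv K f has_derivative (\<lambda>h. (\<chi> i. conv (\<lambda>z. gradient K z $ i) f x) \<bullet> h)) (at x)"
  unfolding has_derivative_at_alt
proof (intro conjI allI impI)
  show "bounded_linear (\<lambda>h. (\<chi> i. conv (\<lambda>z. gradient K z $ i) f x) \<bullet> h)"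
    by (rule bounded_linear_inner_right)
  fix e :: real assume "e > 0"
  obtain R where R: "R \<ge> 0" "\<And>z. norm z > R \<Longrightarrow> K z = 0" "\<And>z. norm z > R \<Longrightarrow> gradient K z = 0"
    using test_functionsE_norm[OF K] by metis
  define I where "I = (\<integral>y. indicator (cball 0 (norm x + R + 1)) y * \<bar>f y\<bar> \<partial>lborel)"
  have I: "integrable lborel (\<lambda>y. indicator (cball 0 (norm x + R + 1)) y * \<bar>f y\<bar>)"
  proof -
    have "integrable lborel (\<lambda>y. \<bar>indicator (cball 0 (norm x + R + 1)) y * f y\<bar>)"
      using f by (auto simp: loc_int_def)
    then show ?thesis by (simp add: abs_mult)
  qed
  have "I \<ge> 0" unfolding I_def by (rule Bochner_Integration.integral_nonneg) simp
  \<comment> \<open>The error integral is at most \<open>e' * norm h * I\<close>; the summand 1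
    covers the case \<open>I = 0\<close>.\<close>
  define e' where "e' = e / (I + 1)"
  have "e' > 0" using \<open>e > 0\<close> \<open>I \<ge> 0\<close> by (simp add: e'_def)
  have dK: "K differentiable (at z)" for z
    using Ck_differentiable test_functions_Ck[OF K] by blast
  obtain d where d: "d > 0" "\<And>z z'. norm (z - z') < d \<Longrightarrow> norm (gradient K z - gradient K z') < e'"
    using continuous_compact_support_uniformly[OF continuous_on_gradient R(3) \<open>e' > 0\<close>]
      test_functions_Ck[OF K] by metis
  show "\<exists>d>0. \<forall>y. norm (y - x) < d \<longrightarrow> norm (conv K f y - conv K f x -
      (\<chi> i. conv (\<lambda>z. gradient K z $ i) f x) \<bullet> (y - x)) \<le> e * norm (y - x)"
  proof (intro exI[of _ "min d 1"] conjI allI impI)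
    show "min d 1 > 0" using d(1) by simp
    fix x' assume x': "norm (x' - x) < min d 1"
    let ?h = "x' - x"
    let ?D = "\<lambda>y. K (x' - y) - K (x - y) - gradient K (x - y) \<bullet> ?h"
    have D: "\<bar>?D y\<bar> \<le> e' * norm ?h * indicator (cball 0 (norm x + R + 1)) y" for y
    proof (cases "norm y \<le> norm x + R + 1")
      case True
      have "norm (K (x' - y) - K (x - y) - gradient K (x - y) \<bullet> ((x' - y) - (x - y)))
          \<le> norm ((x' - y) - (x - y)) * e'"
      proof (rule differentiable_bound_linearization[where S = "ball (x - y) d" and f' = "\<lambda>z h. gradient K z \<bullet> h"])
        show "(x - y) + t *\<^sub>R ((x' - y) - (x - y)) \<in> ball (x - y) d" if "t \<in> {0..1}" for t
        proof -
          have "\<bar>t\<bar> * norm ?h \<le> 1 * norm ?h" using that by (intro mult_right_mono) auto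
          then show ?thesis using x' by (simp add: dist_norm)
        qed
        show "(K has_derivative (\<lambda>h. gradient K z \<bullet> h)) (at z within ball (x - y) d)" for z
          using has_derivative_gradient[OF dK] by (rule has_derivative_at_withinI)
        show "onorm ((\<lambda>h. gradient K z \<bullet> h) - (\<lambda>h. gradient K (x - y) \<bullet> h)) \<le> e'"
          if "z \<in> ball (x - y) d" for z
        proof (rule onorm_le)
          fix h :: "real ^ 'N"
          have "norm (gradient K z - gradient K (x - y)) \<le> e'"
            using d(2)[of z "x - y"] that by (simp add: dist_norm norm_minus_commute)
          then have "norm (gradient K z - gradient K (x - y)) * norm h \<le> e' * norm h"
            by (intro mult_right_mono) auto
          moreover have "norm ((gradient K z - gradient K (x - y)) \<bullet> h)
              \<le> norm (gradient K z - gradient K (x - y)) * norm h"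
            using Cauchy_Schwarz_ineq2 by simp
          ultimately show "norm (((\<lambda>h. gradient K z \<bullet> h) - (\<lambda>h. gradient K (x - y) \<bullet> h)) h) \<le> e' * norm h"
            by (simp add: inner_diff_left)
        qed
        show "x - y \<in> ball (x - y) d" using d(1) by simp
      qed
      then show ?thesis using True by (simp add: mult.commute)
    next
      case False
      have "norm y - norm x \<le> norm (x - y)" by (metis norm_minus_commute norm_triangle_ineq2)
      moreover have "norm y - norm x' \<le> norm (x' - y)" by (metis norm_minus_commute norm_triangle_ineq2)
      moreover have "norm x' - norm x \<le> norm ?h" by (rule norm_triangle_ineq2)
      ultimately have "norm (x - y) > R" "norm (x' - y) > R" using False x' by auto
      then show ?thesis using R False by simp
    qed
    have int: "integrable lborel (\<lambda>y. K (x' - y) * f y)" "integrable lborel (\<lambda>y. K (x - y) * f y)"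
      "integrable lborel (\<lambda>y. gradient K (x - y) $ i * f y)" for i
      using conv_integrable[OF K f] conv_integrable[OF test_functions_gradient[OF K] f] by blast+
    have inner: "(\<chi> i. conv (\<lambda>z. gradient K z $ i) f x) \<bullet> ?h = (\<integral>y. (gradient K (x - y) \<bullet> ?h) * f y \<partial>lborel)"
      and int': "integrable lborel (\<lambda>y. (gradient K (x - y) \<bullet> ?h) * f y)"
    proof -
      have *: "(gradient K (x - y) \<bullet> ?h) * f y = (\<Sum>i\<in>UNIV. ?h $ i * (gradient K (x - y) $ i * f y))" for y
        by (simp add: inner_vec_def sum_distrib_right sum_distrib_left mult_ac)
      show "integrable lborel (\<lambda>y. (gradient K (x - y) \<bullet> ?h) * f y)"
        unfolding * using int by auto
      show "(\<chi> i. conv (\<lambda>z. gradient K z $ i) f x) \<bullet> ?h = (\<integral>y. (gradient K (x - y) \<bullet> ?h) * f y \<partial>lborel)"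
        unfolding * using int by (simp add: inner_vec_def conv_def mult.commute)
    qed
    have "conv K f x' - conv K f x - (\<chi> i. conv (\<lambda>z. gradient K z $ i) f x) \<bullet> ?h = (\<integral>y. ?D y * f y \<partial>lborel)"
      unfolding inner unfolding conv_def using int int' by (simp add: left_diff_distrib)
    also have "norm \<dots> \<le> (\<integral>y. (e' * norm ?h) * (indicator (cball 0 (norm x + R + 1)) y * \<bar>f y\<bar>) \<partial>lborel)"
    proof (rule order_trans[OF Bochner_Integration.integral_norm_bound], rule integral_mono)
      show "integrable lborel (\<lambda>y. norm (?D y * f y))"
        using int int' by (intro integrable_norm) (auto simp: left_diff_distrib)
      show "integrable lborel (\<lambda>y. (e' * norm ?h) * (indicator (cball 0 (norm x + R + 1)) y * \<bar>f y\<bar>))"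
        using I by simp
      show "norm (?D y * f y) \<le> (e' * norm ?h) * (indicator (cball 0 (norm x + R + 1)) y * \<bar>f y\<bar>)" for y
        using mult_right_mono[OF D[of y] abs_ge_zero[of "f y"]] by (simp add: abs_mult mult_ac)
    qed
    also have "\<dots> = e' * norm ?h * I" using I by (simp add: I_def)
    also have "\<dots> \<le> e * norm ?h"
    proof -
      have "e' * I \<le> e" using \<open>e > 0\<close> \<open>I \<ge> 0\<close> by (simp add: e'_def field_simps)
      then show ?thesis using mult_right_mono[of "e' * I" e "norm ?h"] by (simp add: mult_ac)
    qed
    finally show "norm (conv K f x' - conv K f x - (\<chi> i. conv (\<lambda>z. gradient K z $ i) f x) \<bullet> ?h) \<le> e * norm ?h" .
  qed
qed

lemma gradient_conv:
  "K \<in> test_functions UNIV \<Longrightarrow> loc_int f \<Longrightarrow>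
    gradient (conv K f) x = (\<chi> i. conv (\<lambda>z. gradient K z $ i) f x)"
  by (intro gradient_eqI conv_has_derivative)

lemma Ck_conv:
  assumes "K \<in> test_functions UNIV" "loc_int f"
  shows "Ck k (conv K f)"
  using assms(1)
proof (induction k arbitrary: K)
  case 0
  have "conv K f differentiable_on UNIV"
    using conv_has_derivative[OF 0 assms(2)] by (auto simp: differentiable_on_def differentiable_def)
  then show ?case by (simp add: differentiable_imp_continuous_on)
next
  case (Suc k)
  show ?case
    by (rule Ck_SucI[OF conv_has_derivative[OF Suc.prems assms(2)]])
      (simp add: Suc.IH test_functions_gradient Suc.prems)
qed

text \<open>The convolution of \<open>\<eta>\<close> with the constant 1 is constant, so its gradient vanishes.\<close>

lemma integral_gradient_eq_0:
  assumes "\<eta> \<in> test_functions UNIV"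
  shows "(\<integral>x. gradient \<eta> x $ i \<partial>lborel) = 0"
proof -
  have c: "conv K (\<lambda>y. 1) x = (\<integral>y. K y \<partial>lborel)" if "K \<in> test_functions UNIV" for K and x :: "real ^ 'a"
    using lborel_integral_reflect(1)[OF test_functions_borel[OF that]] by (simp add: conv_def)
  have "conv \<eta> (\<lambda>y. 1) = (\<lambda>x. \<integral>y. \<eta> y \<partial>lborel)" using c[OF assms] by auto
  then have "gradient (conv \<eta> (\<lambda>y. 1)) 0 = 0" by simp
  then have "conv (\<lambda>z. gradient \<eta> z $ i) (\<lambda>y. 1) 0 = 0"
    using gradient_conv[OF assms loc_int_const[of 1], of 0] by (simp add: vec_eq_iff)
  then show ?thesis using c[OF test_functions_gradient[OF assms]] by simp
qed

lemma power2_diff_le: "(a - b)\<^sup>2 \<le> 2 * a\<^sup>2 + 2 * b\<^sup>2" for a b :: real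
  using zero_le_power2[of "a + b"] by (simp add: power2_eq_square algebra_simps)

text \<open>For continuous functions of bounded support this is uniform continuity. Such functions
  are dense, and translations preserve the norm.\<close>

lemma l2_translation_continuous:
  fixes f :: "'a :: euclidean_space \<Rightarrow> real"
  assumes f: "l2 lborel f" and "e > 0"
  obtains d where "d > 0" "\<And>w. norm w < d \<Longrightarrow> (\<integral>x. (f (x - w) - f x)\<^sup>2 \<partial>lborel) < e"
proof -
  \<comment> \<open>The approximation error enters twice with factor 4, which costs less than
    \<open>e / 2\<close>; the translation error of \<open>\<phi>\<close> enters with factor 2 and
    will be at most \<open>e / 4\<close>.\<close>
  obtain \<phi> R where \<phi>: "continuous_on UNIV \<phi>" "\<And>x. norm x > R \<Longrightarrow> \<phi> x = 0" "l2 lborel \<phi>"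
    and close: "(\<integral>x. (f x - \<phi> x)\<^sup>2 \<partial>lborel) < e / 16"
    using l2_dense_Cc[OF f, of "e / 16"] \<open>e > 0\<close> by auto
  have [measurable]: "f \<in> borel_measurable borel" "\<phi> \<in> borel_measurable borel"
    using f \<phi>(3) by (auto simp: l2_def)
  \<comment> \<open>The volume of a ball that carries \<open>\<phi> (x - w) - \<phi> x\<close> for
    all \<open>norm w < 1\<close>, enlarged by 1 to make it a safe denominator.\<close>
  define V where "V = (\<integral>x. indicator (cball (0 :: 'a) (R + 1)) x \<partial>lborel) + (1 :: real)"
  have intV: "integrable lborel (indicator (cball (0 :: 'a) (R + 1)) :: _ \<Rightarrow> real)"
    using emeasure_bounded_finite[OF bounded_cball, of "0 :: 'a" "R + 1"]
    by (auto simp: integrable_indicator_iff)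
  have "V > 0"
    unfolding V_def using Bochner_Integration.integral_nonneg[of lborel "indicator (cball (0 :: 'a) (R + 1))"]
    by (simp add: add_nonneg_pos)
  obtain d where d: "d > 0" "\<And>x y. norm (x - y) < d \<Longrightarrow> norm (\<phi> x - \<phi> y) < sqrt (e / (4 * V))"
    using continuous_compact_support_uniformly[OF \<phi>(1,2), where e = "sqrt (e / (4 * V))"] \<open>e > 0\<close> \<open>V > 0\<close> by auto
  have "(\<integral>x. (f (x - w) - f x)\<^sup>2 \<partial>lborel) < e" if w: "norm w < min d 1" for w
  proof -
    have tr: "l2 lborel (\<lambda>x. g (x - w))" if "l2 lborel g" for g :: "'a \<Rightarrow> real"
    proof -
      have [measurable]: "g \<in> borel_measurable borel" using that by (auto simp: l2_def)
      show ?thesis using that lborel_integral_translate(2)[of "\<lambda>x. (norm (g x))\<^sup>2" w]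
        by (auto simp: l2_def)
    qed
    note i = l2_integrable[OF l2_diff[OF f \<phi>(3)]]
      l2_integrable[OF tr[OF l2_diff[OF f \<phi>(3)]]] l2_integrable[OF l2_diff[OF tr[OF \<phi>(3)] \<phi>(3)]]
      l2_integrable[OF l2_diff[OF tr[OF f] f]]
    have "(\<integral>x. (f (x - w) - f x)\<^sup>2 \<partial>lborel)
        \<le> (\<integral>x. 4 * (f (x - w) - \<phi> (x - w))\<^sup>2 + 4 * (f x - \<phi> x)\<^sup>2 + 2 * (\<phi> (x - w) - \<phi> x)\<^sup>2 \<partial>lborel)"
    proof (rule integral_mono)
      fix x
      have "(f (x - w) - f x)\<^sup>2 \<le> 2 * ((f (x - w) - \<phi> (x - w)) - (f x - \<phi> x))\<^sup>2 + 2 * (\<phi> (x - w) - \<phi> x)\<^sup>2"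
        using power2_norm_add_le[of "(f (x - w) - \<phi> (x - w)) - (f x - \<phi> x)" "\<phi> (x - w) - \<phi> x"] by simp
      also have "((f (x - w) - \<phi> (x - w)) - (f x - \<phi> x))\<^sup>2 \<le> 2 * (f (x - w) - \<phi> (x - w))\<^sup>2 + 2 * (f x - \<phi> x)\<^sup>2"
        by (rule power2_diff_le)
      finally show "(f (x - w) - f x)\<^sup>2 \<le> 4 * (f (x - w) - \<phi> (x - w))\<^sup>2 + 4 * (f x - \<phi> x)\<^sup>2 + 2 * (\<phi> (x - w) - \<phi> x)\<^sup>2"
        by simp
    qed (use i in auto)
    also have "\<dots> = 4 * (\<integral>x. (f (x - w) - \<phi> (x - w))\<^sup>2 \<partial>lborel) + 4 * (\<integral>x. (f x - \<phi> x)\<^sup>2 \<partial>lborel)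
        + 2 * (\<integral>x. (\<phi> (x - w) - \<phi> x)\<^sup>2 \<partial>lborel)"
      using i by simp
    also have "(\<integral>x. (f (x - w) - \<phi> (x - w))\<^sup>2 \<partial>lborel) = (\<integral>x. (f x - \<phi> x)\<^sup>2 \<partial>lborel)"
      using lborel_integral_translate(1)[of "\<lambda>x. (f x - \<phi> x)\<^sup>2" w] by simp
    also have "(\<integral>x. (\<phi> (x - w) - \<phi> x)\<^sup>2 \<partial>lborel) \<le> (\<integral>x. e / (4 * V) * indicator (cball (0 :: 'a) (R + 1)) x \<partial>lborel)"
    proof (rule integral_mono)
      fix x
      show "(\<phi> (x - w) - \<phi> x)\<^sup>2 \<le> e / (4 * V) * indicator (cball 0 (R + 1)) x"
      proof (cases "norm x \<le> R + 1")
        case True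
        have "norm (\<phi> (x - w) - \<phi> x) < sqrt (e / (4 * V))" using d(2)[of "x - w" x] w by simp
        then have "(norm (\<phi> (x - w) - \<phi> x))\<^sup>2 \<le> (sqrt (e / (4 * V)))\<^sup>2" by (intro power_mono) auto
        then show ?thesis using True \<open>e > 0\<close> \<open>V > 0\<close> by simp
      next
        case False
        have "norm x - norm w \<le> norm (x - w)" by (rule norm_triangle_ineq2)
        then have "norm (x - w) > R" "norm x > R" using False w by auto
        then show ?thesis using \<phi>(2) False by simp
      qed
    qed (use i(3) intV in auto)
    also have "\<dots> = e / (4 * V) * (V - 1)" using intV by (simp add: V_def)
    also have "\<dots> \<le> e / 4" using \<open>V > 0\<close> \<open>e > 0\<close> by (simp add: field_simps)
    finally show ?thesis using close \<open>e > 0\<close> by simp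
  qed
  then show ?thesis using that[of "min d 1"] d(1) by simp
qed

text \<open>The difference \<open>conv K f x - f x\<close> is the average of
  \<open>f (x - w) - f x\<close> with respect to the probability density \<open>K\<close>. Jensen's
  inequality moves the square inside, and Tonelli exchanges the integrals; what is left is the
  translation error for \<open>w\<close> in the support of \<open>K\<close>.\<close>

lemma mollify_estimate:
  fixes f K :: "real ^ 'N \<Rightarrow> real"
  assumes f: "l2 lborel f" and K: "K \<in> test_functions UNIV" "\<And>z. K z \<ge> 0" "(\<integral>z. K z \<partial>lborel) = 1"
    and d: "\<And>z. norm z \<ge> d \<Longrightarrow> K z = 0"
    and e: "e \<ge> 0" "\<And>w. norm w < d \<Longrightarrow> (\<integral>x. (f (x - w) - f x)\<^sup>2 \<partial>lborel) \<le> e"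
  shows "l2 lborel (conv K f)" "(\<integral>x. (conv K f x - f x)\<^sup>2 \<partial>lborel) \<le> e"
proof -
  have [measurable]: "f \<in> borel_measurable borel" using f by (auto simp: l2_def)
  have [measurable]: "K \<in> borel_measurable borel" using K(1) by (rule test_functions_borel)
  have [measurable]: "conv K f \<in> borel_measurable borel"
    using Ck_continuous[OF Ck_conv[OF K(1) loc_int_l2[OF f]]] by (rule borel_measurable_continuous_onI)
  have tr: "l2 lborel (\<lambda>x. f (x - w))" for w
    using f lborel_integral_translate(2)[of "\<lambda>x. (norm (f x))\<^sup>2" w] by (auto simp: l2_def)
  have refl: "l2 lborel (\<lambda>w. f (x - w))" for x
    using f lborel_integral_reflect(2)[of "\<lambda>x. (norm (f x))\<^sup>2" x] by (auto simp: l2_def)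
  obtain B where B: "\<And>z. \<bar>K z\<bar> \<le> B" using test_functions_bounded[OF K(1)] by metis
  have Kz: "norm z > d \<Longrightarrow> K z = 0" for z using d by simp
  have iK: "integrable lborel K"
    using loc_int_mult[OF loc_int_const[of 1] \<open>K \<in> borel_measurable borel\<close> B Kz] by simp
  have Jensen: "(conv K f x - f x)\<^sup>2 \<le> (\<integral>w. K w * (f (x - w) - f x)\<^sup>2 \<partial>lborel)"
    and iK2: "integrable lborel (\<lambda>w. K w * (f (x - w) - f x)\<^sup>2)" for x
  proof -
    have i1: "integrable lborel (\<lambda>w. K w * f (x - w))"
      by (rule loc_int_mult[OF loc_int_l2[OF refl] \<open>K \<in> borel_measurable borel\<close> B Kz])
    have i2: "integrable lborel (\<lambda>w. K w * (f (x - w))\<^sup>2)"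
    proof (rule loc_int_mult[OF _ \<open>K \<in> borel_measurable borel\<close> B Kz])
      have "integrable lborel (\<lambda>w. (f (x - w))\<^sup>2)" using l2_integrable[OF refl[of x]] by simp
      then show "loc_int (\<lambda>w. (f (x - w))\<^sup>2)"
        unfolding loc_int_def
        by (auto intro!: integrable_real_mult_indicator simp: mult.commute[of "indicator _ _"])
    qed
    \<comment> \<open>The mean of \<open>f (x - w) - f x\<close> under \<open>K\<close>. Jensen's
      inequality for the square is the nonnegativity of the variance about \<open>m\<close>.\<close>
    define m where "m = conv K f x - f x"
    have "conv K f x = (\<integral>w. K w * f (x - w) \<partial>lborel)"
      using lborel_integral_reflect(1)[of "\<lambda>w. K w * f (x - w)" x] by (simp add: conv_def)
    then have m: "m = (\<integral>w. K w * f (x - w) \<partial>lborel) - f x" by (simp add: m_def)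
    have eq: "K w * (f (x - w) - f x - c)\<^sup>2
        = K w * (f (x - w))\<^sup>2 - 2 * (f x + c) * (K w * f (x - w)) + (f x + c)\<^sup>2 * K w" for w c
      by (simp add: power2_eq_square algebra_simps)
    show iK2: "integrable lborel (\<lambda>w. K w * (f (x - w) - f x)\<^sup>2)"
      using i1 i2 iK eq[of _ 0] by simp
    have E: "(\<integral>w. K w * (f (x - w) - f x - c)\<^sup>2 \<partial>lborel)
        = (\<integral>w. K w * (f (x - w))\<^sup>2 \<partial>lborel) - 2 * (f x + c) * (\<integral>w. K w * f (x - w) \<partial>lborel) + (f x + c)\<^sup>2" for c
      unfolding eq using i1 i2 iK K(3) by simp
    have "0 \<le> (\<integral>w. K w * (f (x - w) - f x - m)\<^sup>2 \<partial>lborel)"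
      using K(2) by (intro Bochner_Integration.integral_nonneg) simp
    also have "\<dots> = (\<integral>w. K w * (f (x - w) - f x - 0)\<^sup>2 \<partial>lborel) - m\<^sup>2"
      unfolding E m by (simp add: power2_eq_square algebra_simps)
    finally have "0 \<le> (\<integral>w. K w * (f (x - w) - f x)\<^sup>2 \<partial>lborel) - m\<^sup>2" by simp
    then show "(conv K f x - f x)\<^sup>2 \<le> (\<integral>w. K w * (f (x - w) - f x)\<^sup>2 \<partial>lborel)" by (simp add: m_def)
  qed
  have "(\<integral>\<^sup>+x. ennreal ((conv K f x - f x)\<^sup>2) \<partial>lborel)
      \<le> (\<integral>\<^sup>+x. (\<integral>\<^sup>+w. ennreal (K w * (f (x - w) - f x)\<^sup>2) \<partial>lborel) \<partial>lborel)"
  proof (rule nn_integral_mono)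
    fix x
    show "ennreal ((conv K f x - f x)\<^sup>2) \<le> (\<integral>\<^sup>+w. ennreal (K w * (f (x - w) - f x)\<^sup>2) \<partial>lborel)"
      using Jensen[of x] K(2) by (subst nn_integral_eq_integral[OF iK2]) auto
  qed
  also have "\<dots> = (\<integral>\<^sup>+w. (\<integral>\<^sup>+x. ennreal (K w * (f (x - w) - f x)\<^sup>2) \<partial>lborel) \<partial>lborel)"
    by (rule lborel_pair.Fubini') measurable
  also have "\<dots> \<le> (\<integral>\<^sup>+w. ennreal (e * K w) \<partial>lborel)"
  proof (rule nn_integral_mono)
    fix w
    have i: "integrable lborel (\<lambda>x. (f (x - w) - f x)\<^sup>2)"
      using l2_integrable[OF l2_diff[OF tr f]] by simp
    have "(\<integral>\<^sup>+x. ennreal (K w * (f (x - w) - f x)\<^sup>2) \<partial>lborel)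
        = ennreal (K w * (\<integral>x. (f (x - w) - f x)\<^sup>2 \<partial>lborel))"
      using i K(2) by (subst nn_integral_eq_integral) auto
    also have "\<dots> \<le> ennreal (e * K w)"
    proof (cases "norm w < d")
      case True
      from mult_left_mono[OF e(2)[OF True] K(2)[of w]] show ?thesis
        by (intro ennreal_leI) (simp add: mult.commute)
    qed (use d in simp)
    finally show "(\<integral>\<^sup>+x. ennreal (K w * (f (x - w) - f x)\<^sup>2) \<partial>lborel) \<le> ennreal (e * K w)" .
  qed
  also have "\<dots> = ennreal e"
    using iK K(2,3) e(1) by (subst nn_integral_eq_integral) auto
  finally have le: "(\<integral>\<^sup>+x. ennreal ((conv K f x - f x)\<^sup>2) \<partial>lborel) \<le> ennreal e" .
  then have "integrable lborel (\<lambda>x. (conv K f x - f x)\<^sup>2)"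
    by (intro integrableI_bounded) (auto simp: less_top[symmetric] top_unique)
  then have "l2 lborel (\<lambda>x. conv K f x - f x)" by (simp add: l2_def)
  from l2_add[OF this f] show "l2 lborel (conv K f)" by simp
  have "ennreal (\<integral>x. (conv K f x - f x)\<^sup>2 \<partial>lborel) \<le> ennreal e"
    using le by (subst nn_integral_eq_integral[symmetric]) (use \<open>integrable lborel (\<lambda>x. (conv K f x - f x)\<^sup>2)\<close> in auto)
  then show "(\<integral>x. (conv K f x - f x)\<^sup>2 \<partial>lborel) \<le> e"
    using e(1) by (simp add: ennreal_le_iff)
qed

lemma test_functions_bump:
  assumes "R > 0"
  shows "bump R \<in> test_functions UNIV"
  by (rule test_functionsI[of _ "cball 0 R"]) (auto simp: Ck_bump bump_eq_0[OF assms])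

section \<open>Mollifiers\<close>

definition mollifier :: "nat \<Rightarrow> real ^ 'N \<Rightarrow> real" where
  "mollifier k z = bump (1 / real (Suc k)) z / (\<integral>z. bump (1 / real (Suc k)) (z :: real ^ 'N) \<partial>lborel)"

text \<open>If the integral were 0, the bump would vanish almost everywhere, but it is positive on
  an open ball, which is not negligible. The mollifiers are normalized by this integral.\<close>

lemma integral_bump_pos:
  assumes "R > 0"
  shows "(\<integral>z. bump R (z :: real ^ 'N) \<partial>lborel) > 0"
proof -
  note t = test_functions_bump[OF assms, where ?'a = 'N]
  obtain B where "\<And>z :: real ^ 'N. \<bar>bump R z\<bar> \<le> B" using test_functions_bounded[OF t] by metis
  then have i: "integrable lborel (bump R :: real ^ 'N \<Rightarrow> real)"
    using loc_int_mult[OF loc_int_const[of 1] test_functions_borel[OF t] _ bump_eq_0[OF assms], of B R]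
    by simp
  have "(\<integral>z. bump R (z :: real ^ 'N) \<partial>lborel) \<noteq> 0"
  proof
    assume "(\<integral>z. bump R (z :: real ^ 'N) \<partial>lborel) = 0"
    then have "AE z :: real ^ 'N in lborel. bump R z = 0"
      using i by (subst (asm) integral_nonneg_eq_0_iff_AE) (auto simp: bump_nonneg)
    then have "AE z :: real ^ 'N in lborel. z \<notin> ball 0 R"
      by eventually_elim (use bump_pos[OF assms] in fastforce)
    then have "AE z in lebesgue. z \<notin> (ball 0 R :: (real ^ 'N) set)" by (rule AE_completion)
    then have "negligible (ball 0 R :: (real ^ 'N) set)"
      by (simp add: negligible_iff_null_sets AE_iff_null_sets)
    then show False using assms open_not_negligible[of "ball (0 :: real ^ 'N) R"] by simp
  qed
  moreover have "(\<integral>z. bump R (z :: real ^ 'N) \<partial>lborel) \<ge> 0"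
    by (rule Bochner_Integration.integral_nonneg) (rule bump_nonneg)
  ultimately show ?thesis by simp
qed

lemma mollifier:
  fixes z :: "real ^ 'N"
  shows test_functions_mollifier: "(mollifier k :: real ^ 'N \<Rightarrow> real) \<in> test_functions UNIV"
    and mollifier_nonneg: "mollifier k z \<ge> 0"
    and integral_mollifier: "(\<integral>z. mollifier k (z :: real ^ 'N) \<partial>lborel) = 1"
    and mollifier_eq_0: "norm z \<ge> 1 / real (Suc k) \<Longrightarrow> mollifier k z = 0"
proof -
  let ?I = "\<integral>z. bump (1 / real (Suc k)) (z :: real ^ 'N) \<partial>lborel"
  have I: "?I > 0" by (rule integral_bump_pos) simp
  have eq: "mollifier k = (\<lambda>z :: real ^ 'N. (1 / ?I) * bump (1 / real (Suc k)) z)"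
    by (auto simp: mollifier_def)
  show "(mollifier k :: real ^ 'N \<Rightarrow> real) \<in> test_functions UNIV"
    unfolding eq by (intro test_functions_mult test_functions_bump Ck_const) simp
  show "mollifier k z \<ge> 0"
    using I by (auto simp: mollifier_def intro!: divide_nonneg_nonneg bump_nonneg)
  show "(\<integral>z. mollifier k (z :: real ^ 'N) \<partial>lborel) = 1"
    unfolding eq using I by simp
  show "mollifier k z = 0" if "norm z \<ge> 1 / real (Suc k)"
    using bump_eq_0[of "1 / real (Suc k)" z] that by (simp add: mollifier_def)
qed

lemma l2_lim_mollify:
  fixes f :: "real ^ 'N \<Rightarrow> real"
  assumes f: "l2 lborel f"
  shows "l2_lim lborel (\<lambda>k. conv (mollifier k) f) f"
proof -
  have *: "\<exists>n. \<forall>k\<ge>n. l2 lborel (conv (mollifier k) f) \<and> (\<integral>x. (conv (mollifier k) f x - f x)\<^sup>2 \<partial>lborel) \<le> e"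
    if e: "e > 0" for e
  proof -
    obtain d where d: "d > 0" "\<And>w. norm w < d \<Longrightarrow> (\<integral>x. (f (x - w) - f x)\<^sup>2 \<partial>lborel) < e"
      using l2_translation_continuous[OF f e] by metis
    obtain n where n: "1 / real (Suc n) < d" using nat_approx_posE[OF d(1)] by metis
    show ?thesis
    proof (intro exI[of _ n] allI impI)
      fix k assume "k \<ge> n"
      then have "1 / real (Suc k) \<le> 1 / real (Suc n)" by (simp add: field_simps)
      with n have "(\<integral>x. (f (x - w) - f x)\<^sup>2 \<partial>lborel) \<le> e" if "norm w < 1 / real (Suc k)" for w
        using d(2)[of w] that by simp
      from mollify_estimate[OF f test_functions_mollifier mollifier_nonneg integral_mollifier
          mollifier_eq_0 less_imp_le[OF e] this]
      show "l2 lborel (conv (mollifier k) f) \<and> (\<integral>x. (conv (mollifier k) f x - f x)\<^sup>2 \<partial>lborel) \<le> e"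
        by blast
    qed
  qed
  \<comment> \<open>The relation \<open>l2_lim\<close> asks for membership at every index, not only
    at large ones, so the estimate is repeated with the crude translation bound
    \<open>4 * \<integral>f\<^sup>2\<close>.\<close>
  have l2: "l2 lborel (conv (mollifier k) f)" for k
  proof (rule mollify_estimate[OF f test_functions_mollifier mollifier_nonneg integral_mollifier mollifier_eq_0])
    have [measurable]: "f \<in> borel_measurable borel" using f by (auto simp: l2_def)
    fix w
    have i: "integrable lborel (\<lambda>x. (f x)\<^sup>2)" using l2_integrable[OF f] by simp
    then have i': "integrable lborel (\<lambda>x. (f (x - w))\<^sup>2)"
      using lborel_integral_translate(2)[of "\<lambda>x. (f x)\<^sup>2" w] by simp
    then have l: "l2 lborel (\<lambda>x. f (x - w))" by (simp add: l2_def)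
    have "(\<integral>x. (f (x - w) - f x)\<^sup>2 \<partial>lborel) \<le> (\<integral>x. 2 * (f (x - w))\<^sup>2 + 2 * (f x)\<^sup>2 \<partial>lborel)"
      using i i' l2_integrable[OF l2_diff[OF l f]] by (intro integral_mono power2_diff_le) auto
    also have "\<dots> = 4 * (\<integral>x. (f x)\<^sup>2 \<partial>lborel)"
      using i i' lborel_integral_translate(1)[of "\<lambda>x. (f x)\<^sup>2" w] by simp
    finally show "(\<integral>x. (f (x - w) - f x)\<^sup>2 \<partial>lborel) \<le> 4 * (\<integral>x. (f x)\<^sup>2 \<partial>lborel)" .
  qed (assumption, intro mult_nonneg_nonneg Bochner_Integration.integral_nonneg, simp_all)
  have "(\<lambda>k. \<integral>x. (conv (mollifier k) f x - f x)\<^sup>2 \<partial>lborel) \<longlonglongrightarrow> 0"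
  proof (rule LIMSEQ_I)
    fix e :: real assume "e > 0"
    then obtain n where n: "\<And>k. k \<ge> n \<Longrightarrow> (\<integral>x. (conv (mollifier k) f x - f x)\<^sup>2 \<partial>lborel) \<le> e / 2"
      using *[of "e / 2"] by auto
    show "\<exists>n. \<forall>k\<ge>n. norm ((\<integral>x. (conv (mollifier k) f x - f x)\<^sup>2 \<partial>lborel) - 0) < e"
    proof (intro exI[of _ n] allI impI)
      fix k assume "k \<ge> n"
      have "(\<integral>x. (conv (mollifier k) f x - f x)\<^sup>2 \<partial>lborel) \<ge> 0"
        by (rule Bochner_Integration.integral_nonneg) simp
      then show "norm ((\<integral>x. (conv (mollifier k) f x - f x)\<^sup>2 \<partial>lborel) - 0) < e"
        using n[OF \<open>k \<ge> n\<close>] \<open>e > 0\<close> by simp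
    qed
  qed
  with l2 f show ?thesis by (simp add: l2_lim_def)
qed

section \<open>Weak gradients\<close>

text \<open>Mollification works with Borel functions on \<open>lborel\<close>, the function spaces
  with \<open>lebesgue_on \<Omega>\<close>. The bridge between them is the extension by zero,
  changed on a null set so as to become Borel.\<close>

lemma lebesgue_on_borel_rep:
  fixes f :: "'a :: euclidean_space \<Rightarrow> real"
  assumes "f \<in> borel_measurable (lebesgue_on \<Omega>)" "\<Omega> \<in> sets lebesgue"
  obtains F where "F \<in> borel_measurable borel" "AE x in lebesgue. indicator \<Omega> x * f x = F x"
proof -
  have "(\<lambda>x. indicator \<Omega> x *\<^sub>R f x) \<in> borel_measurable lebesgue"
    using assms by (subst (asm) borel_measurable_restrict_space_iff) auto
  then obtain F where "F \<in> borel_measurable lborel" "AE x in lborel. indicator \<Omega> x *\<^sub>R f x = F x"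
    using completion_ex_borel_measurable_real by blast
  then show ?thesis using that[of F] AE_completion by auto
qed

lemma lebesgue_on_integral_rep:
  fixes f :: "'a :: euclidean_space \<Rightarrow> real"
  assumes "\<Omega> \<in> sets lebesgue" "F \<in> borel_measurable borel" "AE x in lebesgue. indicator \<Omega> x * f x = F x"
    and "f \<in> borel_measurable (lebesgue_on \<Omega>)"
  shows "(\<integral>x. f x \<partial>lebesgue_on \<Omega>) = (\<integral>x. F x \<partial>lborel)"
    and "integrable (lebesgue_on \<Omega>) f \<longleftrightarrow> integrable lborel F"
proof -
  have m: "(\<lambda>x. indicator \<Omega> x *\<^sub>R f x) \<in> borel_measurable lebesgue"
    using assms(1,4) by (subst (asm) borel_measurable_restrict_space_iff) auto
  have F: "F \<in> borel_measurable lebesgue" using assms(2) by (simp add: measurable_completion)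
  have "(\<integral>x. f x \<partial>lebesgue_on \<Omega>) = (\<integral>x. indicator \<Omega> x *\<^sub>R f x \<partial>lebesgue)"
    using assms(1) by (subst integral_restrict_space) auto
  also have "\<dots> = (\<integral>x. F x \<partial>lebesgue)"
    using assms(3) by (intro integral_cong_AE m F) auto
  also have "\<dots> = (\<integral>x. F x \<partial>lborel)"
    using assms(2) by (intro integral_completion) simp
  finally show "(\<integral>x. f x \<partial>lebesgue_on \<Omega>) = (\<integral>x. F x \<partial>lborel)" .
  have "integrable (lebesgue_on \<Omega>) f \<longleftrightarrow> integrable lebesgue (\<lambda>x. indicator \<Omega> x *\<^sub>R f x)"
    using assms(1) by (subst integrable_restrict_space) auto
  also have "\<dots> \<longleftrightarrow> integrable lebesgue F"
    using assms(3) by (intro integrable_cong_AE m F) auto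
  also have "\<dots> \<longleftrightarrow> integrable lborel F"
    using assms(2) by (intro integrable_completion) simp
  finally show "integrable (lebesgue_on \<Omega>) f \<longleftrightarrow> integrable lborel F" .
qed

lemma borel_measurable_lebesgue_on:
  "f \<in> borel_measurable borel \<Longrightarrow> f \<in> borel_measurable (lebesgue_on \<Omega>)"
  by (intro measurable_restrict_space1 measurable_completion) simp

lemma l2_rep:
  fixes f :: "'a :: euclidean_space \<Rightarrow> real"
  assumes "l2 (lebesgue_on \<Omega>) f" "\<Omega> \<in> sets lebesgue" "F \<in> borel_measurable borel"
    and ae: "AE x in lebesgue. indicator \<Omega> x * f x = F x"
  shows "l2 lborel F"
proof -
  have [measurable]: "f \<in> borel_measurable (lebesgue_on \<Omega>)" using assms(1) by (simp add: l2_def)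
  have "integrable lborel (\<lambda>x. (norm (F x))\<^sup>2)"
  proof (subst lebesgue_on_integral_rep(2)[symmetric, where f = "\<lambda>x. (norm (f x))\<^sup>2", OF assms(2)])
    show "AE x in lebesgue. indicator \<Omega> x * (norm (f x))\<^sup>2 = (norm (F x))\<^sup>2"
      using ae by eventually_elim (auto simp: indicator_def split: if_splits)
    show "integrable (lebesgue_on \<Omega>) (\<lambda>x. (norm (f x))\<^sup>2)" using assms(1) by (rule l2_integrable)
  qed (use assms(3) in measurable)
  then show ?thesis using assms(3) by (simp add: l2_def)
qed

lemma test_functions_integral_rep:
  fixes f :: "real ^ 'N \<Rightarrow> real"
  assumes "\<eta> \<in> test_functions \<Omega>'" "f \<in> borel_measurable (lebesgue_on \<Omega>)" "\<Omega> \<in> sets lebesgue"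
    "F \<in> borel_measurable borel" "AE x in lebesgue. indicator \<Omega> x * f x = F x"
  shows "(\<integral>x. f x * \<eta> x \<partial>lebesgue_on \<Omega>) = (\<integral>x. F x * \<eta> x \<partial>lborel)"
proof (rule lebesgue_on_integral_rep(1)[OF assms(3)])
  note [measurable] = assms(2,4) test_functions_borel[OF assms(1)] borel_measurable_lebesgue_on[OF test_functions_borel[OF assms(1)]]
  show "(\<lambda>x. F x * \<eta> x) \<in> borel_measurable borel" by measurable
  show "(\<lambda>x. f x * \<eta> x) \<in> borel_measurable (lebesgue_on \<Omega>)" by measurable
  show "AE x in lebesgue. indicator \<Omega> x * (f x * \<eta> x) = F x * \<eta> x"
    using assms(5) by eventually_elim (simp add: mult.assoc[symmetric])
qed

text \<open>At a point of \<open>\<Omega>\<close> the reflected mollifiers of small radius are test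
  functions on \<open>\<Omega>\<close>, so the mollifications of \<open>f\<close> are eventually 0
  there. Along a subsequence they also converge to \<open>f\<close> almost everywhere.\<close>

lemma fundamental_lemma:
  fixes f :: "real ^ 'N \<Rightarrow> real"
  assumes "open \<Omega>" and f: "l2 (lebesgue_on \<Omega>) f"
    and zero: "\<And>\<eta>. \<eta> \<in> test_functions \<Omega> \<Longrightarrow> (\<integral>x. f x * \<eta> x \<partial>lebesgue_on \<Omega>) = 0"
  shows "AE x in lebesgue_on \<Omega>. f x = 0"
proof -
  have \<Omega>: "\<Omega> \<in> sets lebesgue" using assms(1) by (simp add: lmeasurable_open)
  have fm: "f \<in> borel_measurable (lebesgue_on \<Omega>)" using f by (simp add: l2_def)
  obtain F where F: "F \<in> borel_measurable borel" "AE x in lebesgue. indicator \<Omega> x * f x = F x"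
    using lebesgue_on_borel_rep[OF fm \<Omega>] by metis
  have lF: "l2 lborel F" by (rule l2_rep[OF f \<Omega> F])
  obtain r where r: "strict_mono r" "AE x in lborel. (\<lambda>k. conv (mollifier (r k)) F x) \<longlonglongrightarrow> F x"
    by (rule l2_lim_AE_subseq[OF l2_lim_mollify[OF lF]])
  have ev: "\<forall>\<^sub>F k in sequentially. conv (mollifier (r k)) F x = 0" if x: "x \<in> \<Omega>" for x
  proof -
    obtain d where d: "d > 0" "cball x d \<subseteq> \<Omega>" using assms(1) x by (meson open_contains_cball)
    obtain n where n: "1 / real (Suc n) < d" using nat_approx_posE[OF d(1)] by metis
    have "conv (mollifier (r k)) F x = 0" if "k \<ge> n" for k
    proof -
      have "r k \<ge> n" using that seq_suble[OF r(1), of k] by simp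
      then have "1 / real (Suc (r k)) \<le> 1 / real (Suc n)" by (simp add: field_simps)
      then have rk: "1 / real (Suc (r k)) < d" using n by simp
      let ?\<eta> = "\<lambda>y. mollifier (r k) (x - y)"
      have t: "?\<eta> \<in> test_functions \<Omega>"
      proof (rule test_functionsI[of _ "cball x d"])
        show "Ck j ?\<eta>" for j by (intro Ck_reflect test_functions_Ck[OF test_functions_mollifier])
        show "?\<eta> y = 0" if "y \<notin> cball x d" for y
          using that rk by (intro mollifier_eq_0) (simp add: dist_norm)
      qed (use d in auto)
      have "conv (mollifier (r k)) F x = (\<integral>y. F y * ?\<eta> y \<partial>lborel)"
        by (simp add: conv_def mult.commute)
      also have "\<dots> = (\<integral>y. f y * ?\<eta> y \<partial>lebesgue_on \<Omega>)"
        by (rule test_functions_integral_rep[OF t fm \<Omega> F, symmetric])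
      also have "\<dots> = 0" by (rule zero[OF t])
      finally show ?thesis .
    qed
    then show ?thesis using eventually_sequentially by blast
  qed
  have "AE x in lebesgue. x \<in> \<Omega> \<longrightarrow> f x = 0"
    using F(2) AE_completion[OF r(2)]
  proof eventually_elim
    case (elim x)
    show ?case
    proof
      assume x: "x \<in> \<Omega>"
      have "(\<lambda>k. conv (mollifier (r k)) F x) \<longlonglongrightarrow> 0" by (rule tendsto_eventually[OF ev[OF x]])
      with elim(2) have "F x = 0" using LIMSEQ_unique by blast
      then show "f x = 0" using elim(1) x by simp
    qed
  qed
  then show ?thesis using \<Omega> by (subst AE_restrict_space_iff) auto
qed

lemma l2_test_functions:
  fixes \<eta> :: "real ^ 'N \<Rightarrow> real"
  assumes "\<eta> \<in> test_functions \<Omega>'"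
  shows "l2 lborel \<eta>"
proof -
  note [measurable] = test_functions_borel[OF assms]
  obtain B where B: "B \<ge> 0" "\<And>x. \<bar>\<eta> x\<bar> \<le> B" using test_functions_bounded[OF assms] by metis
  obtain R where R: "\<And>x. norm x > R \<Longrightarrow> \<eta> x = 0" using test_functionsE_norm[OF assms] by metis
  show ?thesis
  proof (rule l2_mono[OF l2_indicator_cball])
    show "AE x in lborel. norm (\<eta> x) \<le> B * norm (indicator (cball 0 R) x :: real)"
    proof (rule AE_I2)
      show "norm (\<eta> x) \<le> B * norm (indicator (cball 0 R) x :: real)" for x
        using B(2)[of x] R[of x] by (auto simp: indicator_def)
    qed
  qed measurable
qed

lemma l2_lborel_imp_lebesgue_on:
  fixes f :: "'a :: euclidean_space \<Rightarrow> 'b :: euclidean_space"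
  assumes "l2 lborel f" "\<Omega> \<in> sets lebesgue"
  shows "l2 (lebesgue_on \<Omega>) f"
proof -
  have [measurable]: "f \<in> borel_measurable borel" using assms(1) by (simp add: l2_def)
  have "integrable lebesgue (\<lambda>x. (norm (f x))\<^sup>2)"
    using l2_integrable[OF assms(1)] by (subst integrable_completion) auto
  then have "integrable lebesgue (\<lambda>x. indicator \<Omega> x *\<^sub>R (norm (f x))\<^sup>2)"
    using assms(2) by (rule integrable_mult_indicator[rotated])
  then show ?thesis
    using assms(2) by (simp add: l2_def borel_measurable_lebesgue_on integrable_restrict_space)
qed

lemma l2_vec:
  fixes f :: "'a \<Rightarrow> real ^ 'N"
  assumes "\<And>i. l2 M (\<lambda>x. f x $ i)"
  shows "l2 M f"
proof -
  have "l2 M (\<lambda>x. f x $ i *\<^sub>R (axis i 1 :: real ^ 'N))" for i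
    by (rule l2_mono[OF assms[of i], where C = 1]) (use assms[of i] in \<open>auto simp: l2_def\<close>)
  then have "l2 M (\<lambda>x. \<Sum>i\<in>UNIV. f x $ i *\<^sub>R (axis i 1 :: real ^ 'N))" by (intro l2_sum)
  then show ?thesis by (simp add: basis_expansion scalar_mult_eq_scaleR[symmetric])
qed

lemma l2_lim_sum:
  "(\<And>i. i \<in> I \<Longrightarrow> l2_lim M (F i) (f i)) \<Longrightarrow> l2_lim M (\<lambda>k x. \<Sum>i\<in>I. F i k x) (\<lambda>x. \<Sum>i\<in>I. f i x)"
  by (induction I rule: infinite_finite_induct) (auto intro: l2_lim_add simp: l2_lim_def[of _ "\<lambda>_ _. 0"])

lemma l2_lim_vec:
  fixes f :: "'a \<Rightarrow> real ^ 'N"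
  assumes "\<And>i. l2_lim M (\<lambda>k x. F k x $ i) (\<lambda>x. f x $ i)"
  shows "l2_lim M F f"
proof -
  have *: "l2 M (\<lambda>x. h x *\<^sub>R (axis i 1 :: real ^ 'N))" if "l2 M h" for h i
    by (rule l2_mono[OF that, where C = 1]) (use that in \<open>auto simp: l2_def\<close>)
  have "l2_lim M (\<lambda>k x. F k x $ i *\<^sub>R (axis i 1 :: real ^ 'N)) (\<lambda>x. f x $ i *\<^sub>R axis i 1)" for i
    by (rule l2_lim_bound[OF _ _ assms[of i], where C = 1])
      (use assms[of i] in \<open>auto simp: scaleR_diff_left[symmetric] l2_lim_def intro!: *\<close>)
  then have "l2_lim M (\<lambda>k x. \<Sum>i\<in>UNIV. F k x $ i *\<^sub>R (axis i 1 :: real ^ 'N)) (\<lambda>x. \<Sum>i\<in>UNIV. f x $ i *\<^sub>R axis i 1)"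
    by (intro l2_lim_sum)
  then show ?thesis by (simp add: basis_expansion scalar_mult_eq_scaleR[symmetric])
qed

lemma l2_test_functions_lebesgue_on:
  "open \<Omega> \<Longrightarrow> \<eta> \<in> test_functions \<Omega>' \<Longrightarrow> l2 (lebesgue_on \<Omega>) \<eta>"
  by (intro l2_lborel_imp_lebesgue_on l2_test_functions) (auto simp: lmeasurable_open)

lemma l2_gradient_test_functions:
  assumes "open \<Omega>" "\<eta> \<in> test_functions \<Omega>'"
  shows "l2 (lebesgue_on \<Omega>) (gradient \<eta>)"
  by (rule l2_vec) (rule l2_test_functions_lebesgue_on[OF assms(1) test_functions_gradient[OF assms(2)]])

section \<open>Limits of test functions and their weak gradients\<close>

lemma integration_by_parts:
  assumes "open \<Omega>" "\<eta> \<in> test_functions \<Omega>" "\<zeta> \<in> test_functions \<Omega>"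
  shows "(\<integral>x. \<eta> x * gradient \<zeta> x $ i \<partial>lebesgue_on \<Omega>) = - (\<integral>x. gradient \<eta> x $ i * \<zeta> x \<partial>lebesgue_on \<Omega>)"
proof -
  have \<Omega>: "\<Omega> \<in> sets lebesgue" using assms(1) by (simp add: lmeasurable_open)
  \<comment> \<open>The product is again a test function, so the integral of its partial derivative
    vanishes; the product rule turns this into the claim.\<close>
  have t: "(\<lambda>x. \<eta> x * \<zeta> x) \<in> test_functions \<Omega>"
    by (intro test_functions_mult assms test_functions_Ck[OF assms(2)])
  note tg = test_functions_gradient[OF t, of i]
  have d: "\<eta> differentiable (at x)" "\<zeta> differentiable (at x)" for x
    using Ck_differentiable test_functions_Ck assms by blast+
  have eq: "gradient (\<lambda>x. \<eta> x * \<zeta> x) x $ i = \<eta> x * gradient \<zeta> x $ i + gradient \<eta> x $ i * \<zeta> x" for x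
    by (simp add: gradient_mult[OF d])
  have "(\<integral>x. gradient (\<lambda>x. \<eta> x * \<zeta> x) x $ i \<partial>lebesgue_on \<Omega>) = (\<integral>x. gradient (\<lambda>x. \<eta> x * \<zeta> x) x $ i \<partial>lborel)"
  proof (rule lebesgue_on_integral_rep(1)[OF \<Omega> test_functions_borel[OF tg]])
    obtain S where S: "S \<subseteq> \<Omega>" "\<And>x. x \<notin> S \<Longrightarrow> gradient (\<lambda>x. \<eta> x * \<zeta> x) x = 0"
      using test_functionsE[OF t] by metis
    then have "indicator \<Omega> x * gradient (\<lambda>x. \<eta> x * \<zeta> x) x $ i = gradient (\<lambda>x. \<eta> x * \<zeta> x) x $ i" for x
      by (cases "x \<in> S") (auto simp: indicator_def)
    then show "AE x in lebesgue. indicator \<Omega> x * gradient (\<lambda>x. \<eta> x * \<zeta> x) x $ i = gradient (\<lambda>x. \<eta> x * \<zeta> x) x $ i"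
      by simp
    show "(\<lambda>x. gradient (\<lambda>x. \<eta> x * \<zeta> x) x $ i) \<in> borel_measurable (lebesgue_on \<Omega>)"
      by (rule borel_measurable_lebesgue_on[OF test_functions_borel[OF tg]])
  qed
  also have "\<dots> = 0"
    by (rule integral_gradient_eq_0[OF subsetD[OF test_functions_mono[OF subset_UNIV] t]])
  finally have "(\<integral>x. \<eta> x * gradient \<zeta> x $ i + gradient \<eta> x $ i * \<zeta> x \<partial>lebesgue_on \<Omega>) = 0"
    unfolding eq .
  moreover have "integrable (lebesgue_on \<Omega>) (\<lambda>x. \<eta> x * gradient \<zeta> x $ i)"
    "integrable (lebesgue_on \<Omega>) (\<lambda>x. gradient \<eta> x $ i * \<zeta> x)"
    using assms by (auto intro!: integrable_mult intro: l2_test_functions_lebesgue_on test_functions_gradient)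
  ultimately show ?thesis by simp
qed

text \<open>The limit \<open>g\<close> of the gradients is a parameter instead of
  \<open>weak_gradient \<Omega> u\<close>. The gradient of a combination or a composition can then
  be computed on test functions and identified with the chosen weak gradient afterwards.\<close>

definition h1_lim ::
    "(real ^ 'N) set \<Rightarrow> (nat \<Rightarrow> real ^ 'N \<Rightarrow> real) \<Rightarrow> (real ^ 'N \<Rightarrow> real) \<Rightarrow> (real ^ 'N \<Rightarrow> real ^ 'N) \<Rightarrow> bool" where
  "h1_lim \<Omega> \<eta> u g \<longleftrightarrow> (\<forall>k. \<eta> k \<in> test_functions \<Omega>) \<and> l2_lim (lebesgue_on \<Omega>) \<eta> u
     \<and> l2_lim (lebesgue_on \<Omega>) (\<lambda>k. gradient (\<eta> k)) g"

text \<open>Integration by parts holds for each \<open>\<eta> k\<close>, and both of its sides are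
  continuous under mean square convergence.\<close>

lemma h1_lim_imp_weak_gradient:
  assumes "open \<Omega>" "h1_lim \<Omega> \<eta> u g"
  shows "is_weak_gradient \<Omega> u g"
  unfolding is_weak_gradient_def square_integrable_iff_l2
proof (intro conjI ballI allI)
  have lim: "l2_lim (lebesgue_on \<Omega>) \<eta> u" "l2_lim (lebesgue_on \<Omega>) (\<lambda>k. gradient (\<eta> k)) g"
    and t: "\<eta> k \<in> test_functions \<Omega>" for k
    using assms(2) by (auto simp: h1_lim_def)
  then show "l2 (lebesgue_on \<Omega>) g" by (auto simp: l2_lim_def)
  fix \<zeta> i assume \<zeta>: "\<zeta> \<in> test_functions \<Omega>"
  have lim': "l2_lim (lebesgue_on \<Omega>) (\<lambda>k x. gradient (\<eta> k) x $ i) (\<lambda>x. g x $ i)"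
    using lim(2) by (intro l2_lim_bound[OF _ _ lim(2), where C = 1])
      (auto simp: l2_lim_def component_le_norm_cart intro!: l2_component simp flip: vector_minus_component)
  have "(\<lambda>k. \<integral>x. \<eta> k x * gradient \<zeta> x $ i \<partial>lebesgue_on \<Omega>) \<longlonglongrightarrow> (\<integral>x. u x * gradient \<zeta> x $ i \<partial>lebesgue_on \<Omega>)"
    by (intro l2_lim_mult lim l2_component l2_gradient_test_functions[OF assms(1) \<zeta>])
  moreover have "(\<lambda>k. - (\<integral>x. gradient (\<eta> k) x $ i * \<zeta> x \<partial>lebesgue_on \<Omega>)) \<longlonglongrightarrow> - (\<integral>x. g x $ i * \<zeta> x \<partial>lebesgue_on \<Omega>)"
    by (intro tendsto_minus l2_lim_mult lim' l2_test_functions_lebesgue_on[OF assms(1) \<zeta>])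
  ultimately show "(\<integral>x. u x * gradient \<zeta> x $ i \<partial>lebesgue_on \<Omega>) = - (\<integral>x. g x $ i * \<zeta> x \<partial>lebesgue_on \<Omega>)"
    using integration_by_parts[OF assms(1) t \<zeta>] LIMSEQ_unique by simp
qed

text \<open>The fundamental lemma applies to each component of the difference. Since
  \<open>weak_gradient\<close> is a choice, every formula for it is obtained by comparison with a
  candidate and holds almost everywhere.\<close>

lemma weak_gradient_unique:
  assumes "open \<Omega>" "is_weak_gradient \<Omega> u g" "is_weak_gradient \<Omega> u g'"
  shows "AE x in lebesgue_on \<Omega>. g x = g' x"
proof -
  have l: "l2 (lebesgue_on \<Omega>) g" "l2 (lebesgue_on \<Omega>) g'"
    using assms by (auto simp: is_weak_gradient_def square_integrable_iff_l2)
  have "AE x in lebesgue_on \<Omega>. g x $ i - g' x $ i = 0" for i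
  proof (rule fundamental_lemma[OF assms(1)])
    show "l2 (lebesgue_on \<Omega>) (\<lambda>x. g x $ i - g' x $ i)" using l by (intro l2_diff l2_component)
    fix \<eta> assume t: "\<eta> \<in> test_functions \<Omega>"
    have "integrable (lebesgue_on \<Omega>) (\<lambda>x. g x $ i * \<eta> x)" "integrable (lebesgue_on \<Omega>) (\<lambda>x. g' x $ i * \<eta> x)"
      using l t assms(1) by (auto intro!: integrable_mult l2_component l2_test_functions_lebesgue_on)
    then have "(\<integral>x. (g x $ i - g' x $ i) * \<eta> x \<partial>lebesgue_on \<Omega>)
        = (\<integral>x. g x $ i * \<eta> x \<partial>lebesgue_on \<Omega>) - (\<integral>x. g' x $ i * \<eta> x \<partial>lebesgue_on \<Omega>)"
      by (simp add: left_diff_distrib)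
    also have "\<dots> = 0" using assms(2,3) t by (simp add: is_weak_gradient_def)
    finally show "(\<integral>x. (g x $ i - g' x $ i) * \<eta> x \<partial>lebesgue_on \<Omega>) = 0" .
  qed
  then have "AE x in lebesgue_on \<Omega>. \<forall>i. g x $ i - g' x $ i = 0" by (simp add: AE_all_countable)
  then show ?thesis by eventually_elim (simp add: vec_eq_iff)
qed

lemma is_weak_gradient_weak_gradient:
  "u \<in> H1 \<Omega> \<Longrightarrow> is_weak_gradient \<Omega> u (weak_gradient \<Omega> u)"
  unfolding weak_gradient_def H1_def by (auto simp: some_eq_ex)

lemma weak_gradient_AE_eq:
  assumes "open \<Omega>" "is_weak_gradient \<Omega> u g"
  shows "AE x in lebesgue_on \<Omega>. weak_gradient \<Omega> u x = g x"
proof -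
  have "is_weak_gradient \<Omega> u (weak_gradient \<Omega> u)"
    unfolding weak_gradient_def using assms(2) by (rule someI[where P = "is_weak_gradient \<Omega> u"])
  then show ?thesis using weak_gradient_unique assms by blast
qed

lemma h1_lim_imp_H10:
  assumes "open \<Omega>" "h1_lim \<Omega> \<eta> u g"
  shows "u \<in> H10 \<Omega>" "AE x in lebesgue_on \<Omega>. weak_gradient \<Omega> u x = g x"
proof -
  note w = h1_lim_imp_weak_gradient[OF assms]
  show ae: "AE x in lebesgue_on \<Omega>. weak_gradient \<Omega> u x = g x"
    by (rule weak_gradient_AE_eq[OF assms(1) w])
  have lim: "l2_lim (lebesgue_on \<Omega>) \<eta> u" "l2_lim (lebesgue_on \<Omega>) (\<lambda>k. gradient (\<eta> k)) g"
    and t: "\<eta> k \<in> test_functions \<Omega>" for k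
    using assms(2) by (auto simp: h1_lim_def)
  have u: "u \<in> H1 \<Omega>"
    using w l2_lim_l2'[OF lim(1)] by (auto simp: H1_def square_integrable_iff_l2)
  note l = is_weak_gradient_weak_gradient[OF u, unfolded is_weak_gradient_def square_integrable_iff_l2, THEN conjunct1]
  have "(\<lambda>k. \<integral>x. (u x - \<eta> k x)\<^sup>2 + (norm (weak_gradient \<Omega> u x - gradient (\<eta> k) x))\<^sup>2 \<partial>lebesgue_on \<Omega>) \<longlonglongrightarrow> 0"
  proof -
    have "(\<integral>x. (u x - \<eta> k x)\<^sup>2 + (norm (weak_gradient \<Omega> u x - gradient (\<eta> k) x))\<^sup>2 \<partial>lebesgue_on \<Omega>)
        = (\<integral>x. (norm (\<eta> k x - u x))\<^sup>2 \<partial>lebesgue_on \<Omega>) + (\<integral>x. (norm (gradient (\<eta> k) x - g x))\<^sup>2 \<partial>lebesgue_on \<Omega>)" for k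
    proof -
      have "(\<integral>x. (u x - \<eta> k x)\<^sup>2 + (norm (weak_gradient \<Omega> u x - gradient (\<eta> k) x))\<^sup>2 \<partial>lebesgue_on \<Omega>)
          = (\<integral>x. (norm (\<eta> k x - u x))\<^sup>2 + (norm (gradient (\<eta> k) x - g x))\<^sup>2 \<partial>lebesgue_on \<Omega>)"
      proof (rule integral_cong_AE)
        have [measurable]: "u \<in> borel_measurable (lebesgue_on \<Omega>)" "\<eta> k \<in> borel_measurable (lebesgue_on \<Omega>)"
          "gradient (\<eta> k) \<in> borel_measurable (lebesgue_on \<Omega>)" "g \<in> borel_measurable (lebesgue_on \<Omega>)"
          "weak_gradient \<Omega> u \<in> borel_measurable (lebesgue_on \<Omega>)"
          using lim l by (auto simp: l2_lim_def l2_def)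
        show "(\<lambda>x. (u x - \<eta> k x)\<^sup>2 + (norm (weak_gradient \<Omega> u x - gradient (\<eta> k) x))\<^sup>2) \<in> borel_measurable (lebesgue_on \<Omega>)"
          "(\<lambda>x. (norm (\<eta> k x - u x))\<^sup>2 + (norm (gradient (\<eta> k) x - g x))\<^sup>2) \<in> borel_measurable (lebesgue_on \<Omega>)"
          by measurable
        show "AE x in lebesgue_on \<Omega>. (u x - \<eta> k x)\<^sup>2 + (norm (weak_gradient \<Omega> u x - gradient (\<eta> k) x))\<^sup>2
            = (norm (\<eta> k x - u x))\<^sup>2 + (norm (gradient (\<eta> k) x - g x))\<^sup>2"
          using ae by eventually_elim (simp add: power2_commute norm_minus_commute)
      qed
      also have "\<dots> = (\<integral>x. (norm (\<eta> k x - u x))\<^sup>2 \<partial>lebesgue_on \<Omega>) + (\<integral>x. (norm (gradient (\<eta> k) x - g x))\<^sup>2 \<partial>lebesgue_on \<Omega>)"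
        using lim by (intro Bochner_Integration.integral_add l2_integrable l2_diff) (auto simp: l2_lim_def)
      finally show ?thesis .
    qed
    moreover have "(\<lambda>k. (\<integral>x. (norm (\<eta> k x - u x))\<^sup>2 \<partial>lebesgue_on \<Omega>) + (\<integral>x. (norm (gradient (\<eta> k) x - g x))\<^sup>2 \<partial>lebesgue_on \<Omega>)) \<longlonglongrightarrow> 0 + 0"
      using lim by (intro tendsto_add) (auto simp: l2_lim_def)
    ultimately show ?thesis by simp
  qed
  with u t show "u \<in> H10 \<Omega>" unfolding H10_def by blast
qed

lemma H10_imp_h1_lim:
  assumes "open \<Omega>" "u \<in> H10 \<Omega>"
  obtains \<eta> where "h1_lim \<Omega> \<eta> u (weak_gradient \<Omega> u)"
proof -
  obtain \<eta> where t: "\<And>k. \<eta> k \<in> test_functions \<Omega>"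
    and lim: "(\<lambda>k. \<integral>x. (u x - \<eta> k x)\<^sup>2 + (norm (weak_gradient \<Omega> u x - gradient (\<eta> k) x))\<^sup>2 \<partial>lebesgue_on \<Omega>) \<longlonglongrightarrow> 0"
    using assms(2) unfolding H10_def by blast
  have u: "u \<in> H1 \<Omega>" using assms(2) by (simp add: H10_def)
  note lg = is_weak_gradient_weak_gradient[OF u, unfolded is_weak_gradient_def square_integrable_iff_l2, THEN conjunct1]
  have lu: "l2 (lebesgue_on \<Omega>) u" using u by (auto simp: H1_def square_integrable_iff_l2)
  note l\<eta> = l2_test_functions_lebesgue_on[OF assms(1) t] and lg\<eta> = l2_gradient_test_functions[OF assms(1) t]
  have i: "integrable (lebesgue_on \<Omega>) (\<lambda>x. (u x - \<eta> k x)\<^sup>2)"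
    "integrable (lebesgue_on \<Omega>) (\<lambda>x. (norm (weak_gradient \<Omega> u x - gradient (\<eta> k) x))\<^sup>2)" for k
    using l2_integrable[OF l2_diff[OF lu l\<eta>]] l2_integrable[OF l2_diff[OF lg lg\<eta>]] by auto
  have "(\<lambda>k. \<integral>x. (norm (\<eta> k x - u x))\<^sup>2 \<partial>lebesgue_on \<Omega>) \<longlonglongrightarrow> 0"
    using lim
  proof (rule tendsto_sandwich[OF _ _ tendsto_const, rotated 2])
    show "\<forall>\<^sub>F k in sequentially. (\<integral>x. (norm (\<eta> k x - u x))\<^sup>2 \<partial>lebesgue_on \<Omega>)
      \<le> (\<integral>x. (u x - \<eta> k x)\<^sup>2 + (norm (weak_gradient \<Omega> u x - gradient (\<eta> k) x))\<^sup>2 \<partial>lebesgue_on \<Omega>)"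
      using i by (intro always_eventually allI integral_mono) (auto simp: power2_commute)
  qed simp
  moreover have "(\<lambda>k. \<integral>x. (norm (gradient (\<eta> k) x - weak_gradient \<Omega> u x))\<^sup>2 \<partial>lebesgue_on \<Omega>) \<longlonglongrightarrow> 0"
    using lim
  proof (rule tendsto_sandwich[OF _ _ tendsto_const, rotated 2])
    show "\<forall>\<^sub>F k in sequentially. (\<integral>x. (norm (gradient (\<eta> k) x - weak_gradient \<Omega> u x))\<^sup>2 \<partial>lebesgue_on \<Omega>)
      \<le> (\<integral>x. (u x - \<eta> k x)\<^sup>2 + (norm (weak_gradient \<Omega> u x - gradient (\<eta> k) x))\<^sup>2 \<partial>lebesgue_on \<Omega>)"
      using i by (intro always_eventually allI integral_mono) (auto simp: norm_minus_commute)
  qed simp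
  ultimately have "h1_lim \<Omega> \<eta> u (weak_gradient \<Omega> u)"
    using t lu lg l\<eta> lg\<eta> by (simp add: h1_lim_def l2_lim_def)
  then show ?thesis by (rule that)
qed

lemma l2_lim_lborel_imp_lebesgue:
  fixes f :: "'a :: euclidean_space \<Rightarrow> real"
  assumes "l2_lim lborel F f"
  shows "l2_lim lebesgue F f"
proof -
  have l: "l2 lborel (F k)" "l2 lborel f" for k using assms by (auto simp: l2_lim_def)
  have [measurable]: "F k \<in> borel_measurable borel" "f \<in> borel_measurable borel" for k
    using l by (auto simp: l2_def)
  have "(\<integral>x. (norm (F k x - f x))\<^sup>2 \<partial>lebesgue) = (\<integral>x. (norm (F k x - f x))\<^sup>2 \<partial>lborel)" for k
    by (rule integral_completion) simp
  moreover have "l2 lebesgue (F k)" "l2 lebesgue f" for k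
    using l[THEN l2_lborel_imp_lebesgue_on, of UNIV] by (auto simp: lebesgue_on_UNIV_eq)
  ultimately show ?thesis using assms by (simp add: l2_lim_def)
qed

lemma l2_lim_cong_AE:
  assumes "l2_lim M F f" "AE x in M. f x = g x" "g \<in> borel_measurable M"
  shows "l2_lim M F g"
  by (rule l2_lim_bound[OF _ _ assms(1), where C = 1])
    (use assms in \<open>auto simp: l2_lim_def intro: l2_cong_AE elim: eventually_mono\<close>)

text \<open>Mollification commutes with the weak gradient: the derivative of the kernel is minus the
  derivative of the reflected kernel, which is a test function in \<open>y\<close>, and the defining
  identity of the weak gradient supplies a second minus sign. The primed functions are Borel
  representatives.\<close>

lemma conv_weak_gradient:
  fixes u :: "real ^ 'N \<Rightarrow> real"
  assumes w: "is_weak_gradient UNIV u g" "l2 lebesgue u"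
    and u': "u' \<in> borel_measurable borel" "AE x in lebesgue. u x = u' x"
    and g': "g' \<in> borel_measurable borel" "AE x in lebesgue. g x $ i = g' x"
    and K: "K \<in> test_functions UNIV"
  shows "conv (\<lambda>z. gradient K z $ i) u' x = conv K g' x"
proof -
  let ?\<eta> = "\<lambda>y. K (x - y)"
  have t: "?\<eta> \<in> test_functions UNIV" by (rule test_functions_reflect[OF K])
  have um: "u \<in> borel_measurable (lebesgue_on UNIV)" and gm: "(\<lambda>x. g x $ i) \<in> borel_measurable (lebesgue_on UNIV)"
    using w l2_component[of lebesgue g i]
    by (auto simp: is_weak_gradient_def square_integrable_iff_l2 lebesgue_on_UNIV_eq l2_def)
  have d: "K differentiable (at z)" for z using Ck_differentiable[OF test_functions_Ck[OF K]] .
  have "conv (\<lambda>z. gradient K z $ i) u' x = - (\<integral>y. u' y * gradient ?\<eta> y $ i \<partial>lborel)"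
    by (simp add: conv_def gradient_reflect[OF d] mult.commute)
  also have "(\<integral>y. u' y * gradient ?\<eta> y $ i \<partial>lborel) = (\<integral>y. u y * gradient ?\<eta> y $ i \<partial>lebesgue_on UNIV)"
    by (rule test_functions_integral_rep[OF test_functions_gradient[OF t] um _ u'(1), symmetric]) (use u'(2) in auto)
  also have "\<dots> = - (\<integral>y. g y $ i * ?\<eta> y \<partial>lebesgue_on UNIV)"
    using w(1) t by (simp add: is_weak_gradient_def)
  also have "(\<integral>y. g y $ i * ?\<eta> y \<partial>lebesgue_on UNIV) = (\<integral>y. g' y * ?\<eta> y \<partial>lborel)"
    by (rule test_functions_integral_rep[OF t gm _ g'(1)]) (use g'(2) in auto)
  finally show ?thesis by (simp add: conv_def mult.commute)
qed

text \<open>The approximation mollifies \<open>u\<close> and cuts it off.\<close>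

lemma H1_UNIV_imp_h1_lim:
  fixes u :: "real ^ 'N \<Rightarrow> real"
  assumes "u \<in> H1 UNIV"
  obtains \<eta> where "h1_lim UNIV \<eta> u (weak_gradient UNIV u)"
proof -
  define g where "g = weak_gradient UNIV u"
  have w: "is_weak_gradient UNIV u g"
    unfolding g_def by (rule is_weak_gradient_weak_gradient[OF assms])
  have lu: "l2 (lebesgue_on UNIV) u" and lg: "l2 (lebesgue_on UNIV) g"
    using assms w by (auto simp: H1_def is_weak_gradient_def square_integrable_iff_l2)
  have lgi: "l2 (lebesgue_on UNIV) (\<lambda>x. g x $ i)" for i using lg by (rule l2_component)
  obtain u' where u': "u' \<in> borel_measurable borel" "AE x in lebesgue. indicator UNIV x * u x = u' x"
    using lebesgue_on_borel_rep[OF l2_measurable[OF lu]] by auto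
  have "\<exists>G. G \<in> borel_measurable borel \<and> (AE x in lebesgue. indicator UNIV x * g x $ i = G x)" for i
  proof -
    obtain G where "G \<in> borel_measurable borel" "AE x in lebesgue. indicator UNIV x * g x $ i = G x"
      using lebesgue_on_borel_rep[OF l2_measurable[OF lgi[of i]]] by auto
    then show ?thesis by blast
  qed
  then have "\<exists>g'. \<forall>i. g' i \<in> borel_measurable borel \<and> (AE x in lebesgue. indicator UNIV x * g x $ i = g' i x)"
    by (intro choice) blast
  then obtain g' where g': "\<And>i. g' i \<in> borel_measurable borel"
    "\<And>i. AE x in lebesgue. indicator UNIV x * g x $ i = g' i x" by blast
  have lu': "l2 lborel u'" by (rule l2_rep[OF lu _ u']) simp
  have lg': "l2 lborel (g' i)" for i by (rule l2_rep[OF lgi _ g']) simp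
  define v where "v k = conv (mollifier k) u'" for k
  have Ckv: "Ck j (v k)" for j k
    unfolding v_def by (rule Ck_conv[OF test_functions_mollifier loc_int_l2[OF lu']])
  have gv: "gradient (v k) x $ i = conv (mollifier k) (g' i) x" for k x i
  proof -
    have "gradient (v k) x $ i = conv (\<lambda>z. gradient (mollifier k) z $ i) u' x"
      unfolding v_def by (simp add: gradient_conv[OF test_functions_mollifier loc_int_l2[OF lu']])
    also have "\<dots> = conv (mollifier k) (g' i) x"
      by (rule conv_weak_gradient[OF w _ u'(1) _ g'(1) _ test_functions_mollifier])
        (use lu u'(2) g'(2) in \<open>auto simp: lebesgue_on_UNIV_eq\<close>)
    finally show ?thesis .
  qed
  \<comment> \<open>The factor \<open>exp 1\<close> compensates the maximum \<open>exp (- 1)\<close>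
    of the bump, so \<open>\<psi> k\<close> stays below 1 and tends to 1.\<close>
  define \<psi> where "\<psi> k x = exp 1 * bump (real (Suc k)) x" for k and x :: "real ^ 'N"
  have \<psi>t: "\<psi> k \<in> test_functions UNIV" for k
    unfolding \<psi>_def by (intro test_functions_mult test_functions_bump Ck_const) simp
  have \<psi>1: "\<bar>\<psi> k x\<bar> \<le> 1" for k x
    using mult_left_mono[OF bump_le[of "real (Suc k)" x], of "exp 1"] bump_nonneg[of "real (Suc k)" x]
    by (simp add: \<psi>_def abs_mult exp_minus)
  have \<psi>lim: "(\<lambda>k. \<psi> k x) \<longlonglongrightarrow> 1" for x
    unfolding \<psi>_def using tendsto_mult_left[OF bump_tendsto[of x], of "exp 1"] by (simp add: exp_minus)
  obtain C where C: "C \<ge> 0" "\<And>(R :: real) (x :: real ^ 'N). R > 0 \<Longrightarrow> norm (gradient (bump R) x) \<le> C / R"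
    by (rule gradient_bump_bound) blast
  have \<psi>g: "\<bar>gradient (\<psi> k) x $ i\<bar> \<le> exp 1 * (C / real (Suc k))" for k x i
  proof -
    have d: "bump (real (Suc k)) differentiable (at x)"
      using Ck_differentiable[OF Ck_bump] .
    have "gradient (\<psi> k) x = exp 1 *\<^sub>R gradient (bump (real (Suc k))) x"
      unfolding \<psi>_def by (subst gradient_mult) (use d in auto)
    moreover have "exp 1 * \<bar>gradient (bump (real (Suc k))) x $ i\<bar> \<le> exp 1 * (C / real (Suc k))"
      by (intro mult_left_mono order_trans[OF component_le_norm_cart C(2)]) simp_all
    ultimately show ?thesis by (simp only: vector_scaleR_component abs_mult real_scaleR_def abs_exp_cancel)
  qed
  have \<psi>g0: "(\<lambda>k. gradient (\<psi> k) x $ i) \<longlonglongrightarrow> 0" for x i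
  proof (rule Lim_null_comparison)
    show "\<forall>\<^sub>F k in sequentially. norm (gradient (\<psi> k) x $ i) \<le> exp 1 * C * inverse (real (Suc k))"
      by (intro always_eventually allI) (use \<psi>g in \<open>simp only: real_norm_def divide_inverse mult.assoc\<close>)
    show "(\<lambda>k. exp 1 * C * inverse (real (Suc k))) \<longlonglongrightarrow> 0"
      by (rule tendsto_mult_right_zero[OF LIMSEQ_inverse_real_of_nat])
  qed
  have \<psi>gb: "\<bar>gradient (\<psi> k) x $ i\<bar> \<le> exp 1 * C" for k x i
  proof -
    have "C / real (Suc k) \<le> C" using C(1) by (simp add: field_simps mult_left_le)
    then show ?thesis using \<psi>g[of k x i] mult_left_mono[of "C / real (Suc k)" C "exp 1"] by simp
  qed
  define \<eta> where "\<eta> k x = v k x * \<psi> k x" for k x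
  have t: "\<eta> k \<in> test_functions UNIV" for k
    unfolding \<eta>_def by (rule test_functions_mult[OF \<psi>t Ckv])
  have grad: "gradient (\<eta> k) x $ i = \<psi> k x * conv (mollifier k) (g' i) x + gradient (\<psi> k) x $ i * v k x" for k x i
  proof -
    have d: "\<psi> k differentiable (at x)" "v k differentiable (at x)"
      using Ck_differentiable[OF test_functions_Ck[OF \<psi>t]] Ck_differentiable[OF Ckv] by auto
    show ?thesis unfolding \<eta>_def gradient_mult[OF d(2,1)] by (simp add: gv mult.commute)
  qed
  have \<psi>m: "\<psi> k \<in> borel_measurable lborel" "(\<lambda>x. gradient (\<psi> k) x $ i) \<in> borel_measurable lborel" for k i
    using test_functions_borel[OF \<psi>t] test_functions_borel[OF test_functions_gradient[OF \<psi>t]] by simp_all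
  have limv: "l2_lim lborel v u'" unfolding v_def by (rule l2_lim_mollify[OF lu'])
  have "l2_lim lborel (\<lambda>k x. \<psi> k x *\<^sub>R v k x) (\<lambda>x. 1 *\<^sub>R u' x)"
    by (rule l2_lim_mult_bounded[OF limv _ _ \<psi>1]) (use \<psi>m \<psi>lim in auto)
  then have lim1: "l2_lim lborel \<eta> u'"
    by (simp add: \<eta>_def[abs_def] mult.commute)
  have lim2: "l2_lim lborel (\<lambda>k x. gradient (\<eta> k) x $ i) (g' i)" for i
  proof -
    have "l2_lim lborel (\<lambda>k x. \<psi> k x *\<^sub>R conv (mollifier k) (g' i) x) (\<lambda>x. 1 *\<^sub>R g' i x)"
      by (rule l2_lim_mult_bounded[OF l2_lim_mollify[OF lg'] _ _ \<psi>1]) (use \<psi>m \<psi>lim in auto)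
    \<comment> \<open>The extra term of the product rule tends to 0, as the gradient of the cut-off
      is of order \<open>1 / (k + 1)\<close>.\<close>
    moreover have "l2_lim lborel (\<lambda>k x. gradient (\<psi> k) x $ i *\<^sub>R v k x) (\<lambda>x. 0 *\<^sub>R u' x)"
      by (rule l2_lim_mult_bounded[OF limv _ _ \<psi>gb]) (use \<psi>m \<psi>g0 in auto)
    ultimately show ?thesis using l2_lim_add by (fastforce simp: grad)
  qed
  have "l2_lim (lebesgue_on UNIV) \<eta> u"
  proof (rule l2_lim_cong_AE[OF _ _ l2_measurable[OF lu]])
    show "l2_lim (lebesgue_on UNIV) \<eta> u'"
      unfolding lebesgue_on_UNIV_eq by (rule l2_lim_lborel_imp_lebesgue[OF lim1])
    show "AE x in lebesgue_on UNIV. u' x = u x"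
      unfolding lebesgue_on_UNIV_eq using u'(2) by eventually_elim simp
  qed
  moreover have "l2_lim (lebesgue_on UNIV) (\<lambda>k. gradient (\<eta> k)) g"
  proof (rule l2_lim_vec)
    fix i
    show "l2_lim (lebesgue_on UNIV) (\<lambda>k x. gradient (\<eta> k) x $ i) (\<lambda>x. g x $ i)"
    proof (rule l2_lim_cong_AE[OF _ _ l2_measurable[OF lgi]])
      show "l2_lim (lebesgue_on UNIV) (\<lambda>k x. gradient (\<eta> k) x $ i) (g' i)"
        unfolding lebesgue_on_UNIV_eq by (rule l2_lim_lborel_imp_lebesgue[OF lim2])
      show "AE x in lebesgue_on UNIV. g' i x = g x $ i"
        unfolding lebesgue_on_UNIV_eq using g'(2)[of i] by eventually_elim simp
    qed
  qed
  ultimately have "h1_lim UNIV \<eta> u g" using t by (simp add: h1_lim_def)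
  then show ?thesis using that by (simp add: g_def)
qed

section \<open>The space H and its approximation by test functions\<close>

lemma Hsp_imp_H1: "u \<in> Hsp \<Omega> \<Longrightarrow> u \<in> H1 \<Omega>"
  by (auto simp: Hsp_def H10_def split: if_splits)

lemma Hsp_imp_l2:
  assumes "u \<in> Hsp \<Omega>"
  shows "l2 (lebesgue_on \<Omega>) u" "l2 (lebesgue_on \<Omega>) (weak_gradient \<Omega> u)"
  using is_weak_gradient_weak_gradient[OF Hsp_imp_H1[OF assms]] Hsp_imp_H1[OF assms]
  by (auto simp: H1_def is_weak_gradient_def square_integrable_iff_l2)

lemma HspI:
  assumes "open \<Omega>" "h1_lim \<Omega> \<eta> u g" "\<Omega> = UNIV \<Longrightarrow> radially_symmetric u"
  shows "u \<in> Hsp \<Omega>"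
  using h1_lim_imp_H10[OF assms(1,2)] assms(3) by (auto simp: Hsp_def H10_def)

lemma h1_lim_subseq:
  assumes "h1_lim \<Omega> \<eta> u g" "strict_mono r"
  shows "h1_lim \<Omega> (\<lambda>k. \<eta> (r k)) u g"
  using assms l2_lim_subseq[OF _ assms(2), of _ \<eta> u]
    l2_lim_subseq[OF _ assms(2), of _ "\<lambda>k. gradient (\<eta> k)" g]
  by (auto simp: h1_lim_def)

text \<open>Both branches of the definition of \<open>Hsp\<close> give an approximation by test
  functions, on the whole space through mollification and cut-off. No symmetry is claimed for the
  approximating functions: radial symmetry is a condition on the limit alone, and
  \<open>HspI\<close> asks for it there. A subsequence adds pointwise convergence.\<close>

lemma HspE:
  assumes "open \<Omega>" "u \<in> Hsp \<Omega>"
  obtains \<eta> where "h1_lim \<Omega> \<eta> u (weak_gradient \<Omega> u)"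
    "AE x in lebesgue_on \<Omega>. (\<lambda>k. \<eta> k x) \<longlonglongrightarrow> u x"
proof -
  obtain \<eta> where \<eta>: "h1_lim \<Omega> \<eta> u (weak_gradient \<Omega> u)"
  proof (cases "\<Omega> = UNIV")
    case True
    then have "u \<in> H1 UNIV" using Hsp_imp_H1[OF assms(2)] by simp
    from H1_UNIV_imp_h1_lim[OF this] show ?thesis using that True by blast
  next
    case False
    then have "u \<in> H10 \<Omega>" using assms(2) by (simp add: Hsp_def)
    from H10_imp_h1_lim[OF assms(1) this] show ?thesis using that by blast
  qed
  then have "l2_lim (lebesgue_on \<Omega>) \<eta> u" by (simp add: h1_lim_def)
  then obtain r where "strict_mono r" "AE x in lebesgue_on \<Omega>. (\<lambda>k. \<eta> (r k) x) \<longlonglongrightarrow> u x"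
    by (rule l2_lim_AE_subseq)
  then show ?thesis using that[OF h1_lim_subseq[OF \<eta>]] by blast
qed

lemma Hsp_radial: "u \<in> Hsp UNIV \<Longrightarrow> radially_symmetric u"
  by (simp add: Hsp_def)

lemma radially_symmetric_compose2:
  assumes "radially_symmetric u" "radially_symmetric v"
  shows "radially_symmetric (\<lambda>x. F (u x) (v x))"
proof -
  obtain a b where "AE x in lebesgue. u x = a (norm x)" "AE x in lebesgue. v x = b (norm x)"
    using assms by (auto simp: radially_symmetric_def)
  then have "AE x in lebesgue. F (u x) (v x) = F (a (norm x)) (b (norm x))" by eventually_elim simp
  then show ?thesis unfolding radially_symmetric_def by (intro exI[of _ "\<lambda>r. F (a r) (b r)"])
qed

lemma h1_lim_lincomb:
  assumes "h1_lim \<Omega> \<eta> u g" "h1_lim \<Omega> \<zeta> v h"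
  shows "h1_lim \<Omega> (\<lambda>k x. a * \<eta> k x + b * \<zeta> k x) (\<lambda>x. a * u x + b * v x) (\<lambda>x. a *\<^sub>R g x + b *\<^sub>R h x)"
proof -
  have t: "\<eta> k \<in> test_functions \<Omega>" "\<zeta> k \<in> test_functions \<Omega>" for k
    using assms by (auto simp: h1_lim_def)
  have d: "\<eta> k differentiable (at x)" "\<zeta> k differentiable (at x)" for k x
    using Ck_differentiable[OF test_functions_Ck[OF t(1)]] Ck_differentiable[OF test_functions_Ck[OF t(2)]] by auto
  have "gradient (\<lambda>x. a * \<eta> k x + b * \<zeta> k x) x = a *\<^sub>R gradient (\<eta> k) x + b *\<^sub>R gradient (\<zeta> k) x" for k x
  proof (rule gradient_eqI)
    show "((\<lambda>x. a * \<eta> k x + b * \<zeta> k x) has_derivative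
        (\<lambda>h. (a *\<^sub>R gradient (\<eta> k) x + b *\<^sub>R gradient (\<zeta> k) x) \<bullet> h)) (at x)"
      using has_derivative_add[OF has_derivative_mult_right[OF has_derivative_gradient[OF d(1)], of a k x]
          has_derivative_mult_right[OF has_derivative_gradient[OF d(2)], of b k x]]
      by (simp add: inner_add_left)
  qed
  then have grad: "gradient (\<lambda>x. a * \<eta> k x + b * \<zeta> k x) = (\<lambda>x. a *\<^sub>R gradient (\<eta> k) x + b *\<^sub>R gradient (\<zeta> k) x)" for k
    by auto
  have "l2_lim (lebesgue_on \<Omega>) (\<lambda>k x. a *\<^sub>R \<eta> k x + b *\<^sub>R \<zeta> k x) (\<lambda>x. a *\<^sub>R u x + b *\<^sub>R v x)"
    "l2_lim (lebesgue_on \<Omega>) (\<lambda>k x. a *\<^sub>R gradient (\<eta> k) x + b *\<^sub>R gradient (\<zeta> k) x) (\<lambda>x. a *\<^sub>R g x + b *\<^sub>R h x)"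
    by (intro l2_lim_add l2_lim_scaleR; use assms in \<open>simp add: h1_lim_def\<close>)+
  moreover have "(\<lambda>x. a * \<eta> k x + b * \<zeta> k x) \<in> test_functions \<Omega>" for k
    by (intro test_functions_add test_functions_mult t Ck_const)
  ultimately show ?thesis by (simp add: h1_lim_def grad)
qed

lemma Hsp_lincomb:
  assumes "open \<Omega>" "u \<in> Hsp \<Omega>" "v \<in> Hsp \<Omega>"
  shows "(\<lambda>x. a * u x + b * v x) \<in> Hsp \<Omega>"
    and "AE x in lebesgue_on \<Omega>. weak_gradient \<Omega> (\<lambda>x. a * u x + b * v x) x
      = a *\<^sub>R weak_gradient \<Omega> u x + b *\<^sub>R weak_gradient \<Omega> v x"
proof -
  obtain \<eta> where \<eta>: "h1_lim \<Omega> \<eta> u (weak_gradient \<Omega> u)" using HspE[OF assms(1,2)] by blast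
  obtain \<zeta> where \<zeta>: "h1_lim \<Omega> \<zeta> v (weak_gradient \<Omega> v)" using HspE[OF assms(1,3)] by blast
  note lim = h1_lim_lincomb[OF \<eta> \<zeta>, of a b]
  show "(\<lambda>x. a * u x + b * v x) \<in> Hsp \<Omega>"
  proof (rule HspI[OF assms(1) lim])
    assume "\<Omega> = UNIV"
    with assms(2,3) show "radially_symmetric (\<lambda>x. a * u x + b * v x)"
      using radially_symmetric_compose2[OF Hsp_radial Hsp_radial, of u v "\<lambda>s t. a * s + b * t"] by simp
  qed
  show "AE x in lebesgue_on \<Omega>. weak_gradient \<Omega> (\<lambda>x. a * u x + b * v x) x
      = a *\<^sub>R weak_gradient \<Omega> u x + b *\<^sub>R weak_gradient \<Omega> v x"
    by (rule h1_lim_imp_H10(2)[OF assms(1) lim])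
qed

section \<open>Truncation by the sine\<close>

lemma sin_chain:
  fixes \<delta> :: real
  assumes "\<delta> \<noteq> 0"
  shows "((\<lambda>t. \<delta> ^ j / \<delta> * sin (\<delta> * t + real j * (pi / 2))) has_real_derivative
    \<delta> ^ Suc j / \<delta> * sin (\<delta> * t + real (Suc j) * (pi / 2))) (at t)"
proof -
  have "sin (\<delta> * t + real (Suc j) * (pi / 2)) = cos (\<delta> * t + real j * (pi / 2))"
  proof -
    have "\<delta> * t + real (Suc j) * (pi / 2) = (\<delta> * t + real j * (pi / 2)) + pi / 2" by (simp add: field_simps)
    then show ?thesis by (simp only: sin_add) simp
  qed
  then show ?thesis by (auto intro!: derivative_eq_intros simp: assms)
qed

lemma sin_diff_le: "\<bar>sin a - sin b\<bar> \<le> \<bar>a - b\<bar>" for a b :: real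
proof -
  have "sin a - sin b = 2 * sin ((a - b) / 2) * cos ((a + b) / 2)" by (rule sin_diff_sin)
  also have "\<bar>\<dots>\<bar> \<le> 2 * \<bar>(a - b) / 2\<bar> * 1"
    unfolding abs_mult by (intro mult_mono abs_sin_x_le_abs_x) auto
  finally show ?thesis by simp
qed

text \<open>The scaled sine is Lipschitz with constant 1, which settles the functions themselves. In
  the gradients the chain rule brings in the factor \<open>cos (\<delta> * \<eta> k x)\<close>,
  bounded and pointwise convergent; this is where the almost everywhere convergence of
  \<open>\<eta>\<close> enters.\<close>

lemma h1_lim_sin:
  assumes lim: "h1_lim \<Omega> \<eta> u g" and ae: "AE x in lebesgue_on \<Omega>. (\<lambda>k. \<eta> k x) \<longlonglongrightarrow> u x" and \<delta>: "\<delta> > 0"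
  shows "h1_lim \<Omega> (\<lambda>k x. sin (\<delta> * \<eta> k x) / \<delta>) (\<lambda>x. sin (\<delta> * u x) / \<delta>) (\<lambda>x. cos (\<delta> * u x) *\<^sub>R g x)"
proof -
  have t: "\<eta> k \<in> test_functions \<Omega>" for k using lim by (simp add: h1_lim_def)
  have l: "l2_lim (lebesgue_on \<Omega>) \<eta> u" "l2_lim (lebesgue_on \<Omega>) (\<lambda>k. gradient (\<eta> k)) g"
    using lim by (auto simp: h1_lim_def)
  have m[measurable]: "u \<in> borel_measurable (lebesgue_on \<Omega>)" "\<eta> k \<in> borel_measurable (lebesgue_on \<Omega>)" for k
    using l(1) by (auto simp: l2_lim_def l2_def)
  have bd: "\<bar>sin (\<delta> * a) / \<delta> - sin (\<delta> * b) / \<delta>\<bar> \<le> \<bar>a - b\<bar>" for a b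
  proof -
    have "\<bar>sin (\<delta> * a) / \<delta> - sin (\<delta> * b) / \<delta>\<bar> = \<bar>sin (\<delta> * a) - sin (\<delta> * b)\<bar> / \<delta>"
      using \<delta> by (simp add: diff_divide_distrib[symmetric])
    also have "\<dots> \<le> \<bar>\<delta> * a - \<delta> * b\<bar> / \<delta>"
      using \<delta> by (intro divide_right_mono sin_diff_le) simp
    also have "\<delta> * a - \<delta> * b = \<delta> * (a - b)" by (simp add: algebra_simps)
    finally show ?thesis using \<delta> by (simp add: abs_mult)
  qed
  have tt: "(\<lambda>x. sin (\<delta> * \<eta> k x) / \<delta>) \<in> test_functions \<Omega>" for k
  proof -
    obtain S where S: "compact S" "S \<subseteq> \<Omega>" "\<And>x. x \<notin> S \<Longrightarrow> \<eta> k x = 0"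
      by (rule test_functionsE[OF t[of k]]) blast
    \<comment> \<open>All derivatives of the truncation are sines shifted by multiples of
      \<open>pi / 2\<close>; the entry with index 0 is the truncation itself.\<close>
    have "Ck j (\<lambda>x. \<delta> ^ 0 / \<delta> * sin (\<delta> * \<eta> k x + real 0 * (pi / 2)))" for j
      by (rule Ck_compose[where F = "\<lambda>j t. \<delta> ^ j / \<delta> * sin (\<delta> * t + real j * (pi / 2))"])
        (use \<delta> sin_chain test_functions_Ck[OF t] in auto)
    then show ?thesis by (intro test_functionsI[OF _ S(1,2)]) (auto simp: S(3))
  qed
  have grad: "gradient (\<lambda>x. sin (\<delta> * \<eta> k x) / \<delta>) = (\<lambda>x. cos (\<delta> * \<eta> k x) *\<^sub>R gradient (\<eta> k) x)" for k
  proof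
    fix x
    have "((\<lambda>t. sin (\<delta> * t) / \<delta>) has_real_derivative cos (\<delta> * \<eta> k x)) (at (\<eta> k x))"
      using \<delta> by (auto intro!: derivative_eq_intros)
    from gradient_eqI[OF gradient_compose[OF this Ck_differentiable[OF test_functions_Ck[OF t]]]]
    show "gradient (\<lambda>x. sin (\<delta> * \<eta> k x) / \<delta>) x = cos (\<delta> * \<eta> k x) *\<^sub>R gradient (\<eta> k) x" .
  qed
  have "l2_lim (lebesgue_on \<Omega>) (\<lambda>k x. sin (\<delta> * \<eta> k x) / \<delta>) (\<lambda>x. sin (\<delta> * u x) / \<delta>)"
  proof (rule l2_lim_bound[OF _ _ l(1), where C = 1])
    show "l2 (lebesgue_on \<Omega>) (\<lambda>x. sin (\<delta> * \<eta> k x) / \<delta>)" for k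
      by (rule l2_mono[OF l2_lim_l2[OF l(1), of k], where C = 1])
        (use bd[of "\<eta> k _" 0] in auto)
    show "l2 (lebesgue_on \<Omega>) (\<lambda>x. sin (\<delta> * u x) / \<delta>)"
      by (rule l2_mono[OF l2_lim_l2'[OF l(1)], where C = 1]) (use bd[of "u _" 0] in auto)
  qed (use bd in auto)
  moreover have "l2_lim (lebesgue_on \<Omega>) (\<lambda>k x. cos (\<delta> * \<eta> k x) *\<^sub>R gradient (\<eta> k) x) (\<lambda>x. cos (\<delta> * u x) *\<^sub>R g x)"
  proof (rule l2_lim_mult_bounded[OF l(2), where B = 1])
    show "AE x in lebesgue_on \<Omega>. (\<lambda>k. cos (\<delta> * \<eta> k x)) \<longlonglongrightarrow> cos (\<delta> * u x)"
      using ae by eventually_elim (intro tendsto_intros)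
    show "(\<lambda>x. cos (\<delta> * \<eta> k x)) \<in> borel_measurable (lebesgue_on \<Omega>)" for k by measurable
    show "(\<lambda>x. cos (\<delta> * u x)) \<in> borel_measurable (lebesgue_on \<Omega>)" by measurable
    show "\<bar>cos (\<delta> * \<eta> k x)\<bar> \<le> 1" for k x by (rule abs_cos_le_one)
  qed
  ultimately show ?thesis using tt by (simp add: h1_lim_def grad)
qed

section \<open>The ground state\<close>

text \<open>The polynomial has a minimum at 0, so the linear coefficient vanishes. Dividing by
  \<open>t\<^sup>2\<close> and letting \<open>t\<close> tend to 0 gives the sign of the quadratic
  coefficient.\<close>

lemma polynomial_nonneg_at_0:
  fixes a1 a2 a3 a4 :: real
  assumes "\<And>t. 0 \<le> a1 * t + a2 * t ^ 2 + a3 * t ^ 3 + a4 * t ^ 4"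
  shows "a1 = 0" "a2 \<ge> 0"
proof -
  let ?p = "\<lambda>t. a1 * t + a2 * t ^ 2 + a3 * t ^ 3 + a4 * t ^ 4"
  have "(?p has_real_derivative a1) (at 0)" by (auto intro!: derivative_eq_intros)
  then show "a1 = 0"
    by (rule DERIV_local_min[where d = 1]) (use assms in auto)
  have "((\<lambda>t. a2 + a3 * t + a4 * t\<^sup>2) \<longlongrightarrow> a2 + a3 * 0 + a4 * 0\<^sup>2) (at 0)"
    by (intro tendsto_intros)
  moreover have "0 \<le> a2 + a3 * t + a4 * t\<^sup>2" if "t \<noteq> 0" for t
  proof -
    have "0 \<le> t\<^sup>2 * (a2 + a3 * t + a4 * t\<^sup>2)"
      using assms[of t] \<open>a1 = 0\<close> by (simp add: power2_eq_square power3_eq_cube power4_eq_xxxx algebra_simps)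
    then show ?thesis using that by (simp add: zero_le_mult_iff)
  qed
  then have "\<forall>\<^sub>F t in at 0. 0 \<le> a2 + a3 * t + a4 * t\<^sup>2"
    by (simp add: eventually_at_filter)
  ultimately show "a2 \<ge> 0" using tendsto_lowerbound[of _ _ "at (0 :: real)" 0] by fastforce
qed

lemma sin_div_tendsto: "(\<lambda>k. sin (1 / real (Suc k) * t) / (1 / real (Suc k))) \<longlonglongrightarrow> t"
proof -
  have "((\<lambda>s. sin (s * t)) has_real_derivative t) (at 0)" by (auto intro!: derivative_eq_intros)
  then have "((\<lambda>h. sin (h * t) / h) \<longlongrightarrow> t) (at 0)" by (simp add: DERIV_def)
  moreover have "filterlim (\<lambda>k. 1 / real (Suc k)) (at 0) sequentially"
    using LIMSEQ_inverse_real_of_nat by (simp add: filterlim_at inverse_eq_divide)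
  ultimately show ?thesis by (rule filterlim_compose)
qed

lemma abs_sin_div_le:
  fixes \<delta> t :: real
  assumes "\<delta> > 0"
  shows "\<bar>sin (\<delta> * t) / \<delta>\<bar> \<le> \<bar>t\<bar>" "\<bar>sin (\<delta> * t) / \<delta>\<bar> \<le> 1 / \<delta>"
proof -
  have "\<bar>sin (\<delta> * t)\<bar> / \<delta> \<le> \<bar>\<delta> * t\<bar> / \<delta>"
    using assms by (intro divide_right_mono abs_sin_x_le_abs_x) simp
  then show "\<bar>sin (\<delta> * t) / \<delta>\<bar> \<le> \<bar>t\<bar>" using assms by (simp add: abs_mult)
  have "\<bar>sin (\<delta> * t)\<bar> / \<delta> \<le> 1 / \<delta>"
    using assms by (intro divide_right_mono abs_sin_le_one) simp
  then show "\<bar>sin (\<delta> * t) / \<delta>\<bar> \<le> 1 / \<delta>" using assms by simp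
qed

locale ground_state =
  fixes \<Omega> :: "(real ^ 'N) set" and lam :: real and U :: "real ^ 'N \<Rightarrow> real"
  assumes open_\<Omega>: "open \<Omega>" and \<Omega>_nonempty: "\<Omega> \<noteq> {}" and lam_pos: "lam > 0"
    and ground: "least_energy_positive_solution \<Omega> lam U"
begin

abbreviation "M \<equiv> lebesgue_on \<Omega>"
abbreviation "Dw \<equiv> weak_gradient \<Omega>"

definition B :: "(real ^ 'N \<Rightarrow> real) \<Rightarrow> (real ^ 'N \<Rightarrow> real) \<Rightarrow> real" where
  "B u v = (\<integral>x. Dw u x \<bullet> Dw v x + lam * (u x * v x) \<partial>M)"

text \<open>The squared norm of \<open>H\<close>, with \<open>B\<close> as its polar form.\<close>

definition Q :: "(real ^ 'N \<Rightarrow> real) \<Rightarrow> real" where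
  "Q u = (\<integral>x. (norm (Dw u x))\<^sup>2 + lam * (u x)\<^sup>2 \<partial>M)"

lemma U_Hsp: "U \<in> Hsp \<Omega>" and U_pos: "AE x in M. U x > 0"
  using ground by (auto simp: least_energy_positive_solution_def scalar_solution_def)

lemma Hsp_measurable:
  assumes "u \<in> Hsp \<Omega>"
  shows "u \<in> borel_measurable M" "Dw u \<in> borel_measurable M"
  using Hsp_imp_l2[OF assms] by (auto simp: l2_def)

lemma Q_integrable:
  assumes "u \<in> Hsp \<Omega>"
  shows "integrable M (\<lambda>x. (norm (Dw u x))\<^sup>2 + lam * (u x)\<^sup>2)"
  using l2_integrable[OF Hsp_imp_l2(1)[OF assms]] l2_integrable[OF Hsp_imp_l2(2)[OF assms]] by simp

lemma B_integrable:
  assumes "u \<in> Hsp \<Omega>" "v \<in> Hsp \<Omega>"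
  shows "integrable M (\<lambda>x. Dw u x \<bullet> Dw v x + lam * (u x * v x))"
  using integrable_inner[OF Hsp_imp_l2(2)[OF assms(1)] Hsp_imp_l2(2)[OF assms(2)]]
    integrable_mult[OF Hsp_imp_l2(1)[OF assms(1)] Hsp_imp_l2(1)[OF assms(2)]] by simp

lemma Q_lincomb:
  assumes u: "u \<in> Hsp \<Omega>" and v: "v \<in> Hsp \<Omega>"
  shows "Q (\<lambda>x. a * u x + b * v x) = a\<^sup>2 * Q u + 2 * a * b * B u v + b\<^sup>2 * Q v"
proof -
  note [measurable] = Hsp_measurable[OF u] Hsp_measurable[OF v]
    Hsp_measurable[OF Hsp_lincomb(1)[OF open_\<Omega> u v, of a b]]
  have "Q (\<lambda>x. a * u x + b * v x) = (\<integral>x. a\<^sup>2 * ((norm (Dw u x))\<^sup>2 + lam * (u x)\<^sup>2)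
      + 2 * a * b * (Dw u x \<bullet> Dw v x + lam * (u x * v x)) + b\<^sup>2 * ((norm (Dw v x))\<^sup>2 + lam * (v x)\<^sup>2) \<partial>M)"
    unfolding Q_def
  proof (rule integral_cong_AE)
    show "AE x in M. (norm (Dw (\<lambda>x. a * u x + b * v x) x))\<^sup>2 + lam * (a * u x + b * v x)\<^sup>2
        = a\<^sup>2 * ((norm (Dw u x))\<^sup>2 + lam * (u x)\<^sup>2)
      + 2 * a * b * (Dw u x \<bullet> Dw v x + lam * (u x * v x)) + b\<^sup>2 * ((norm (Dw v x))\<^sup>2 + lam * (v x)\<^sup>2)"
      using Hsp_lincomb(2)[OF open_\<Omega> u v, of a b]
    proof eventually_elim
      case (elim x)
      have "(norm (a *\<^sub>R Dw u x + b *\<^sub>R Dw v x))\<^sup>2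
          = a\<^sup>2 * (norm (Dw u x))\<^sup>2 + 2 * a * b * (Dw u x \<bullet> Dw v x) + b\<^sup>2 * (norm (Dw v x))\<^sup>2"
        unfolding power2_norm_eq_inner
        by (simp add: inner_add_left inner_add_right inner_commute power2_eq_square algebra_simps)
      then show ?case unfolding elim by (simp add: power2_eq_square algebra_simps)
    qed
  qed measurable
  also have "\<dots> = a\<^sup>2 * Q u + 2 * a * b * B u v + b\<^sup>2 * Q v"
    using Q_integrable[OF u] Q_integrable[OF v] B_integrable[OF u v]
    unfolding Q_def B_def by simp
  finally show ?thesis .
qed

lemma Q_nonneg: "Q u \<ge> 0"
  unfolding Q_def using lam_pos by (intro Bochner_Integration.integral_nonneg) simp

lemma Q_pos:
  assumes "u \<in> Hsp \<Omega>" "\<not> (AE x in M. u x = 0)"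
  shows "Q u > 0"
proof -
  have "Q u \<noteq> 0"
  proof
    assume "Q u = 0"
    then have "AE x in M. (norm (Dw u x))\<^sup>2 + lam * (u x)\<^sup>2 = 0"
      unfolding Q_def using Q_integrable[OF assms(1)] lam_pos
      by (subst (asm) integral_nonneg_eq_0_iff_AE) auto
    then have "AE x in M. u x = 0"
    proof eventually_elim
      case (elim x)
      have "lam * (u x)\<^sup>2 \<ge> 0" using lam_pos by simp
      then have "lam * (u x)\<^sup>2 = 0" using elim zero_le_power2[of "norm (Dw u x)"] by linarith
      then show ?case using lam_pos by simp
    qed
    with assms(2) show False by blast
  qed
  with Q_nonneg[of u] show ?thesis by linarith
qed

lemma AE_M_not_False: "\<not> (AE x in M. False)"
proof
  assume *: "AE x in M. False"
  have "\<Omega> \<in> sets lebesgue" using open_\<Omega> by (simp add: lmeasurable_open)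
  then have "AE x in lebesgue. x \<notin> \<Omega>" using * by (subst (asm) AE_restrict_space_iff) auto
  then have "negligible \<Omega>"
    using \<open>\<Omega> \<in> sets lebesgue\<close> by (simp add: negligible_iff_null_sets AE_iff_null_sets)
  then show False using open_not_negligible[OF open_\<Omega> \<Omega>_nonempty] by simp
qed

lemma U_nonzero: "\<not> (AE x in M. U x = 0)"
proof
  assume "AE x in M. U x = 0"
  with U_pos have "AE x in M. False" by eventually_elim simp
  with AE_M_not_False show False by simp
qed

lemma power4_nonneg_integral: "0 \<le> (\<integral>x. (u x :: real) ^ 4 \<partial>M)"
  by (intro Bochner_Integration.integral_nonneg) simp

text \<open>If the integral of \<open>v\<^sup>4\<close> is not 0, the multiple \<open>s v\<close>
  with \<open>s\<^sup>2 = Q v / \<integral>v\<^sup>4\<close> lies on the Nehari manifold, and its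
  energy is \<open>(Q v)\<^sup>2 / (4 \<integral>v\<^sup>4)\<close>. Written as a product, the
  inequality also makes sense when the integral is 0.\<close>

lemma energy_le:
  assumes v: "v \<in> Hsp \<Omega>" and i: "integrable M (\<lambda>x. v x ^ 4)"
  shows "4 * scalar_energy \<Omega> lam U * (\<integral>x. v x ^ 4 \<partial>M) \<le> (Q v)\<^sup>2"
proof (cases "(\<integral>x. v x ^ 4 \<partial>M) = 0")
  case False
  let ?V = "\<integral>x. v x ^ 4 \<partial>M"
  have V: "?V > 0" using False power4_nonneg_integral[of v] by linarith
  have nz: "\<not> (AE x in M. v x = 0)"
  proof
    assume "AE x in M. v x = 0"
    then have "AE x in M. v x ^ 4 = 0" by eventually_elim simp
    then have "?V = 0" by (rule integral_eq_zero_AE)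
    with False show False by simp
  qed
  have Qv: "Q v > 0" by (rule Q_pos[OF v nz])
  define s where "s = sqrt (Q v / ?V)"
  have s2: "s\<^sup>2 = Q v / ?V" using Qv V by (simp add: s_def)
  have "s > 0" using Qv V by (simp add: s_def)
  \<comment> \<open>The summand \<open>0 * v x\<close> brings \<open>w\<close> into the shape of
    \<open>Hsp_lincomb\<close> and \<open>Q_lincomb\<close>.\<close>
  define w where "w x = s * v x + 0 * v x" for x
  have w: "w \<in> Hsp \<Omega>" unfolding w_def by (rule Hsp_lincomb(1)[OF open_\<Omega> v v])
  have Qw: "Q w = s\<^sup>2 * Q v" unfolding w_def Q_lincomb[OF v v] by simp
  have Vw: "(\<integral>x. w x ^ 4 \<partial>M) = (s\<^sup>2)\<^sup>2 * ?V" unfolding w_def by (simp add: power_mult_distrib)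
  have "\<not> (AE x in M. w x = 0)"
  proof
    assume "AE x in M. w x = 0"
    then have "AE x in M. v x = 0" by eventually_elim (use \<open>s > 0\<close> in \<open>simp add: w_def\<close>)
    with nz show False by blast
  qed
  moreover have "Q w = (\<integral>x. w x ^ 4 \<partial>M)"
    unfolding Qw Vw s2 using V by (simp add: field_simps power2_eq_square)
  ultimately have "w \<in> nehari_manifold \<Omega> lam"
    using w by (simp add: nehari_manifold_def Q_def)
  then have "scalar_energy \<Omega> lam U \<le> scalar_energy \<Omega> lam w"
    using ground by (simp add: least_energy_positive_solution_def)
  also have "\<dots> = 1/2 * Q w - 1/4 * (\<integral>x. w x ^ 4 \<partial>M)"
    by (simp add: scalar_energy_def Q_def)
  also have "\<dots> = (Q v)\<^sup>2 / (4 * ?V)"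
    unfolding Qw Vw s2 using V by (simp add: field_simps power2_eq_square)
  finally show ?thesis using V by (simp add: field_simps)
qed simp

lemma sin_Hsp:
  assumes u: "u \<in> Hsp \<Omega>" and \<delta>: "\<delta> > 0"
  shows "(\<lambda>x. sin (\<delta> * u x) / \<delta>) \<in> Hsp \<Omega>"
    and "AE x in M. Dw (\<lambda>x. sin (\<delta> * u x) / \<delta>) x = cos (\<delta> * u x) *\<^sub>R Dw u x"
proof -
  obtain \<eta> where \<eta>: "h1_lim \<Omega> \<eta> u (Dw u)" "AE x in M. (\<lambda>k. \<eta> k x) \<longlonglongrightarrow> u x"
    by (rule HspE[OF open_\<Omega> u])
  note lim = h1_lim_sin[OF \<eta> \<delta>]
  show "(\<lambda>x. sin (\<delta> * u x) / \<delta>) \<in> Hsp \<Omega>"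
  proof (rule HspI[OF open_\<Omega> lim])
    assume "\<Omega> = UNIV"
    with u have "radially_symmetric u" using Hsp_radial by simp
    from radially_symmetric_compose2[OF this this, of "\<lambda>s t. sin (\<delta> * s) / \<delta>"]
    show "radially_symmetric (\<lambda>x. sin (\<delta> * u x) / \<delta>)" .
  qed
  show "AE x in M. Dw (\<lambda>x. sin (\<delta> * u x) / \<delta>) x = cos (\<delta> * u x) *\<^sub>R Dw u x"
    by (rule h1_lim_imp_H10(2)[OF open_\<Omega> lim])
qed

text \<open>The factor \<open>cos (\<delta> * u x)\<close> shrinks the gradient and the truncation
  shrinks the values. The bound is uniform in \<open>\<delta>\<close>, as the passage to the limit
  by Fatou's lemma demands.\<close>

lemma Q_sin_le:
  assumes u: "u \<in> Hsp \<Omega>" and \<delta>: "\<delta> > 0"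
  shows "Q (\<lambda>x. sin (\<delta> * u x) / \<delta>) \<le> Q u"
  unfolding Q_def
proof (rule integral_mono_AE[OF Q_integrable[OF sin_Hsp(1)[OF assms]] Q_integrable[OF u]])
  show "AE x in M. (norm (Dw (\<lambda>x. sin (\<delta> * u x) / \<delta>) x))\<^sup>2 + lam * (sin (\<delta> * u x) / \<delta>)\<^sup>2
      \<le> (norm (Dw u x))\<^sup>2 + lam * (u x)\<^sup>2"
    using sin_Hsp(2)[OF assms]
  proof eventually_elim
    case (elim x)
    have "\<bar>cos (\<delta> * u x)\<bar> * norm (Dw u x) \<le> 1 * norm (Dw u x)"
      by (intro mult_right_mono) auto
    then have "(norm (cos (\<delta> * u x) *\<^sub>R Dw u x))\<^sup>2 \<le> (norm (Dw u x))\<^sup>2"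
      by (intro power_mono) auto
    moreover have "(sin (\<delta> * u x) / \<delta>)\<^sup>2 \<le> (u x)\<^sup>2"
      using abs_sin_div_le(1)[OF \<delta>, of "u x"] by (simp only: abs_le_square_iff)
    ultimately show ?case unfolding elim using lam_pos by (intro add_mono mult_left_mono) auto
  qed
qed

text \<open>One square of the truncated value is bounded by \<open>(1 / \<delta>)\<^sup>2\<close>,
  the other by \<open>(u x)\<^sup>2\<close>, so the square integrability of \<open>u\<close>
  suffices.\<close>

lemma sin_power4_integrable:
  assumes u: "u \<in> Hsp \<Omega>" and \<delta>: "\<delta> > 0"
  shows "integrable M (\<lambda>x. (sin (\<delta> * u x) / \<delta>) ^ 4)"
proof (rule Bochner_Integration.integrable_bound)
  note [measurable] = Hsp_measurable[OF u]
  show "integrable M (\<lambda>x. (1 / \<delta>)\<^sup>2 * (u x)\<^sup>2)"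
    using l2_integrable[OF Hsp_imp_l2(1)[OF u]] by simp
  show "(\<lambda>x. (sin (\<delta> * u x) / \<delta>) ^ 4) \<in> borel_measurable M" by measurable
  have "norm ((sin (\<delta> * u x) / \<delta>) ^ 4) \<le> norm ((1 / \<delta>)\<^sup>2 * (u x)\<^sup>2)" for x
  proof -
    let ?s = "sin (\<delta> * u x) / \<delta>"
    have "?s\<^sup>2 \<le> (u x)\<^sup>2" using abs_sin_div_le(1)[OF \<delta>, of "u x"] by (simp only: abs_le_square_iff)
    moreover have "?s\<^sup>2 \<le> (1 / \<delta>)\<^sup>2"
      using abs_sin_div_le(2)[OF \<delta>, of "u x"] \<delta> by (simp only: abs_le_square_iff[symmetric] abs_divide abs_one abs_of_pos)
    ultimately have "?s\<^sup>2 * ?s\<^sup>2 \<le> (1 / \<delta>)\<^sup>2 * (u x)\<^sup>2" by (intro mult_mono) auto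
    moreover have "?s ^ 4 = ?s\<^sup>2 * ?s\<^sup>2" by (simp only: power2_eq_square power4_eq_xxxx mult.assoc)
    ultimately show ?thesis by (simp only: real_norm_def abs_of_nonneg zero_le_power2 mult_nonneg_nonneg)
  qed
  then show "AE x in M. norm ((sin (\<delta> * u x) / \<delta>) ^ 4) \<le> norm ((1 / \<delta>)\<^sup>2 * (u x)\<^sup>2)" by simp
qed

text \<open>The minimality of \<open>U\<close> is itself a Sobolev inequality; it is first applied to the bounded
  functions \<open>sin (\<delta> u) / \<delta>\<close>.\<close>

lemma energy_pos_imp_power4_integrable:
  assumes E: "scalar_energy \<Omega> lam U > 0" and u: "u \<in> Hsp \<Omega>"
  shows "integrable M (\<lambda>x. u x ^ 4)"
proof -
  note [measurable] = Hsp_measurable[OF u]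
  define v where "v k x = sin (1 / real (Suc k) * u x) / (1 / real (Suc k))" for k x
  have vH: "v k \<in> Hsp \<Omega>" for k unfolding v_def by (rule sin_Hsp(1)[OF u]) simp
  have vi: "integrable M (\<lambda>x. v k x ^ 4)" for k unfolding v_def by (rule sin_power4_integrable[OF u]) simp
  define C where "C = (Q u)\<^sup>2 / (4 * scalar_energy \<Omega> lam U)"
  have le: "(\<integral>x. v k x ^ 4 \<partial>M) \<le> C" for k
  proof -
    have "Q (v k) \<le> Q u" unfolding v_def by (rule Q_sin_le[OF u]) simp
    then have "(Q (v k))\<^sup>2 \<le> (Q u)\<^sup>2" using Q_nonneg by (intro power_mono)
    then have "4 * scalar_energy \<Omega> lam U * (\<integral>x. v k x ^ 4 \<partial>M) \<le> (Q u)\<^sup>2"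
      using energy_le[OF vH vi, of k] by linarith
    then show ?thesis using E by (simp add: C_def field_simps)
  qed
  \<comment> \<open>Fatou's lemma: the truncations converge pointwise to \<open>u\<close>, and their
    fourth powers have integrals bounded by \<open>C\<close> independently of
    \<open>k\<close>.\<close>
  have "(\<integral>\<^sup>+x. ennreal (u x ^ 4) \<partial>M) = (\<integral>\<^sup>+x. liminf (\<lambda>k. ennreal (v k x ^ 4)) \<partial>M)"
  proof (rule nn_integral_cong)
    fix x
    have "(\<lambda>k. v k x) \<longlonglongrightarrow> u x" unfolding v_def by (rule sin_div_tendsto)
    then have "(\<lambda>k. ennreal (v k x ^ 4)) \<longlonglongrightarrow> ennreal (u x ^ 4)"
      by (intro tendsto_ennrealI tendsto_power)
    from lim_imp_Liminf[OF sequentially_bot this]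
    show "ennreal (u x ^ 4) = liminf (\<lambda>k. ennreal (v k x ^ 4))" by (rule sym)
  qed
  also have "\<dots> \<le> liminf (\<lambda>k. \<integral>\<^sup>+x. ennreal (v k x ^ 4) \<partial>M)"
    by (rule nn_integral_liminf) (simp add: v_def)
  also have "\<dots> \<le> ennreal C"
  proof (rule Liminf_le)
    show "\<forall>\<^sub>F k in sequentially. (\<integral>\<^sup>+x. ennreal (v k x ^ 4) \<partial>M) \<le> ennreal C"
      using le vi by (intro always_eventually allI) (simp add: nn_integral_eq_integral ennreal_leI)
  qed simp
  finally show ?thesis
    by (intro integrableI_bounded) (auto simp: less_top[symmetric] top_unique)
qed

text \<open>A nonintegrable function has integral 0 by convention. Were \<open>U\<^sup>4\<close> not
  integrable, the energy of \<open>U\<close> would therefore be \<open>Q U / 2 > 0\<close>; but a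
  positive level forces the fourth powers of all elements of \<open>H\<close> to be
  integrable.\<close>

lemma U_power4_integrable: "integrable M (\<lambda>x. U x ^ 4)"
proof (rule ccontr)
  assume *: "\<not> integrable M (\<lambda>x. U x ^ 4)"
  then have "scalar_energy \<Omega> lam U = 1/2 * Q U"
    by (simp add: scalar_energy_def Q_def not_integrable_integral_eq)
  then have "scalar_energy \<Omega> lam U > 0" using Q_pos[OF U_Hsp U_nonzero] by simp
  from energy_pos_imp_power4_integrable[OF this U_Hsp] * show False by simp
qed

lemma U_power3_integrable: "integrable M (\<lambda>x. U x ^ 3)"
proof (rule Bochner_Integration.integrable_bound)
  note [measurable] = Hsp_measurable[OF U_Hsp]
  show "integrable M (\<lambda>x. (U x)\<^sup>2 + U x ^ 4)"
    using l2_integrable[OF Hsp_imp_l2(1)[OF U_Hsp]] U_power4_integrable by simp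
  show "(\<lambda>x. U x ^ 3) \<in> borel_measurable M" by measurable
  have "norm (U x ^ 3) \<le> norm ((U x)\<^sup>2 + U x ^ 4)" for x
  proof -
    have "\<bar>U x\<bar> * 1 \<le> 1 + (U x)\<^sup>2"
      using sum_squares_bound[of "\<bar>U x\<bar>" 1] by (simp add: power2_eq_square)
    from mult_left_mono[OF this zero_le_power2[of "U x"]]
    show ?thesis by (simp add: abs_mult power2_eq_square power3_eq_cube power4_eq_xxxx algebra_simps)
  qed
  then show "AE x in M. norm (U x ^ 3) \<le> norm ((U x)\<^sup>2 + U x ^ 4)" by simp
qed

text \<open>\<open>U\<close> itself need not be a test function, but its truncation is the limit of
  test functions \<open>\<zeta> k\<close> bounded by \<open>1 / \<delta>\<close>. On the right-hand
  side \<open>\<bar>U x ^ 3\<bar> / \<delta>\<close> is then an integrable majorant; mean square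
  convergence of \<open>\<zeta>\<close> would not suffice there, since \<open>U\<^sup>3\<close> is
  only known to be integrable.\<close>

lemma test_with_sin:
  assumes \<delta>: "\<delta> > 0"
  shows "(\<integral>x. cos (\<delta> * U x) * (norm (Dw U x))\<^sup>2 \<partial>M) + lam * (\<integral>x. sin (\<delta> * U x) / \<delta> * U x \<partial>M)
    = (\<integral>x. U x ^ 3 * (sin (\<delta> * U x) / \<delta>) \<partial>M)"
proof -
  note [measurable] = Hsp_measurable[OF U_Hsp]
  note l = Hsp_imp_l2[OF U_Hsp]
  obtain \<eta> where \<eta>: "h1_lim \<Omega> \<eta> U (Dw U)" "AE x in M. (\<lambda>k. \<eta> k x) \<longlonglongrightarrow> U x"
    by (rule HspE[OF open_\<Omega> U_Hsp])
  define \<zeta> where "\<zeta> k x = sin (\<delta> * \<eta> k x) / \<delta>" for k x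
  have lim: "h1_lim \<Omega> \<zeta> (\<lambda>x. sin (\<delta> * U x) / \<delta>) (\<lambda>x. cos (\<delta> * U x) *\<^sub>R Dw U x)"
    unfolding \<zeta>_def by (rule h1_lim_sin[OF \<eta> \<delta>])
  then have t: "\<zeta> k \<in> test_functions \<Omega>"
    and l1: "l2_lim M \<zeta> (\<lambda>x. sin (\<delta> * U x) / \<delta>)"
    and l2: "l2_lim M (\<lambda>k. gradient (\<zeta> k)) (\<lambda>x. cos (\<delta> * U x) *\<^sub>R Dw U x)" for k
    by (auto simp: h1_lim_def)
  have [measurable]: "\<zeta> k \<in> borel_measurable M" for k using l2_lim_l2[OF l1] by (simp add: l2_def)
  have "(\<lambda>k. (\<integral>x. gradient (\<zeta> k) x \<bullet> Dw U x \<partial>M) + lam * (\<integral>x. \<zeta> k x * U x \<partial>M))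
      \<longlonglongrightarrow> (\<integral>x. (cos (\<delta> * U x) *\<^sub>R Dw U x) \<bullet> Dw U x \<partial>M) + lam * (\<integral>x. sin (\<delta> * U x) / \<delta> * U x \<partial>M)"
    by (intro tendsto_intros l2_lim_inner[OF l2 l(2)] l2_lim_mult[OF l1 l(1)])
  moreover have "(\<lambda>k. \<integral>x. U x ^ 3 * \<zeta> k x \<partial>M) \<longlonglongrightarrow> (\<integral>x. U x ^ 3 * (sin (\<delta> * U x) / \<delta>) \<partial>M)"
  proof (rule integral_dominated_convergence)
    show "integrable M (\<lambda>x. 1 / \<delta> * \<bar>U x ^ 3\<bar>)" using U_power3_integrable by simp
    show "AE x in M. (\<lambda>k. U x ^ 3 * \<zeta> k x) \<longlonglongrightarrow> U x ^ 3 * (sin (\<delta> * U x) / \<delta>)"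
      using \<eta>(2) unfolding \<zeta>_def by eventually_elim (use \<delta> in \<open>intro tendsto_intros, auto\<close>)
    have "norm (U x ^ 3 * \<zeta> k x) \<le> 1 / \<delta> * \<bar>U x ^ 3\<bar>" for k x
      using mult_left_mono[OF abs_sin_div_le(2)[OF \<delta>, of "\<eta> k x"], of "\<bar>U x ^ 3\<bar>"]
      by (simp add: \<zeta>_def abs_mult mult.commute)
    then show "AE x in M. norm (U x ^ 3 * \<zeta> k x) \<le> 1 / \<delta> * \<bar>U x ^ 3\<bar>" for k by simp
  qed measurable
  moreover have "(\<integral>x. gradient (\<zeta> k) x \<bullet> Dw U x \<partial>M) + lam * (\<integral>x. \<zeta> k x * U x \<partial>M) = (\<integral>x. U x ^ 3 * \<zeta> k x \<partial>M)" for k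
  proof -
    have "(\<integral>x. U x ^ 3 * \<zeta> k x \<partial>M) = (\<integral>x. Dw U x \<bullet> gradient (\<zeta> k) x + lam * U x * \<zeta> k x \<partial>M)"
      using ground t[of k] by (simp add: least_energy_positive_solution_def scalar_solution_def)
    also have "\<dots> = (\<integral>x. gradient (\<zeta> k) x \<bullet> Dw U x + lam * (\<zeta> k x * U x) \<partial>M)"
      by (intro Bochner_Integration.integral_cong) (auto simp: inner_commute mult_ac)
    also have "\<dots> = (\<integral>x. gradient (\<zeta> k) x \<bullet> Dw U x \<partial>M) + lam * (\<integral>x. \<zeta> k x * U x \<partial>M)"
      using integrable_inner[OF l2_lim_l2[OF l2] l(2)] integrable_mult[OF l2_lim_l2[OF l1] l(1)] by simp
    finally show ?thesis by (rule sym)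
  qed
  ultimately have "(\<integral>x. (cos (\<delta> * U x) *\<^sub>R Dw U x) \<bullet> Dw U x \<partial>M) + lam * (\<integral>x. sin (\<delta> * U x) / \<delta> * U x \<partial>M)
      = (\<integral>x. U x ^ 3 * (sin (\<delta> * U x) / \<delta>) \<partial>M)"
    using LIMSEQ_unique by simp
  then show ?thesis by (simp add: power2_norm_eq_inner)
qed

text \<open>In the equation tested with the truncation, \<open>\<delta>\<close> tends to 0 under the
  majorants \<open>(norm (Dw U x))\<^sup>2\<close>, \<open>(U x)\<^sup>2\<close> and
  \<open>U x ^ 4\<close>. The result places \<open>U\<close> on the Nehari manifold, which makes the
  ground state level \<open>Q U / 4\<close> and hence positive.\<close>

lemma Q_U: "Q U = (\<integral>x. U x ^ 4 \<partial>M)"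
proof -
  note [measurable] = Hsp_measurable[OF U_Hsp]
  define d where "d k = 1 / real (Suc k)" for k
  have d: "d k > 0" for k by (simp add: d_def)
  have dlim: "d \<longlonglongrightarrow> 0" using LIMSEQ_inverse_real_of_nat by (simp add: d_def[abs_def] inverse_eq_divide)
  have slim: "(\<lambda>k. sin (d k * t) / d k) \<longlonglongrightarrow> t" for t unfolding d_def by (rule sin_div_tendsto)
  note i = l2_integrable[OF Hsp_imp_l2(2)[OF U_Hsp]] l2_integrable[OF Hsp_imp_l2(1)[OF U_Hsp]]
  have 1: "(\<lambda>k. \<integral>x. cos (d k * U x) * (norm (Dw U x))\<^sup>2 \<partial>M) \<longlonglongrightarrow> (\<integral>x. (norm (Dw U x))\<^sup>2 \<partial>M)"
  proof (rule integral_dominated_convergence[OF _ _ i(1)])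
    have "(\<lambda>k. cos (d k * U x) * (norm (Dw U x))\<^sup>2) \<longlonglongrightarrow> cos (0 * U x) * (norm (Dw U x))\<^sup>2" for x
      by (intro tendsto_intros dlim)
    then show "AE x in M. (\<lambda>k. cos (d k * U x) * (norm (Dw U x))\<^sup>2) \<longlonglongrightarrow> (norm (Dw U x))\<^sup>2" by simp
    show "AE x in M. norm (cos (d k * U x) * (norm (Dw U x))\<^sup>2) \<le> (norm (Dw U x))\<^sup>2" for k
      by (intro AE_I2) (auto simp: abs_mult intro!: mult_left_le_one_le)
  qed measurable
  have 2: "(\<lambda>k. \<integral>x. sin (d k * U x) / d k * U x \<partial>M) \<longlonglongrightarrow> (\<integral>x. U x * U x \<partial>M)"
  proof (rule integral_dominated_convergence[where w = "\<lambda>x. (U x)\<^sup>2"])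
    show "AE x in M. (\<lambda>k. sin (d k * U x) / d k * U x) \<longlonglongrightarrow> U x * U x"
      by (intro AE_I2 tendsto_mult slim tendsto_const)
    have "norm (sin (d k * U x) / d k * U x) \<le> (U x)\<^sup>2" for k x
      using mult_right_mono[OF abs_sin_div_le(1)[OF d, of k "U x"] abs_ge_zero[of "U x"]]
      by (simp add: abs_mult power2_eq_square)
    then show "AE x in M. norm (sin (d k * U x) / d k * U x) \<le> (U x)\<^sup>2" for k by simp
  qed (use i in auto)
  have 3: "(\<lambda>k. \<integral>x. U x ^ 3 * (sin (d k * U x) / d k) \<partial>M) \<longlonglongrightarrow> (\<integral>x. U x ^ 3 * U x \<partial>M)"
  proof (rule integral_dominated_convergence[OF _ _ U_power4_integrable])
    show "AE x in M. (\<lambda>k. U x ^ 3 * (sin (d k * U x) / d k)) \<longlonglongrightarrow> U x ^ 3 * U x"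
      by (intro AE_I2 tendsto_mult slim tendsto_const)
    have "norm (U x ^ 3 * (sin (d k * U x) / d k)) \<le> U x ^ 4" for k x
    proof -
      have "\<bar>U x ^ 3\<bar> * \<bar>sin (d k * U x) / d k\<bar> \<le> \<bar>U x ^ 3\<bar> * \<bar>U x\<bar>"
        by (intro mult_left_mono abs_sin_div_le d) simp
      also have "\<dots> = \<bar>U x ^ 4\<bar>" by (simp add: abs_mult[symmetric] power3_eq_cube power4_eq_xxxx)
      finally show ?thesis by (simp add: abs_mult)
    qed
    then show "AE x in M. norm (U x ^ 3 * (sin (d k * U x) / d k)) \<le> U x ^ 4" for k by simp
  qed measurable
  have "(\<lambda>k. (\<integral>x. cos (d k * U x) * (norm (Dw U x))\<^sup>2 \<partial>M) + lam * (\<integral>x. sin (d k * U x) / d k * U x \<partial>M))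
      \<longlonglongrightarrow> (\<integral>x. (norm (Dw U x))\<^sup>2 \<partial>M) + lam * (\<integral>x. U x * U x \<partial>M)"
    by (intro tendsto_intros 1 2)
  then have "(\<integral>x. (norm (Dw U x))\<^sup>2 \<partial>M) + lam * (\<integral>x. U x * U x \<partial>M) = (\<integral>x. U x ^ 3 * U x \<partial>M)"
    unfolding test_with_sin[OF d] using 3 LIMSEQ_unique by blast
  moreover have "Q U = (\<integral>x. (norm (Dw U x))\<^sup>2 \<partial>M) + lam * (\<integral>x. U x * U x \<partial>M)"
    unfolding Q_def using i by (simp add: power2_eq_square)
  ultimately show ?thesis by (simp add: power3_eq_cube power4_eq_xxxx mult.assoc)
qed

lemma Q_U_pos: "Q U > 0"
  by (rule Q_pos[OF U_Hsp U_nonzero])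

lemma scalar_energy_U: "scalar_energy \<Omega> lam U = Q U / 4"
  using Q_U by (simp add: scalar_energy_def Q_def)

lemma power4_integrable: "u \<in> Hsp \<Omega> \<Longrightarrow> integrable M (\<lambda>x. u x ^ 4)"
  by (rule energy_pos_imp_power4_integrable) (use scalar_energy_U Q_U_pos in auto)

text \<open>A consequence of the integrability of fourth powers. Pairing two such products makes
  every quartic monomial integrable, so that energies along lines become polynomials.\<close>

lemma l2_product:
  assumes "u \<in> Hsp \<Omega>" "v \<in> Hsp \<Omega>"
  shows "l2 M (\<lambda>x. u x * v x)"
proof -
  note [measurable] = Hsp_measurable[OF assms(1)] Hsp_measurable[OF assms(2)]
  have "integrable M (\<lambda>x. (norm (u x * v x))\<^sup>2)"
  proof (rule Bochner_Integration.integrable_bound)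
    show "integrable M (\<lambda>x. u x ^ 4 + v x ^ 4)" using assms by (simp add: power4_integrable)
    have "a * b \<le> a\<^sup>2 + b\<^sup>2" for a b :: real
      using sum_squares_bound[of a b] zero_le_power2[of a] zero_le_power2[of b] by linarith
    from this[of "(u _)\<^sup>2" "(v _)\<^sup>2"] have "(u x * v x)\<^sup>2 \<le> u x ^ 4 + v x ^ 4" for x
      by (simp add: power_mult_distrib)
    then show "AE x in M. norm ((norm (u x * v x))\<^sup>2) \<le> norm (u x ^ 4 + v x ^ 4)"
      by (intro AE_I2) simp
  qed measurable
  then show ?thesis by (simp add: l2_def)
qed

lemma quartic_integrable:
  "u \<in> Hsp \<Omega> \<Longrightarrow> v \<in> Hsp \<Omega> \<Longrightarrow> w \<in> Hsp \<Omega> \<Longrightarrow> z \<in> Hsp \<Omega> \<Longrightarrow>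
    integrable M (\<lambda>x. (u x * v x) * (w x * z x))"
  by (intro integrable_mult l2_product)

lemma minimality:
  assumes "v \<in> Hsp \<Omega>"
  shows "Q U * (\<integral>x. v x ^ 4 \<partial>M) \<le> (Q v)\<^sup>2"
  using energy_le[OF assms power4_integrable[OF assms]] by (simp add: scalar_energy_U)

text \<open>The first and second order conditions for the minimum of \<open>Q(v)\<^sup>2 / \<integral>v\<^sup>4\<close> at \<open>v = U\<close>.\<close>

lemma
  assumes \<psi>: "\<psi> \<in> Hsp \<Omega>"
  shows B_U: "B U \<psi> = (\<integral>x. (U x * U x) * (U x * \<psi> x) \<partial>M)"
    and second_order: "3 * Q U * (\<integral>x. (U x * U x) * (\<psi> x * \<psi> x) \<partial>M) \<le> 2 * (B U \<psi>)\<^sup>2 + Q U * Q \<psi>"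
proof -
  let ?m = "Q U" and ?b = "B U \<psi>"
  define I1 where "I1 = (\<integral>x. (U x * U x) * (U x * \<psi> x) \<partial>M)"
  define I2 where "I2 = (\<integral>x. (U x * U x) * (\<psi> x * \<psi> x) \<partial>M)"
  define I3 where "I3 = (\<integral>x. (U x * \<psi> x) * (\<psi> x * \<psi> x) \<partial>M)"
  define I4 where "I4 = (\<integral>x. (\<psi> x * \<psi> x) * (\<psi> x * \<psi> x) \<partial>M)"
  have m: "?m = (\<integral>x. (U x * U x) * (U x * U x) \<partial>M)"
    unfolding Q_U by (simp add: power4_eq_xxxx mult.assoc)
  \<comment> \<open>This is \<open>minimality\<close> for \<open>U + t \<psi>\<close>, expanded in
    powers of \<open>t\<close>. The constant terms cancel because of
    \<open>Q U = \<integral>U\<^sup>4\<close>, so the polynomial attains its minimum 0 at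
    \<open>t = 0\<close>.\<close>
  have ineq: "0 \<le> (4 * ?m * ?b - 4 * ?m * I1) * t + (4 * ?b\<^sup>2 + 2 * ?m * Q \<psi> - 6 * ?m * I2) * t ^ 2
      + (4 * ?b * Q \<psi> - 4 * ?m * I3) * t ^ 3 + ((Q \<psi>)\<^sup>2 - ?m * I4) * t ^ 4" for t
  proof -
    have v: "(\<lambda>x. 1 * U x + t * \<psi> x) \<in> Hsp \<Omega>" by (rule Hsp_lincomb(1)[OF open_\<Omega> U_Hsp \<psi>])
    have eq: "(1 * U x + t * \<psi> x) ^ 4 = (U x * U x) * (U x * U x) + 4 * t * ((U x * U x) * (U x * \<psi> x))
        + 6 * t\<^sup>2 * ((U x * U x) * (\<psi> x * \<psi> x)) + 4 * t ^ 3 * ((U x * \<psi> x) * (\<psi> x * \<psi> x))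
        + t ^ 4 * ((\<psi> x * \<psi> x) * (\<psi> x * \<psi> x))" for x
      by (simp add: power2_eq_square power3_eq_cube power4_eq_xxxx algebra_simps)
    have "(\<integral>x. (1 * U x + t * \<psi> x) ^ 4 \<partial>M) = ?m + 4 * t * I1 + 6 * t\<^sup>2 * I2 + 4 * t ^ 3 * I3 + t ^ 4 * I4"
      unfolding eq m I1_def I2_def I3_def I4_def
      using quartic_integrable[OF U_Hsp U_Hsp U_Hsp U_Hsp] quartic_integrable[OF U_Hsp U_Hsp U_Hsp \<psi>]
        quartic_integrable[OF U_Hsp U_Hsp \<psi> \<psi>] quartic_integrable[OF U_Hsp \<psi> \<psi> \<psi>]
        quartic_integrable[OF \<psi> \<psi> \<psi> \<psi>] by simp
    moreover have "Q (\<lambda>x. 1 * U x + t * \<psi> x) = ?m + 2 * t * ?b + t\<^sup>2 * Q \<psi>"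
      by (subst Q_lincomb[OF U_Hsp \<psi>]) simp
    ultimately have "?m * (?m + 4 * t * I1 + 6 * t\<^sup>2 * I2 + 4 * t ^ 3 * I3 + t ^ 4 * I4)
        \<le> (?m + 2 * t * ?b + t\<^sup>2 * Q \<psi>)\<^sup>2"
      using minimality[OF v] by simp
    then show ?thesis by (simp add: power2_eq_square power3_eq_cube power4_eq_xxxx algebra_simps)
  qed
  note p = polynomial_nonneg_at_0[OF ineq]
  show "B U \<psi> = (\<integral>x. (U x * U x) * (U x * \<psi> x) \<partial>M)"
    using p(1) Q_U_pos unfolding I1_def by simp
  show "3 * Q U * (\<integral>x. (U x * U x) * (\<psi> x * \<psi> x) \<partial>M) \<le> 2 * (B U \<psi>)\<^sup>2 + Q U * Q \<psi>"
    using p(2) unfolding I2_def by simp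
qed

end

section \<open>The coupling matrix\<close>

lemma half_angle_cos_less_1:
  assumes "0 < t" "t < pi"
  shows "cos (2 * t) < 1"
  using sin_gt_zero[OF assms] by (simp add: cos_double_sin)

text \<open>The sums are real and imaginary part of a geometric sum whose ratio is an
  \<open>n\<close>-th root of unity, different from 1 because of \<open>0 < m < n\<close>.\<close>

lemma sum_roots_of_unity_eq_0:
  fixes n m :: nat
  assumes "0 < m" "m < n"
  shows "(\<Sum>k<n. cos (2 * pi * real m * real k / real n)) = 0"
    and "(\<Sum>k<n. sin (2 * pi * real m * real k / real n)) = 0"
proof -
  define t where "t = pi * real m / real n"
  define z where "z = cis (2 * t)"
  have t: "0 < t" "t < pi" using assms by (auto simp: t_def field_simps)
  have "z \<noteq> 1" using half_angle_cos_less_1[OF t] by (auto simp: z_def complex_eq_iff)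
  have zk: "z ^ k = cis (2 * pi * real m * real k / real n)" for k
    by (simp add: z_def Complex.DeMoivre t_def field_simps)
  have "z ^ n = cis (2 * pi * real m)" using assms zk[of n] by simp
  then have "z ^ n = 1" using cis_multiple_2pi[of "real m"] by (simp add: mult_ac)
  then have "(\<Sum>k<n. z ^ k) = 0" using \<open>z \<noteq> 1\<close> by (simp add: geometric_sum)
  then have "(\<Sum>k<n. cis (2 * pi * real m * real k / real n)) = 0" by (simp add: zk)
  then show "(\<Sum>k<n. cos (2 * pi * real m * real k / real n)) = 0"
    "(\<Sum>k<n. sin (2 * pi * real m * real k / real n)) = 0"
    by (simp_all add: complex_eq_iff)
qed

text \<open>The coordinates are the cosines and sines of \<open>n\<close> equally spaced angles.
  Their sums involve frequency 1, and the double angle formulas reduce the inner products to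
  frequency 2; \<open>n \<ge> 3\<close> keeps both frequencies away from the multiples of
  \<open>n\<close>. The entries of \<open>C C\<^sup>T + S S\<^sup>T\<close> are cosines of angle
  differences.\<close>

lemma circle_vectors_exist:
  assumes n: "CARD('n :: finite) \<ge> 3"
  obtains C S :: "real ^ 'n" where
    "(\<Sum>i\<in>UNIV. C $ i) = 0" "(\<Sum>i\<in>UNIV. S $ i) = 0" "C \<bullet> C = CARD('n) / 2" "S \<bullet> S = CARD('n) / 2"
    "C \<bullet> S = 0" "\<And>i. C $ i * C $ i + S $ i * S $ i = 1"
    "\<And>i j. i \<noteq> j \<Longrightarrow> C $ i * C $ j + S $ i * S $ j < 1"
proof -
  let ?n = "CARD('n)"
  obtain f where f: "bij_betw f (UNIV :: 'n set) {..<?n}"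
    using ex_bij_betw_finite_nat[of "UNIV :: 'n set"] by (auto simp: lessThan_atLeast0)
  define a where "a i = 2 * pi * real (f i) / real ?n" for i
  define C :: "real ^ 'n" where "C = (\<chi> i. cos (a i))"
  define S :: "real ^ 'n" where "S = (\<chi> i. sin (a i))"
  have reindex: "(\<Sum>i\<in>UNIV. g (f i)) = (\<Sum>k<?n. g k)" for g :: "nat \<Rightarrow> real"
    using sum.reindex_bij_betw[OF f] .
  have 1: "(\<Sum>i\<in>UNIV. cos (a i)) = 0" "(\<Sum>i\<in>UNIV. sin (a i)) = 0"
    using sum_roots_of_unity_eq_0[of 1 ?n] n
      reindex[of "\<lambda>k. cos (2 * pi * real k / real ?n)"]
      reindex[of "\<lambda>k. sin (2 * pi * real k / real ?n)"] by (simp_all add: a_def)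
  have "2 * a i = 2 * pi * real 2 * real (f i) / real ?n" for i by (simp add: a_def)
  then have 2: "(\<Sum>i\<in>UNIV. cos (2 * a i)) = 0" "(\<Sum>i\<in>UNIV. sin (2 * a i)) = 0"
    using sum_roots_of_unity_eq_0[of 2 ?n] n
      reindex[of "\<lambda>k. cos (2 * pi * real 2 * real k / real ?n)"]
      reindex[of "\<lambda>k. sin (2 * pi * real 2 * real k / real ?n)"] by simp_all
  have cc: "cos (a i) * cos (a i) = (1 + cos (2 * a i)) / 2" for i
    by (simp add: cos_double_cos power2_eq_square)
  have ss: "sin (a i) * sin (a i) = (1 - cos (2 * a i)) / 2" for i
    by (simp add: cos_double_sin power2_eq_square)
  have cs: "cos (a i) * sin (a i) = sin (2 * a i) / 2" for i
    by (simp add: sin_double)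
  have "(\<Sum>i\<in>UNIV. C $ i) = 0" "(\<Sum>i\<in>UNIV. S $ i) = 0"
    using 1 by (simp_all add: C_def S_def)
  moreover have "C \<bullet> C = ?n / 2" "S \<bullet> S = ?n / 2" "C \<bullet> S = 0"
    using 2 by (simp_all add: C_def S_def inner_vec_def cc ss cs sum.distrib sum_subtractf sum_divide_distrib[symmetric])
  moreover have "C $ i * C $ i + S $ i * S $ i = 1" for i
    by (simp add: C_def S_def power2_eq_square[symmetric])
  moreover have "C $ i * C $ j + S $ i * S $ j < 1" if "i \<noteq> j" for i j
  proof -
    have *: "cos (a i - a j) < 1" if "f i > f j" for i j
    proof -
      have "f i < ?n" using f by (auto simp: bij_betw_def)
      then have "pi * (real (f i) - real (f j)) < pi * real ?n"
        by (intro mult_strict_left_mono) auto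
      then have "cos (2 * (pi * (real (f i) - real (f j)) / real ?n)) < 1"
        using that by (intro half_angle_cos_less_1) (auto simp: divide_simps)
      moreover have "2 * (pi * (real (f i) - real (f j)) / real ?n) = a i - a j"
        by (simp add: a_def field_simps)
      ultimately show ?thesis by simp
    qed
    have "f i \<noteq> f j" using f that by (auto simp: bij_betw_def inj_on_def)
    then have "cos (a i - a j) < 1"
      using *[of i j] *[of j i] cos_minus[of "a i - a j"] by (cases "f i > f j") auto
    then show ?thesis by (simp add: C_def S_def cos_diff)
  qed
  ultimately show ?thesis by (rule that)
qed

text \<open>The matrix is \<open>\<epsilon> I + ((1 - \<epsilon>) / n) e e\<^sup>T - (\<beta> / n)
  (C C\<^sup>T + S S\<^sup>T)\<close> with the all-ones vector \<open>e\<close>. As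
  \<open>e\<close>, \<open>C\<close>, \<open>S\<close> are orthogonal with squared lengths
  \<open>n\<close>, \<open>n / 2\<close>, \<open>n / 2\<close>, it acts as 1 on \<open>e\<close>, as
  \<open>\<epsilon> - \<beta> / 2\<close> on the plane of \<open>C\<close> and \<open>S\<close>, and
  as \<open>\<epsilon>\<close> on the orthogonal complement of the three.\<close>

lemma coupling_matrix_exists:
  assumes n: "CARD('n :: finite) \<ge> 3"
  obtains A :: "real ^ 'n ^ 'n" and C S :: "real ^ 'n" where
    "det A > 0" "\<And>i j. A $ i $ j = A $ j $ i" "\<And>i j. i \<noteq> j \<Longrightarrow> A $ i $ j > 0" "\<And>i. A $ i $ i = 0"
    "\<And>i. (\<Sum>j\<in>UNIV. A $ i $ j) = 1" "\<And>x. x \<bullet> (A *v x) \<le> x \<bullet> x"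
    "\<And>x. x \<noteq> 0 \<Longrightarrow> C \<bullet> x = 0 \<Longrightarrow> S \<bullet> x = 0 \<Longrightarrow> x \<bullet> (A *v x) > 0"
    "\<And>x. x \<in> span {C, S} \<Longrightarrow> x \<bullet> (A *v x) \<le> 0" "dim {C, S} = 2"
proof -
  let ?n = "real CARD('n)"
  obtain C S :: "real ^ 'n" where sums: "(\<Sum>i\<in>UNIV. C $ i) = 0" "(\<Sum>i\<in>UNIV. S $ i) = 0"
    and CS[simp]: "C \<bullet> C = ?n / 2" "S \<bullet> S = ?n / 2" "C \<bullet> S = 0"
    and one: "\<And>i. C $ i * C $ i + S $ i * S $ i = 1"
    and less1: "\<And>i j. i \<noteq> j \<Longrightarrow> C $ i * C $ j + S $ i * S $ j < 1"
    by (rule circle_vectors_exist[OF n]) blast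
  define e :: "real ^ 'n" where "e = (\<chi> i. 1)"
  have e[simp]: "e \<bullet> e = ?n" "e \<bullet> C = 0" "e \<bullet> S = 0" "C \<bullet> e = 0" "S \<bullet> e = 0" "S \<bullet> C = 0"
    using sums CS(3) by (simp_all only: inner_commute[of S C]) (simp_all add: e_def inner_vec_def)
  have npos: "?n \<ge> 3" using n by simp
  define G where "G = {C $ i * C $ j + S $ i * S $ j | i j. i \<noteq> j}"
  have "finite G"
  proof -
    have "G \<subseteq> (\<lambda>(i, j). C $ i * C $ j + S $ i * S $ j) ` UNIV" by (auto simp: G_def)
    then show ?thesis by (rule finite_subset) simp
  qed
  \<comment> \<open>A bound below 1 for all off-diagonal entries of
    \<open>C C\<^sup>T + S S\<^sup>T\<close>; inserting 0 makes it nonnegative.\<close>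
  define c where "c = Max (insert 0 G)"
  have "c < 1" unfolding c_def using \<open>finite G\<close> less1 by (subst Max_less_iff) (auto simp: G_def)
  have c0: "c \<ge> 0" unfolding c_def using \<open>finite G\<close> by (intro Max_ge) auto
  have cG: "C $ i * C $ j + S $ i * S $ j \<le> c" if "i \<noteq> j" for i j
    unfolding c_def using \<open>finite G\<close> that by (intro Max_ge) (auto simp: G_def)
  \<comment> \<open>Chosen so that \<open>c + \<epsilon> n = (1 + c) / 2 < 1\<close>. This leads to
    \<open>\<beta> c < 1 - \<epsilon>\<close>, which is the positivity of the off-diagonal
    entries.\<close>
  define \<epsilon> where "\<epsilon> = (1 - c) / (2 * ?n)"
  have eps: "0 < \<epsilon>" "\<epsilon> < 1" using \<open>c < 1\<close> c0 npos by (auto simp: \<epsilon>_def field_simps)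
  \<comment> \<open>Each diagonal entry is
    \<open>\<epsilon> + (1 - \<epsilon>) / n - \<beta> / n\<close>, as the points with coordinates
    \<open>C $ i\<close> and \<open>S $ i\<close> lie on the unit circle; this
    \<open>\<beta>\<close> makes it 0.\<close>
  define \<beta> where "\<beta> = 1 + \<epsilon> * (?n - 1)"
  have \<beta>: "\<beta> > 0" "\<epsilon> < \<beta> / 2"
  proof -
    have "\<epsilon> * (?n - 1) \<ge> \<epsilon> * 2" using eps npos by (intro mult_left_mono) auto
    then have "2 * \<epsilon> < \<beta>" unfolding \<beta>_def by linarith
    then show "\<beta> > 0" "\<epsilon> < \<beta> / 2" using eps by linarith+
  qed
  have \<beta>c: "\<beta> * c < 1 - \<epsilon>"
  proof -
    have "\<epsilon> * ?n = (1 - c) / 2" using npos by (simp add: \<epsilon>_def)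
    have "(?n - 1) * c \<le> ?n - 1" using \<open>c < 1\<close> npos by (intro mult_left_le) auto
    then have "\<epsilon> * ((?n - 1) * c) \<le> \<epsilon> * (?n - 1)" using eps by (intro mult_left_mono) auto
    then have "\<beta> * c \<le> c + \<epsilon> * ?n - \<epsilon>" by (simp add: \<beta>_def algebra_simps)
    then have "\<beta> * c \<le> c + (1 - c) / 2 - \<epsilon>" by (simp only: \<open>\<epsilon> * ?n = (1 - c) / 2\<close>)
    also have "c + (1 - c) / 2 < 1" using \<open>c < 1\<close> by (simp add: field_simps)
    finally show ?thesis by simp
  qed
  define A :: "real ^ 'n ^ 'n" where "A = (\<chi> i j. \<epsilon> * (if i = j then 1 else 0) + (1 - \<epsilon>) / ?n
      - \<beta> / ?n * (C $ i * C $ j + S $ i * S $ j))"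
  have Av: "A *v x = \<epsilon> *\<^sub>R x + ((1 - \<epsilon>) / ?n * (e \<bullet> x)) *\<^sub>R e
      - (\<beta> / ?n * (C \<bullet> x)) *\<^sub>R C - (\<beta> / ?n * (S \<bullet> x)) *\<^sub>R S" for x
  proof -
    have "(A *v x) $ i = \<epsilon> * x $ i + (1 - \<epsilon>) / ?n * (e \<bullet> x)
      - \<beta> / ?n * (C \<bullet> x) * C $ i - \<beta> / ?n * (S \<bullet> x) * S $ i" for i
    proof -
      have "(A *v x) $ i = (\<Sum>j\<in>UNIV. (if i = j then \<epsilon> * x $ j else 0) + (1 - \<epsilon>) / ?n * x $ j
          - \<beta> / ?n * C $ i * (C $ j * x $ j) - \<beta> / ?n * S $ i * (S $ j * x $ j))"
        unfolding A_def matrix_vector_mult_def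
        by (simp, intro sum.cong refl) (simp add: algebra_simps add_divide_distrib)
      also have "\<dots> = \<epsilon> * x $ i + (1 - \<epsilon>) / ?n * (\<Sum>j\<in>UNIV. x $ j)
          - \<beta> / ?n * C $ i * (\<Sum>j\<in>UNIV. C $ j * x $ j) - \<beta> / ?n * S $ i * (\<Sum>j\<in>UNIV. S $ j * x $ j)"
        by (simp only: sum.distrib sum_subtractf sum_distrib_left[symmetric] sum.delta' sum.delta finite UNIV_I if_True)
      finally show ?thesis by (simp add: inner_vec_def e_def mult_ac)
    qed
    then show ?thesis by (simp add: vec_eq_iff e_def)
  qed
  have form: "x \<bullet> (A *v x) = \<epsilon> * (x \<bullet> x) + (1 - \<epsilon>) / ?n * (e \<bullet> x)\<^sup>2
      - \<beta> / ?n * (C \<bullet> x)\<^sup>2 - \<beta> / ?n * (S \<bullet> x)\<^sup>2" for x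
    unfolding Av by (simp add: inner_add_right inner_diff_right inner_commute[of x e] inner_commute[of x C]
        inner_commute[of x S] power2_eq_square)
  \<comment> \<open>The map \<open>F\<close> is a real square root of \<open>A\<close>: the identity
    on \<open>e\<close>, a quarter turn scaled by \<open>b\<close> on the plane of \<open>C\<close>
    and \<open>S\<close>, and multiplication by \<open>\<alpha>\<close> on the rest. A quarter turn
    squares to -1, which is how the double negative eigenvalue gets a real root. So
    \<open>det A\<close> is a square, and no characteristic polynomial is computed.\<close>
  define \<alpha> where "\<alpha> = sqrt \<epsilon>"
  define b where "b = sqrt (\<beta> / 2 - \<epsilon>)"
  have \<alpha>2: "\<alpha> * \<alpha> = \<epsilon>" and b2: "b * b = \<beta> / 2 - \<epsilon>"
    using eps \<beta> by (simp_all add: \<alpha>_def b_def)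
  define F where "F x = \<alpha> *\<^sub>R x + ((1 - \<alpha>) / ?n * (e \<bullet> x)) *\<^sub>R e
      - (2 * \<alpha> / ?n * (C \<bullet> x) + 2 * b / ?n * (S \<bullet> x)) *\<^sub>R C
      + (2 * b / ?n * (C \<bullet> x) - 2 * \<alpha> / ?n * (S \<bullet> x)) *\<^sub>R S" for x
  have "linear F"
    by (rule linearI) (simp_all add: F_def vec_eq_iff inner_add_right add_divide_distrib diff_divide_distrib algebra_simps)
  have Fe: "e \<bullet> F x = e \<bullet> x" and FC: "C \<bullet> F x = - b * (S \<bullet> x)" and FS: "S \<bullet> F x = b * (C \<bullet> x)" for x
    using npos by (simp_all add: F_def inner_add_right inner_diff_right field_simps)
  have "F (F x) = A *v x" for x
  proof -
    have "F (F x) = \<alpha> *\<^sub>R F x + ((1 - \<alpha>) / ?n * (e \<bullet> x)) *\<^sub>R e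
        - (2 * \<alpha> / ?n * (- b * (S \<bullet> x)) + 2 * b / ?n * (b * (C \<bullet> x))) *\<^sub>R C
        + (2 * b / ?n * (- b * (S \<bullet> x)) - 2 * \<alpha> / ?n * (b * (C \<bullet> x))) *\<^sub>R S"
      by (subst F_def) (simp only: Fe FC FS)
    also have "\<dots> = (\<alpha> * \<alpha>) *\<^sub>R x + ((1 - \<alpha> * \<alpha>) / ?n * (e \<bullet> x)) *\<^sub>R e
        - (2 * (\<alpha> * \<alpha> + b * b) / ?n * (C \<bullet> x)) *\<^sub>R C - (2 * (\<alpha> * \<alpha> + b * b) / ?n * (S \<bullet> x)) *\<^sub>R S"
      by (simp add: F_def vec_eq_iff) (simp add: field_simps)
    also have "\<dots> = A *v x" unfolding Av \<alpha>2 b2 by simp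
    finally show ?thesis .
  qed
  then have "A = matrix F ** matrix F"
    using \<open>linear F\<close> by (simp add: matrix_eq matrix_vector_mul_assoc[symmetric] matrix_works)
  then have detA: "det A = (det (matrix F))\<^sup>2" by (simp add: det_mul power2_eq_square)
  \<comment> \<open>Pairing \<open>A *v x = 0\<close> with \<open>e\<close>, \<open>C\<close> and
    \<open>S\<close> shows that \<open>x\<close> is orthogonal to all three, and there
    \<open>A\<close> is multiplication by \<open>\<epsilon>\<close>.\<close>
  have "x = 0" if "A *v x = 0" for x
  proof -
    have "e \<bullet> (A *v x) = e \<bullet> x" using npos
      by (simp add: Av inner_add_right inner_diff_right field_simps)
    then have ex: "e \<bullet> x = 0" using that by simp
    have "C \<bullet> (A *v x) = (\<epsilon> - \<beta> / 2) * (C \<bullet> x)" using npos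
      by (simp add: Av inner_add_right inner_diff_right field_simps)
    then have Cx: "C \<bullet> x = 0" using that \<beta> by simp
    have "S \<bullet> (A *v x) = (\<epsilon> - \<beta> / 2) * (S \<bullet> x)" using npos
      by (simp add: Av inner_add_right inner_diff_right field_simps)
    then have Sx: "S \<bullet> x = 0" using that \<beta> by simp
    have "\<epsilon> *\<^sub>R x = 0" using that unfolding Av ex Cx Sx by simp
    then show "x = 0" using eps by simp
  qed
  then have "invertible A"
    using matrix_left_invertible_ker[of A] invertible_left_inverse by blast
  then have "det A > 0" using detA invertible_det_nz[of A] by simp
  moreover have "A $ i $ j = A $ j $ i" for i j by (simp add: A_def mult.commute)
  moreover have "A $ i $ j > 0" if "i \<noteq> j" for i j
  proof -
    have "\<beta> * (C $ i * C $ j + S $ i * S $ j) \<le> \<beta> * c"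
      using \<beta>(1) cG[OF that] by (intro mult_left_mono) auto
    then have "0 < (1 - \<epsilon> - \<beta> * (C $ i * C $ j + S $ i * S $ j)) / ?n"
      using \<beta>c npos by (intro divide_pos_pos) auto
    then show ?thesis using that by (simp add: A_def diff_divide_distrib)
  qed
  moreover have "A $ i $ i = 0" for i
  proof -
    have "A $ i $ i = \<epsilon> + (1 - \<epsilon>) / ?n - \<beta> / ?n" by (simp add: A_def one)
    also have "\<dots> = 0" using npos by (simp add: \<beta>_def field_simps)
    finally show ?thesis .
  qed
  moreover have "(\<Sum>j\<in>UNIV. A $ i $ j) = 1" for i
  proof -
    have "(\<Sum>j\<in>UNIV. A $ i $ j) = (A *v e) $ i" by (simp add: matrix_vector_mult_def e_def)
    also have "\<dots> = 1" unfolding Av using npos by (simp add: e_def[symmetric]) (simp add: e_def)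
    finally show ?thesis .
  qed
  \<comment> \<open>The two terms with \<open>\<beta>\<close> are dropped; Cauchy-Schwarz with
    \<open>e \<bullet> e = n\<close> bounds the others by
    \<open>\<epsilon> + (1 - \<epsilon>) = 1\<close> times \<open>x \<bullet> x\<close>.\<close>
  moreover have "x \<bullet> (A *v x) \<le> x \<bullet> x" for x
  proof -
    have "(e \<bullet> x)\<^sup>2 \<le> ?n * (x \<bullet> x)" using Cauchy_Schwarz_ineq[of e x] by simp
    then have "(1 - \<epsilon>) / ?n * (e \<bullet> x)\<^sup>2 \<le> (1 - \<epsilon>) / ?n * (?n * (x \<bullet> x))"
      using eps npos by (intro mult_left_mono) auto
    also have "\<dots> = (1 - \<epsilon>) * (x \<bullet> x)" using npos by simp
    finally have "(1 - \<epsilon>) / ?n * (e \<bullet> x)\<^sup>2 \<le> x \<bullet> x - \<epsilon> * (x \<bullet> x)" by (simp add: algebra_simps)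
    moreover have "\<beta> / ?n * (C \<bullet> x)\<^sup>2 \<ge> 0" "\<beta> / ?n * (S \<bullet> x)\<^sup>2 \<ge> 0" using \<beta> npos by auto
    ultimately show ?thesis unfolding form by linarith
  qed
  moreover have "x \<bullet> (A *v x) > 0" if "x \<noteq> 0" "C \<bullet> x = 0" "S \<bullet> x = 0" for x
  proof -
    have "\<epsilon> * (x \<bullet> x) > 0" using eps that(1) by simp
    moreover have "(1 - \<epsilon>) / ?n * (e \<bullet> x)\<^sup>2 \<ge> 0" using eps npos by simp
    ultimately show ?thesis unfolding form that(2,3) by simp
  qed
  moreover have "x \<bullet> (A *v x) \<le> 0" if "x \<in> span {C, S}" for x
  proof -
    obtain p where "x - p *\<^sub>R C \<in> span {S}" using \<open>x \<in> span {C, S}\<close> span_breakdown_eq by blast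
    then obtain q where "x - p *\<^sub>R C = q *\<^sub>R S" by (auto simp: span_singleton)
    then have x: "x = p *\<^sub>R C + q *\<^sub>R S" by (simp add: algebra_simps)
    have "x \<bullet> (A *v x) = ?n / 2 * (\<epsilon> - \<beta> / 2) * (p\<^sup>2 + q\<^sup>2)"
      unfolding form x using npos
      by (simp add: inner_add_right inner_add_left) (simp add: field_simps power2_eq_square)
    also have "\<dots> \<le> 0"
      using npos \<beta> by (intro mult_nonpos_nonneg[OF mult_nonneg_nonpos]) auto
    finally show ?thesis .
  qed
  moreover have "dim {C, S} = 2"
  proof -
    have "C \<bullet> C \<noteq> 0" "S \<bullet> S \<noteq> 0" "C \<bullet> S = 0" using npos by auto
    then have ne: "C \<noteq> 0" "S \<noteq> 0" "C \<noteq> S" by (auto simp del: CS)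
    have "independent {C, S}"
    proof (rule pairwise_orthogonal_independent)
      show "pairwise orthogonal {C, S}" by (auto simp: pairwise_insert orthogonal_def)
    qed (use ne in auto)
    then show ?thesis using ne by (simp add: dim_eq_card_independent)
  qed
  ultimately show ?thesis by (rule that)
qed

section \<open>Morse index\<close>

interpretation fun_vec: vector_space_pair "\<lambda>(r :: real) (f :: 'a \<Rightarrow> 'b :: real_vector) x. r *\<^sub>R f x"
    "(*\<^sub>R) :: real \<Rightarrow> 'c :: real_vector \<Rightarrow> 'c"
  by unfold_locales

text \<open>The map \<open>s\<close> is linear only on \<open>W\<close>, as is to be expected of a
  map defined by integrals. Extending its values on a basis of \<open>W\<close> gives a globally
  linear \<open>L\<close> that agrees with \<open>s\<close> on \<open>W\<close>, and the theory of
  linear maps applies to \<open>L\<close>.\<close>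

lemma dim_image_of_fun_subspace:
  fixes W :: "('a \<Rightarrow> 'b :: real_vector) set" and s :: "('a \<Rightarrow> 'b) \<Rightarrow> 'c :: euclidean_space"
  assumes W: "funs.subspace W"
    and add: "\<And>\<phi> \<psi>. \<phi> \<in> W \<Longrightarrow> \<psi> \<in> W \<Longrightarrow> s (\<phi> + \<psi>) = s \<phi> + s \<psi>"
    and scale: "\<And>r \<phi>. \<phi> \<in> W \<Longrightarrow> s (\<lambda>x. r *\<^sub>R \<phi> x) = r *\<^sub>R s \<phi>"
    and inj: "\<And>\<phi>. \<phi> \<in> W \<Longrightarrow> \<phi> \<noteq> 0 \<Longrightarrow> s \<phi> \<noteq> 0"
  shows "subspace (s ` W)" "dim (s ` W) = funs.dim W"
proof -
  obtain B where B: "B \<subseteq> W" "funs.independent B" "W \<subseteq> funs.span B" "card B = funs.dim W"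
    by (rule funs.basis_exists)
  have span: "funs.span B = W"
    using B(1,3) W by (simp add: funs.span_minimal subset_antisym)
  obtain L where L: "Vector_Spaces.linear (\<lambda>r f x. r *\<^sub>R f x) (*\<^sub>R) L" and LB: "\<And>\<phi>. \<phi> \<in> B \<Longrightarrow> L \<phi> = s \<phi>"
    using fun_vec.linear_independent_extend[OF B(2), of s] by blast
  interpret L: Vector_Spaces.linear "\<lambda>(r :: real) (f :: 'a \<Rightarrow> 'b) x. r *\<^sub>R f x" "(*\<^sub>R)" L by (rule L)
  have s0: "s 0 = 0"
    using add[of 0 0] funs.subspace_0[OF W] by simp
  have "funs.subspace {\<phi> \<in> W. L \<phi> = s \<phi>}"
  proof (rule funs.subspaceI)
    show "0 \<in> {\<phi> \<in> W. L \<phi> = s \<phi>}" using funs.subspace_0[OF W] s0 by (simp add: L.zero)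
    show "\<phi> + \<psi> \<in> {\<phi> \<in> W. L \<phi> = s \<phi>}" if "\<phi> \<in> {\<phi> \<in> W. L \<phi> = s \<phi>}" "\<psi> \<in> {\<phi> \<in> W. L \<phi> = s \<phi>}" for \<phi> \<psi>
      using that funs.subspace_add[OF W] by (simp add: L.add add)
    show "(\<lambda>x. r *\<^sub>R \<phi> x) \<in> {\<phi> \<in> W. L \<phi> = s \<phi>}" if "\<phi> \<in> {\<phi> \<in> W. L \<phi> = s \<phi>}" for r \<phi>
      using that funs.subspace_scale[OF W] by (simp add: L.scale scale)
  qed
  then have "funs.span B \<subseteq> {\<phi> \<in> W. L \<phi> = s \<phi>}"
    using B(1) LB by (intro funs.span_minimal) auto
  then have Ls: "L \<phi> = s \<phi>" if "\<phi> \<in> W" for \<phi> using that span by auto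
  then have "s ` W = L ` funs.span B" unfolding span by (intro image_cong refl) simp
  also have "\<dots> = span (L ` B)" by (rule L.span_image[folded span_raw_def, symmetric])
  finally have V: "s ` W = span (L ` B)" .
  then show "subspace (s ` W)" by simp
  have "inj_on L (funs.span B)"
  proof (rule inj_onI)
    fix \<phi> \<psi> assume *: "\<phi> \<in> funs.span B" "\<psi> \<in> funs.span B" "L \<phi> = L \<psi>"
    then have "\<phi> - \<psi> \<in> W" using funs.span_diff[of \<phi> B \<psi>] span by simp
    moreover have "L (\<phi> - \<psi>) = 0" using *(3) by (simp add: L.diff)
    ultimately show "\<phi> = \<psi>" using Ls[of "\<phi> - \<psi>"] inj[of "\<phi> - \<psi>"] by auto
  qed
  then have "inj_on L B" and "independent (L ` B)"
    using L.independent_injective_image[folded dependent_raw_def, OF B(2)]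
    by (auto intro: inj_on_subset[OF _ funs.span_superset])
  from \<open>inj_on L B\<close> have "dim (s ` W) = card B"
    unfolding V by (simp only: dim_span_eq_card_independent[OF \<open>independent (L ` B)\<close>] card_image)
  then show "dim (s ` W) = funs.dim W" using B(4) by simp
qed

text \<open>The definition of \<open>morse_index\<close> asks for a finite spanning set; the image
  of a basis of \<open>V\<close> is one, and injectivity keeps it independent.\<close>

lemma funs_dim_span_image:
  fixes T :: "'c :: euclidean_space \<Rightarrow> 'a \<Rightarrow> 'b :: real_vector"
  assumes T: "Vector_Spaces.linear (*\<^sub>R) (\<lambda>r f x. r *\<^sub>R f x) T" and "inj T" "subspace V"
  obtains B where "finite B" "T ` V = funs.span B" "funs.dim (T ` V) = dim V"
proof -
  interpret T: Vector_Spaces.linear "(*\<^sub>R) :: real \<Rightarrow> 'c \<Rightarrow> 'c" "\<lambda>(r :: real) (f :: 'a \<Rightarrow> 'b) x. r *\<^sub>R f x" T by (rule T)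
  obtain B where B: "B \<subseteq> V" "independent B" "V \<subseteq> span B" "card B = dim V"
    by (rule basis_exists)
  have span: "span B = V" using B(1,3) assms(3) by (simp add: span_minimal subset_antisym)
  have ind: "funs.independent (T ` B)"
    by (rule T.independent_injective_image[folded dependent_raw_def span_raw_def, OF B(2)]) (use assms(2) in \<open>auto intro: inj_on_subset\<close>)
  have eq: "T ` V = funs.span (T ` B)" using T.span_image[of B, folded span_raw_def] span by simp
  moreover have "finite (T ` B)" using B(2) independent_imp_finite by blast
  moreover have "funs.dim (T ` V) = dim V"
    unfolding eq funs.dim_span_eq_card_independent[OF ind] B(4)[symmetric]
    by (rule card_image) (use assms(2) in \<open>auto intro: inj_on_subset\<close>)
  ultimately show ?thesis using that by blast
qed

text \<open>The energy along the line \<open>u + t \<phi>\<close> is a quartic polynomial in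
  \<open>t\<close>, so its coefficient of \<open>t\<^sup>2\<close> determines the second
  variation.\<close>

lemma second_derivative_quartic:
  fixes k0 k1 k2 k3 k4 :: real
  shows "(deriv ^^ 2) (\<lambda>t. k0 + k1 * t + k2 * t ^ 2 + k3 * t ^ 3 + k4 * t ^ 4) 0 = 2 * k2"
proof -
  have "deriv (\<lambda>t. k0 + k1 * t + k2 * t ^ 2 + k3 * t ^ 3 + k4 * t ^ 4)
      = (\<lambda>t. k1 + 2 * k2 * t + 3 * k3 * t ^ 2 + 4 * k4 * t ^ 3)"
    by (intro ext DERIV_imp_deriv) (auto intro!: derivative_eq_intros)
  moreover have "deriv (\<lambda>t. k1 + 2 * k2 * t + 3 * k3 * t ^ 2 + 4 * k4 * t ^ 3) 0 = 2 * k2"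
    by (rule DERIV_imp_deriv) (auto intro!: derivative_eq_intros)
  ultimately show ?thesis by (simp add: numeral_2_eq_2)
qed

section \<open>The second variation at the solution\<close>

context ground_state
begin

text \<open>The form of the linearized nonlinearity, with weight \<open>U\<^sup>2\<close>. Paired
  with \<open>U\<close> it agrees with the inner product \<open>B\<close>, so orthogonality to
  \<open>U\<close> means the same for both.\<close>

definition K :: "(real ^ 'N \<Rightarrow> real) \<Rightarrow> (real ^ 'N \<Rightarrow> real) \<Rightarrow> real" where
  "K u v = (\<integral>x. (U x * U x) * (u x * v x) \<partial>M)"

lemma K_integrable:
  "u \<in> Hsp \<Omega> \<Longrightarrow> v \<in> Hsp \<Omega> \<Longrightarrow> integrable M (\<lambda>x. (U x * U x) * (u x * v x))"
  by (intro quartic_integrable U_Hsp)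

lemma K_commute: "K u v = K v u"
  by (simp add: K_def mult.commute)

lemma K_lincomb:
  assumes "u \<in> Hsp \<Omega>" "v \<in> Hsp \<Omega>" "w \<in> Hsp \<Omega>"
  shows "K (\<lambda>x. a * u x + b * v x) w = a * K u w + b * K v w"
proof -
  have "(U x * U x) * ((a * u x + b * v x) * w x)
      = a * ((U x * U x) * (u x * w x)) + b * ((U x * U x) * (v x * w x))" for x
    by (simp add: algebra_simps)
  then show ?thesis
    unfolding K_def using K_integrable[OF assms(1,3)] K_integrable[OF assms(2,3)] by simp
qed

lemma K_U_U: "K U U = Q U"
  unfolding K_def Q_U by (simp add: power4_eq_xxxx mult.assoc)

lemma B_U_eq_K: "\<psi> \<in> Hsp \<Omega> \<Longrightarrow> B U \<psi> = K U \<psi>"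
  unfolding K_def by (rule B_U)

text \<open>\<open>E1\<close>, \<open>E3\<close> and \<open>E4\<close> name the coefficients of
  \<open>t\<close>, \<open>t\<^sup>3\<close> and \<open>t\<^sup>4\<close> in the expansion below;
  they disappear in the second derivative at 0.\<close>

definition E1 :: "(real ^ 'N \<Rightarrow> real) \<Rightarrow> (real ^ 'N \<Rightarrow> real) \<Rightarrow> real" where
  "E1 u v = 2 * (\<integral>x. (U x * U x) * (U x * u x) \<partial>M) + 2 * (\<integral>x. (U x * U x) * (U x * v x) \<partial>M)"

definition E3 :: "(real ^ 'N \<Rightarrow> real) \<Rightarrow> (real ^ 'N \<Rightarrow> real) \<Rightarrow> real" where
  "E3 u v = 2 * (\<integral>x. (U x * u x) * (u x * v x) \<partial>M) + 2 * (\<integral>x. (U x * u x) * (v x * v x) \<partial>M)"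

definition E4 :: "(real ^ 'N \<Rightarrow> real) \<Rightarrow> (real ^ 'N \<Rightarrow> real) \<Rightarrow> real" where
  "E4 u v = (\<integral>x. (u x * u x) * (v x * v x) \<partial>M)"

lemma quartic_expansion:
  assumes u: "u \<in> Hsp \<Omega>" and v: "v \<in> Hsp \<Omega>"
  shows "integrable M (\<lambda>x. (U x + t * u x)\<^sup>2 * (U x + t * v x)\<^sup>2)"
    and "(\<integral>x. (U x + t * u x)\<^sup>2 * (U x + t * v x)\<^sup>2 \<partial>M)
      = Q U + E1 u v * t + (K u u + K v v + 4 * K u v) * t ^ 2 + E3 u v * t ^ 3 + E4 u v * t ^ 4"
proof -
  let ?f0 = "\<lambda>x. (U x * U x) * (U x * U x)"
  let ?f1 = "\<lambda>x. (U x * U x) * (U x * u x)" and ?g1 = "\<lambda>x. (U x * U x) * (U x * v x)"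
  let ?f2 = "\<lambda>x. (U x * U x) * (u x * u x)" and ?g2 = "\<lambda>x. (U x * U x) * (v x * v x)"
    and ?h2 = "\<lambda>x. (U x * U x) * (u x * v x)"
  let ?f3 = "\<lambda>x. (U x * u x) * (u x * v x)" and ?g3 = "\<lambda>x. (U x * u x) * (v x * v x)"
  let ?f4 = "\<lambda>x. (u x * u x) * (v x * v x)"
  note q = quartic_integrable
  note i = q[OF U_Hsp U_Hsp U_Hsp U_Hsp] q[OF U_Hsp U_Hsp U_Hsp u] q[OF U_Hsp U_Hsp U_Hsp v]
    q[OF U_Hsp U_Hsp u u] q[OF U_Hsp U_Hsp v v] q[OF U_Hsp U_Hsp u v] q[OF U_Hsp u u v]
    q[OF U_Hsp u v v] q[OF u u v v]
  have eq: "(U x + t * u x)\<^sup>2 * (U x + t * v x)\<^sup>2 = ?f0 x + 2 * t * ?f1 x + 2 * t * ?g1 x + t ^ 2 * ?f2 x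
      + t ^ 2 * ?g2 x + 4 * t ^ 2 * ?h2 x + 2 * t ^ 3 * ?f3 x + 2 * t ^ 3 * ?g3 x + t ^ 4 * ?f4 x" for x
    by (simp add: power2_eq_square power3_eq_cube power4_eq_xxxx algebra_simps)
  show "integrable M (\<lambda>x. (U x + t * u x)\<^sup>2 * (U x + t * v x)\<^sup>2)"
    unfolding eq using i by simp
  have "(\<integral>x. (U x + t * u x)\<^sup>2 * (U x + t * v x)\<^sup>2 \<partial>M) = K U U + 2 * t * integral\<^sup>L M ?f1
      + 2 * t * integral\<^sup>L M ?g1 + t ^ 2 * K u u + t ^ 2 * K v v + 4 * t ^ 2 * K u v
      + 2 * t ^ 3 * integral\<^sup>L M ?f3 + 2 * t ^ 3 * integral\<^sup>L M ?g3 + t ^ 4 * integral\<^sup>L M ?f4"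
    unfolding eq K_def using i by simp
  then show "(\<integral>x. (U x + t * u x)\<^sup>2 * (U x + t * v x)\<^sup>2 \<partial>M)
      = Q U + E1 u v * t + (K u u + K v v + 4 * K u v) * t ^ 2 + E3 u v * t ^ 3 + E4 u v * t ^ 4"
    by (simp add: K_U_U E1_def E3_def E4_def algebra_simps)
qed

text \<open>The quadratic coefficient of the coupling term pairs each component with itself and with
  the others. In the former terms symmetry and unit row sums eliminate the matrix, which leaves the
  single subtracted \<open>K\<close> in the first sum.\<close>

lemma second_variation_eq:
  fixes A :: "real ^ 'n ^ 'n" and \<phi> :: "real ^ 'N \<Rightarrow> real ^ 'n"
  assumes A: "\<And>i j. A $ i $ j = A $ j $ i" "\<And>i. (\<Sum>j\<in>UNIV. A $ i $ j) = 1"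
    and \<phi>: "\<phi> \<in> Hvec \<Omega>"
  shows "second_variation (system_energy \<Omega> lam A) (\<lambda>x. \<chi> i. U x) \<phi>
    = (\<Sum>i\<in>UNIV. Q (\<lambda>x. \<phi> x $ i) - K (\<lambda>x. \<phi> x $ i) (\<lambda>x. \<phi> x $ i))
      - 2 * (\<Sum>i\<in>UNIV. \<Sum>j\<in>UNIV. A $ i $ j * K (\<lambda>x. \<phi> x $ i) (\<lambda>x. \<phi> x $ j))"
proof -
  let ?p = "\<lambda>i x. \<phi> x $ i"
  have H: "?p i \<in> Hsp \<Omega>" for i using \<phi> by (simp add: Hvec_def)
  note int = quartic_expansion(1)[OF H H] and e = quartic_expansion(2)[OF H H]
  define c2 where "c2 = (\<Sum>i\<in>UNIV. \<Sum>j\<in>UNIV. A $ i $ j * (K (?p i) (?p i) + K (?p j) (?p j) + 4 * K (?p i) (?p j)))"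
  define k where "k = (\<lambda>e :: 'n \<Rightarrow> 'n \<Rightarrow> real. \<Sum>i\<in>UNIV. \<Sum>j\<in>UNIV. A $ i $ j * e i j)"
  have energy: "system_energy \<Omega> lam A (\<lambda>x. (\<chi> i. U x) + t *\<^sub>R \<phi> x)
      = ((\<Sum>i\<in>(UNIV :: 'n set). Q U) / 2 - k (\<lambda>i j. Q U) / 4) + ((\<Sum>i\<in>UNIV. B U (?p i)) - k (\<lambda>i j. E1 (?p i) (?p j)) / 4) * t
        + ((\<Sum>i\<in>UNIV. Q (?p i)) / 2 - c2 / 4) * t ^ 2 + (- k (\<lambda>i j. E3 (?p i) (?p j)) / 4) * t ^ 3 + (- k (\<lambda>i j. E4 (?p i) (?p j)) / 4) * t ^ 4" for t
  proof -
    have "(\<integral>x. (norm (Dw (\<lambda>y. ((\<chi> i. U y) + t *\<^sub>R \<phi> y) $ i) x))\<^sup>2 + lam * (((\<chi> i. U x) + t *\<^sub>R \<phi> x) $ i)\<^sup>2 \<partial>M)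
        = Q U + 2 * t * B U (?p i) + t\<^sup>2 * Q (?p i)" for i
      using Q_lincomb[OF U_Hsp H[of i], of 1 t] by (simp add: Q_def)
    moreover have "(\<integral>x. (\<Sum>i\<in>UNIV. \<Sum>j\<in>UNIV. A $ i $ j * (((\<chi> i. U x) + t *\<^sub>R \<phi> x) $ i)\<^sup>2 * (((\<chi> i. U x) + t *\<^sub>R \<phi> x) $ j)\<^sup>2) \<partial>M)
        = (\<Sum>i\<in>UNIV. \<Sum>j\<in>UNIV. A $ i $ j * (\<integral>x. (U x + t * ?p i x)\<^sup>2 * (U x + t * ?p j x)\<^sup>2 \<partial>M))"
      using int by (simp add: mult.assoc)
    ultimately show ?thesis
      unfolding system_energy_def e c2_def k_def
      by (simp add: sum.distrib sum_distrib_left sum_distrib_right sum_divide_distrib algebra_simps)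
  qed
  have "second_variation (system_energy \<Omega> lam A) (\<lambda>x. \<chi> i. U x) \<phi> = (\<Sum>i\<in>UNIV. Q (?p i)) - c2 / 2"
    unfolding second_variation_def energy second_derivative_quartic by simp
  moreover have "c2 = 2 * (\<Sum>i\<in>UNIV. K (?p i) (?p i)) + 4 * (\<Sum>i\<in>UNIV. \<Sum>j\<in>UNIV. A $ i $ j * K (?p i) (?p j))"
  proof -
    have 1: "(\<Sum>i\<in>UNIV. \<Sum>j\<in>UNIV. A $ i $ j * K (?p i) (?p i)) = (\<Sum>i\<in>UNIV. K (?p i) (?p i))"
      by (simp add: sum_distrib_right[symmetric] A(2))
    have "(\<Sum>i\<in>UNIV. \<Sum>j\<in>UNIV. A $ i $ j * K (?p j) (?p j)) = (\<Sum>j\<in>UNIV. \<Sum>i\<in>UNIV. A $ j $ i * K (?p j) (?p j))"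
      by (subst sum.swap) (simp add: A(1))
    then have 2: "(\<Sum>i\<in>UNIV. \<Sum>j\<in>UNIV. A $ i $ j * K (?p j) (?p j)) = (\<Sum>i\<in>UNIV. K (?p i) (?p i))"
      using 1 by simp
    show ?thesis
      unfolding c2_def using 1 2 by (simp add: distrib_left sum.distrib sum_distrib_left mult.left_commute)
  qed
  ultimately show ?thesis by (simp add: sum_subtractf add_divide_distrib)
qed

lemma form_eq_sum: "x \<bullet> (A *v x) = (\<Sum>i\<in>UNIV. \<Sum>j\<in>UNIV. A $ i $ j * (x $ i * x $ j))"
  for A :: "real ^ 'n ^ 'n"
  by (simp add: inner_vec_def matrix_vector_mult_def sum_distrib_left mult_ac)

text \<open>The vector \<open>s\<close> in the decomposition
  \<open>\<phi>\<^sub>i = s\<^sub>i U + \<chi>\<^sub>i\<close>. Because of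
  \<open>K U U = Q U\<close>, this quotient makes the remainder orthogonal to
  \<open>U\<close>.\<close>

definition coord :: "(real ^ 'N \<Rightarrow> real ^ 'n) \<Rightarrow> real ^ 'n" where
  "coord \<phi> = (\<chi> i. K U (\<lambda>x. \<phi> x $ i) / Q U)"

text \<open>For the remainders \<open>X i\<close> the minimality of \<open>U\<close> gives
  \<open>Q (X i) \<ge> 3 K (X i) (X i)\<close>. By \<open>A \<le> 1\<close>, applied at each point
  with weight \<open>U\<^sup>2\<close>, the coupling takes away at most twice the sum of the
  \<open>K (X i) (X i)\<close>. With the one already subtracted, the balance
  \<open>3 - 1 - 2\<close> is 0, and the contribution of the multiples of \<open>U\<close>
  remains.\<close>

lemma second_variation_ge:
  fixes A :: "real ^ 'n ^ 'n" and \<phi> :: "real ^ 'N \<Rightarrow> real ^ 'n"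
  assumes A: "\<And>i j. A $ i $ j = A $ j $ i" "\<And>i. (\<Sum>j\<in>UNIV. A $ i $ j) = 1"
    "\<And>x. x \<bullet> (A *v x) \<le> x \<bullet> x"
    and \<phi>: "\<phi> \<in> Hvec \<Omega>"
  shows "second_variation (system_energy \<Omega> lam A) (\<lambda>x. \<chi> i. U x) \<phi>
    \<ge> - 2 * Q U * (coord \<phi> \<bullet> (A *v coord \<phi>))"
proof -
  let ?p = "\<lambda>i x. \<phi> x $ i"
  define s where "s i = K U (?p i) / Q U" for i
  have sm: "K U (?p i) = s i * Q U" for i using Q_U_pos by (simp add: s_def)
  have H: "?p i \<in> Hsp \<Omega>" for i using \<phi> by (simp add: Hvec_def)
  define X where "X i x = (- s i) * U x + 1 * ?p i x" for i x
  have XH: "X i \<in> Hsp \<Omega>" for i unfolding X_def by (rule Hsp_lincomb(1)[OF open_\<Omega> U_Hsp H])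
  \<comment> \<open>Since \<open>B U (?p i) = K U (?p i) = s i * Q U\<close>, the decomposition is
    orthogonal for \<open>Q\<close>; \<open>KXX\<close> below says the same for
    \<open>K\<close>.\<close>
  have QX: "Q (?p i) = Q (X i) + (s i)\<^sup>2 * Q U" for i
    unfolding X_def Q_lincomb[OF U_Hsp H] B_U_eq_K[OF H] sm by (simp add: power2_eq_square)
  have KX1: "K (X i) v = - s i * K U v + K (?p i) v" if "v \<in> Hsp \<Omega>" for i v
    unfolding X_def K_lincomb[OF U_Hsp H that] by simp
  have KXU: "K U (X i) = 0" for i
    unfolding K_commute[of U "X i"] KX1[OF U_Hsp] K_U_U K_commute[of "?p i" U] sm by simp
  have KXX: "K (?p i) (?p j) = K (X i) (X j) + s i * s j * Q U" for i j
  proof -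
    have "K (X i) (X j) = K (?p i) (X j)" unfolding KX1[OF XH] KXU by simp
    also have "\<dots> = K (X j) (?p i)" by (rule K_commute)
    also have "\<dots> = - s j * (s i * Q U) + K (?p i) (?p j)"
      unfolding KX1[OF H] sm K_commute[of "?p j" "?p i"] by simp
    finally show ?thesis by simp
  qed
  have "3 * K (X i) (X i) \<le> Q (X i)" for i
  proof -
    \<comment> \<open>The term with \<open>(B U (X i))\<^sup>2\<close> in the second order condition
      vanishes by orthogonality.\<close>
    have "3 * Q U * K (X i) (X i) \<le> Q U * Q (X i)"
      using second_order[OF XH[of i], folded K_def] unfolding B_U_eq_K[OF XH] KXU by simp
    then have "Q U * (3 * K (X i) (X i)) \<le> Q U * Q (X i)" by (simp add: mult_ac)
    then show ?thesis using Q_U_pos by (simp only: mult_le_cancel_left_pos)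
  qed
  then have "(\<Sum>i\<in>UNIV. 3 * K (X i) (X i)) \<le> (\<Sum>i\<in>UNIV. Q (X i))" by (intro sum_mono)
  then have 1: "2 * (\<Sum>i\<in>UNIV. K (X i) (X i)) \<le> (\<Sum>i\<in>UNIV. Q (X i) - K (X i) (X i))"
    by (simp add: sum_distrib_left[symmetric] sum_subtractf)
  have 2: "(\<Sum>i\<in>UNIV. \<Sum>j\<in>UNIV. A $ i $ j * K (X i) (X j)) \<le> (\<Sum>i\<in>UNIV. K (X i) (X i))"
  proof -
    have "(\<Sum>i\<in>UNIV. \<Sum>j\<in>UNIV. A $ i $ j * K (X i) (X j))
        = (\<integral>x. (\<Sum>i\<in>UNIV. \<Sum>j\<in>UNIV. A $ i $ j * ((U x * U x) * (X i x * X j x))) \<partial>M)"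
      unfolding K_def using K_integrable[OF XH XH] by simp
    also have "\<dots> \<le> (\<integral>x. (\<Sum>i\<in>UNIV. (U x * U x) * (X i x * X i x)) \<partial>M)"
    proof (rule integral_mono)
      show "integrable M (\<lambda>x. \<Sum>i\<in>UNIV. \<Sum>j\<in>UNIV. A $ i $ j * ((U x * U x) * (X i x * X j x)))"
        "integrable M (\<lambda>x. \<Sum>i\<in>UNIV. (U x * U x) * (X i x * X i x))"
        using K_integrable[OF XH XH] by auto
      fix x
      have "(U x * U x) * ((\<chi> i. X i x) \<bullet> (A *v (\<chi> i. X i x))) \<le> (U x * U x) * ((\<chi> i. X i x) \<bullet> (\<chi> i. X i x))"
        by (intro mult_left_mono A(3)) simp
      then show "(\<Sum>i\<in>UNIV. \<Sum>j\<in>UNIV. A $ i $ j * ((U x * U x) * (X i x * X j x)))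
          \<le> (\<Sum>i\<in>UNIV. (U x * U x) * (X i x * X i x))"
        unfolding form_eq_sum by (simp add: inner_vec_def sum_distrib_left mult_ac)
    qed
    also have "\<dots> = (\<Sum>i\<in>UNIV. K (X i) (X i))"
      unfolding K_def using K_integrable[OF XH XH] by simp
    finally show ?thesis .
  qed
  have "second_variation (system_energy \<Omega> lam A) (\<lambda>x. \<chi> i. U x) \<phi>
      = (\<Sum>i\<in>UNIV. Q (X i) - K (X i) (X i))
        - 2 * (\<Sum>i\<in>UNIV. \<Sum>j\<in>UNIV. A $ i $ j * K (X i) (X j) + Q U * (A $ i $ j * (s i * s j)))"
    unfolding second_variation_eq[OF A(1,2) \<phi>] QX KXX
    by (simp add: power2_eq_square algebra_simps)
  also have "\<dots> = (\<Sum>i\<in>UNIV. Q (X i) - K (X i) (X i))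
        - 2 * (\<Sum>i\<in>UNIV. \<Sum>j\<in>UNIV. A $ i $ j * K (X i) (X j)) - 2 * Q U * (coord \<phi> \<bullet> (A *v coord \<phi>))"
  proof -
    have c: "coord \<phi> $ i = s i" for i by (simp add: coord_def s_def)
    have "(\<Sum>i\<in>UNIV. \<Sum>j\<in>UNIV. A $ i $ j * K (X i) (X j) + Q U * (A $ i $ j * (s i * s j)))
        = (\<Sum>i\<in>UNIV. \<Sum>j\<in>UNIV. A $ i $ j * K (X i) (X j)) + Q U * (coord \<phi> \<bullet> (A *v coord \<phi>))"
      unfolding form_eq_sum c by (simp only: sum.distrib sum_distrib_left)
    then show ?thesis by (simp add: distrib_left)
  qed
  finally show ?thesis using 1 2 by linarith
qed

text \<open>On multiples of \<open>U\<close> the lower bound is attained: \<open>Q\<close> and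
  \<open>K\<close> take the same values there and cancel.\<close>

lemma second_variation_U:
  fixes A :: "real ^ 'n ^ 'n" and w :: "real ^ 'n"
  assumes A: "\<And>i j. A $ i $ j = A $ j $ i" "\<And>i. (\<Sum>j\<in>UNIV. A $ i $ j) = 1"
  shows "(\<lambda>x. U x *\<^sub>R w) \<in> Hvec \<Omega>"
    and "second_variation (system_energy \<Omega> lam A) (\<lambda>x. \<chi> i. U x) (\<lambda>x. U x *\<^sub>R w)
      = - 2 * Q U * (w \<bullet> (A *v w))"
proof -
  have eq: "(\<lambda>x. (U x *\<^sub>R w) $ i) = (\<lambda>x. w $ i * U x + 0 * U x)" for i by (simp add: mult.commute)
  show H: "(\<lambda>x. U x *\<^sub>R w) \<in> Hvec \<Omega>"
  proof -
    have "(\<lambda>x. (U x *\<^sub>R w) $ i) \<in> Hsp \<Omega>" for i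
      unfolding eq by (rule Hsp_lincomb(1)[OF open_\<Omega> U_Hsp U_Hsp])
    then show ?thesis unfolding Hvec_def by blast
  qed
  have Q: "Q (\<lambda>x. (U x *\<^sub>R w) $ i) = w $ i * w $ i * Q U" for i
    unfolding eq Q_lincomb[OF U_Hsp U_Hsp] by (simp add: power2_eq_square)
  have K: "K (\<lambda>x. (U x *\<^sub>R w) $ i) (\<lambda>x. (U x *\<^sub>R w) $ j) = w $ i * w $ j * Q U" for i j
  proof -
    have "K (\<lambda>x. (U x *\<^sub>R w) $ i) (\<lambda>x. (U x *\<^sub>R w) $ j) = (\<integral>x. (w $ i * w $ j) * ((U x * U x) * (U x * U x)) \<partial>M)"
      unfolding K_def by (intro Bochner_Integration.integral_cong) (simp_all add: mult_ac)
    also have "\<dots> = w $ i * w $ j * K U U" unfolding K_def by simp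
    finally show ?thesis by (simp add: K_U_U)
  qed
  show "second_variation (system_energy \<Omega> lam A) (\<lambda>x. \<chi> i. U x) (\<lambda>x. U x *\<^sub>R w)
      = - 2 * Q U * (w \<bullet> (A *v w))"
    unfolding second_variation_eq[OF A H] Q K form_eq_sum by (simp add: sum_distrib_left sum_negf mult_ac)
qed

lemma coord_add:
  assumes "\<phi> \<in> Hvec \<Omega>" "\<psi> \<in> Hvec \<Omega>"
  shows "coord (\<phi> + \<psi>) = coord \<phi> + coord \<psi>"
proof -
  have H: "(\<lambda>x. \<phi> x $ i) \<in> Hsp \<Omega>" "(\<lambda>x. \<psi> x $ i) \<in> Hsp \<Omega>" for i
    using assms by (auto simp: Hvec_def)
  have "K U (\<lambda>x. 1 * \<phi> x $ i + 1 * \<psi> x $ i) = 1 * K U (\<lambda>x. \<phi> x $ i) + 1 * K U (\<lambda>x. \<psi> x $ i)" for i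
    unfolding K_commute[of U] by (rule K_lincomb[OF H U_Hsp])
  then show ?thesis by (simp add: coord_def vec_eq_iff add_divide_distrib)
qed

lemma coord_scale:
  assumes "\<phi> \<in> Hvec \<Omega>"
  shows "coord (\<lambda>x. r *\<^sub>R \<phi> x) = r *\<^sub>R coord \<phi>"
proof -
  have H: "(\<lambda>x. \<phi> x $ i) \<in> Hsp \<Omega>" for i using assms by (auto simp: Hvec_def)
  have "K U (\<lambda>x. r * \<phi> x $ i + 0 * \<phi> x $ i) = r * K U (\<lambda>x. \<phi> x $ i) + 0 * K U (\<lambda>x. \<phi> x $ i)" for i
    unfolding K_commute[of U] by (rule K_lincomb[OF H H U_Hsp])
  then show ?thesis by (simp add: coord_def vec_eq_iff)
qed

text \<open>For the upper bound, \<open>coord\<close> is injective on a space of negative directions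
  and sends its nonzero elements to vectors on which \<open>A\<close> is positive. The image thus
  meets the plane of \<open>C\<close> and \<open>S\<close> only in 0, which leaves dimension at most
  \<open>n - 2\<close>. For the lower bound, the functions \<open>U w\<close> with \<open>w\<close>
  orthogonal to \<open>C\<close> and \<open>S\<close> are negative directions.\<close>

lemma morse_index_eq:
  fixes A :: "real ^ 'n ^ 'n" and C S :: "real ^ 'n"
  assumes A: "\<And>i j. A $ i $ j = A $ j $ i" "\<And>i. (\<Sum>j\<in>UNIV. A $ i $ j) = 1"
    and le: "\<And>x. x \<bullet> (A *v x) \<le> x \<bullet> x"
    and pos: "\<And>x. x \<noteq> 0 \<Longrightarrow> C \<bullet> x = 0 \<Longrightarrow> S \<bullet> x = 0 \<Longrightarrow> x \<bullet> (A *v x) > 0"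
    and neg: "\<And>x. x \<in> span {C, S} \<Longrightarrow> x \<bullet> (A *v x) \<le> 0" and dim2: "dim {C, S} = 2"
  shows "morse_index \<Omega> lam A (\<lambda>x. \<chi> i. U x) = enat (CARD('n) - 2)"
proof -
  let ?I = "second_variation (system_energy \<Omega> lam A) (\<lambda>x. \<chi> i. U x)"
  have upper: "funs.dim W \<le> CARD('n) - 2"
    if W: "funs.subspace W" "W \<subseteq> Hvec \<Omega>" and I: "\<forall>\<phi> \<in> W - {0}. ?I \<phi> < 0" for W :: "(real ^ 'N \<Rightarrow> real ^ 'n) set"
  proof -
    have form: "coord \<phi> \<bullet> (A *v coord \<phi>) > 0" if "\<phi> \<in> W" "\<phi> \<noteq> 0" for \<phi>
    proof -
      have "?I \<phi> < 0" using I that by blast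
      moreover have "- 2 * Q U * (coord \<phi> \<bullet> (A *v coord \<phi>)) \<le> ?I \<phi>"
        using that W(2) by (intro second_variation_ge[OF A le]) auto
      ultimately have "0 < Q U * (coord \<phi> \<bullet> (A *v coord \<phi>))" by simp
      then show ?thesis using Q_U_pos by (simp add: zero_less_mult_iff)
    qed
    have add: "coord (\<phi> + \<psi>) = coord \<phi> + coord \<psi>" if "\<phi> \<in> W" "\<psi> \<in> W" for \<phi> \<psi>
      using that W(2) by (intro coord_add) auto
    have scale: "coord (\<lambda>x. r *\<^sub>R \<phi> x) = r *\<^sub>R coord \<phi>" if "\<phi> \<in> W" for r \<phi>
      using that W(2) by (intro coord_scale) auto
    have inj: "coord \<phi> \<noteq> 0" if "\<phi> \<in> W" "\<phi> \<noteq> 0" for \<phi>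
      using form[OF that] by auto
    let ?V = "coord ` W"
    have V: "subspace ?V" and dimV: "dim ?V = funs.dim W"
      by (rule dim_image_of_fun_subspace[OF W(1) add scale inj]; assumption)+
    have "?V \<inter> span {C, S} \<subseteq> {0}"
    proof
      fix v assume v: "v \<in> ?V \<inter> span {C, S}"
      then obtain \<phi> where \<phi>: "\<phi> \<in> W" "v = coord \<phi>" by blast
      have "\<phi> = 0"
      proof (rule ccontr)
        assume "\<phi> \<noteq> 0"
        with form[OF \<phi>(1)] neg[of v] v \<phi>(2) show False by force
      qed
      \<comment> \<open>For \<open>\<phi> = 0\<close> additivity reads
        \<open>coord 0 = coord 0 + coord 0\<close>.\<close>
      then show "v \<in> {0}" using add[OF \<phi>(1) \<phi>(1)] \<phi>(2) by simp
    qed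
    then have dim0: "dim (?V \<inter> span {C, S}) = 0" by (simp add: dim_eq_0)
    have "dim {x + y |x y. x \<in> ?V \<and> y \<in> span {C, S}} = dim ?V + 2"
      using dim_sums_Int[OF V subspace_span[of "{C, S}"]] unfolding dim0 dim_span dim2 by simp
    moreover have "dim {x + y |x y. x \<in> ?V \<and> y \<in> span {C, S}} \<le> CARD('n)"
      using dim_subset_UNIV_cart .
    ultimately show ?thesis using dimV by simp
  qed
  let ?T = "\<lambda>(w :: real ^ 'n) x. U x *\<^sub>R w"
  define V where "V = {x. C \<bullet> x = 0 \<and> S \<bullet> x = 0}"
  have V: "subspace V" by (simp add: V_def subspace_def inner_add_right)
  have V_eq: "{y \<in> UNIV. \<forall>x \<in> span {C, S}. orthogonal x y} = V"
  proof -
    have "\<forall>x \<in> span {C, S}. orthogonal x y" if "y \<in> V" for y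
    proof
      fix x assume "x \<in> span {C, S}"
      then have "orthogonal y x"
        by (rule orthogonal_to_span) (use that in \<open>auto simp: V_def orthogonal_def inner_commute\<close>)
      then show "orthogonal x y" by (simp add: orthogonal_commute)
    qed
    moreover have "y \<in> V" if "\<forall>x \<in> span {C, S}. orthogonal x y" for y
      using that span_base[of C "{C, S}"] span_base[of S "{C, S}"] by (simp add: V_def orthogonal_def)
    ultimately show ?thesis by blast
  qed
  have dimV: "dim V = CARD('n) - 2"
    using dim_subspace_orthogonal_to_vectors[of "span {C, S}" UNIV] unfolding V_eq dim_span dim2 by simp
  have T: "Vector_Spaces.linear (*\<^sub>R) (\<lambda>r f x. r *\<^sub>R f x) ?T"
    by unfold_locales (auto simp: fun_eq_iff algebra_simps)
  \<comment> \<open>One point where \<open>U\<close> does not vanish makes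
    \<open>w \<mapsto> U w\<close> injective as a map into functions.\<close>
  have "\<exists>x. U x \<noteq> 0" using U_nonzero by auto
  then have inj: "inj ?T" by (auto simp: inj_def fun_eq_iff)
  obtain B where B: "finite B" "?T ` V = funs.span B" "funs.dim (?T ` V) = dim V"
    by (rule funs_dim_span_image[OF T inj V])
  have W: "funs.subspace (?T ` V)" "?T ` V \<subseteq> Hvec \<Omega>"
    by (simp only: B(2) funs.subspace_span) (rule image_subsetI, rule second_variation_U(1)[OF A])
  have WI: "\<forall>\<phi> \<in> ?T ` V - {0}. ?I \<phi> < 0"
  proof
    fix \<phi> assume "\<phi> \<in> ?T ` V - {0}"
    then obtain w where w: "w \<in> V" "\<phi> = ?T w" "\<phi> \<noteq> 0" by blast
    then have "w \<noteq> 0" by (auto simp: zero_fun_def)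
    with w(1) have "w \<bullet> (A *v w) > 0" by (intro pos) (auto simp: V_def)
    then show "?I \<phi> < 0" unfolding w(2) second_variation_U(2)[OF A] using Q_U_pos by simp
  qed
  have lower: "enat (CARD('n) - 2) \<in> {enat (funs.dim W) | W.
      funs.subspace W \<and> (\<exists>B. finite B \<and> W = funs.span B) \<and> W \<subseteq> Hvec \<Omega> \<and> (\<forall>\<phi> \<in> W - {0}. ?I \<phi> < 0)}"
    by (intro CollectI exI[of _ "?T ` V"] conjI W WI exI[of _ B] B(1,2)) (simp only: B(3) dimV)
  show ?thesis
    unfolding morse_index_def
  proof (rule antisym)
    show "Sup {enat (funs.dim W) | W. funs.subspace W \<and> (\<exists>B. finite B \<and> W = funs.span B) \<and> W \<subseteq> Hvec \<Omega>
        \<and> (\<forall>\<phi> \<in> W - {0}. ?I \<phi> < 0)} \<le> enat (CARD('n) - 2)"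
    proof (rule Sup_least)
      fix k assume "k \<in> {enat (funs.dim W) | W. funs.subspace W \<and> (\<exists>B. finite B \<and> W = funs.span B) \<and> W \<subseteq> Hvec \<Omega>
        \<and> (\<forall>\<phi> \<in> W - {0}. ?I \<phi> < 0)}"
      then show "k \<le> enat (CARD('n) - 2)"
      proof (elim CollectE exE conjE)
        fix W B assume "k = enat (funs.dim W)" "funs.subspace W" "W \<subseteq> Hvec \<Omega>" "\<forall>\<phi> \<in> W - {0}. ?I \<phi> < 0"
        with upper[of W] show ?thesis by (simp only: enat_ord_simps)
      qed
    qed
  qed (rule Sup_upper[OF lower])
qed

text \<open>With equal components the coupling sum is the row sum times \<open>U\<^sup>3\<close>, so
  each equation of the system is the scalar one.\<close>

lemma positive_vector_solution_U:
  fixes A :: "real ^ 'n ^ 'n"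
  assumes "\<And>i. (\<Sum>j\<in>UNIV. A $ i $ j) = 1"
  shows "positive_vector_solution \<Omega> lam A (\<lambda>x. \<chi> i. U x)"
proof -
  have "(\<Sum>j\<in>UNIV. A $ i $ j * U x * (U x)\<^sup>2) = U x ^ 3" for i x
  proof -
    have "(\<Sum>j\<in>UNIV. A $ i $ j * U x * (U x)\<^sup>2) = (\<Sum>j\<in>UNIV. A $ i $ j) * (U x * (U x)\<^sup>2)"
      by (simp only: sum_distrib_right mult.assoc)
    then show ?thesis by (simp add: assms power2_eq_square power3_eq_cube)
  qed
  then show ?thesis
    using ground U_Hsp U_pos
    by (simp add: positive_vector_solution_def system_solution_def Hvec_def
        least_energy_positive_solution_def scalar_solution_def)
qed

end

theorem theorem3p5:
  fixes \<Omega> :: "(real ^ 'N) set" and lam :: real and U :: "real ^ 'N \<Rightarrow> real"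
  assumes "open \<Omega>" and "connected \<Omega>" and "\<Omega> \<noteq> {}"
    and "CARD('N) \<le> 3" and "lam > 0"
    and "least_energy_positive_solution \<Omega> lam U"
    and "CARD('n) \<ge> 3"
  shows "\<exists>A :: real ^ 'n ^ 'n. det A > 0
    \<and> (\<forall>i j. i \<noteq> j \<longrightarrow> A $ i $ j = A $ j $ i \<and> A $ i $ j > 0)
    \<and> (\<forall>i. A $ i $ i = 0)
    \<and> (\<exists>c :: real ^ 'n. positive_vector_solution \<Omega> lam A (\<lambda>x. \<chi> i. c $ i * U x)
         \<and> morse_index \<Omega> lam A (\<lambda>x. \<chi> i. c $ i * U x) = enat (CARD('n) - 2))"
proof -
  interpret ground_state \<Omega> lam U using assms by unfold_locales auto
  obtain A :: "real ^ 'n ^ 'n" and C S :: "real ^ 'n" where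
    A: "det A > 0" "\<And>i j. A $ i $ j = A $ j $ i" "\<And>i j. i \<noteq> j \<Longrightarrow> A $ i $ j > 0" "\<And>i. A $ i $ i = 0"
    and sum: "\<And>i. (\<Sum>j\<in>UNIV. A $ i $ j) = 1" and le: "\<And>x. x \<bullet> (A *v x) \<le> x \<bullet> x"
    and pos: "\<And>x. x \<noteq> 0 \<Longrightarrow> C \<bullet> x = 0 \<Longrightarrow> S \<bullet> x = 0 \<Longrightarrow> x \<bullet> (A *v x) > 0"
    and neg: "\<And>x. x \<in> span {C, S} \<Longrightarrow> x \<bullet> (A *v x) \<le> 0" and dim: "dim {C, S} = 2"
    by (rule coupling_matrix_exists[OF assms(7)]) blast
  have morse: "morse_index \<Omega> lam A (\<lambda>x. \<chi> i. U x) = enat (CARD('n) - 2)"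
    by (rule morse_index_eq[OF A(2) sum le _ _ dim]) (fact pos neg)+
  \<comment> \<open>All coefficients are 1, in accordance with the unit row sums of
    \<open>A\<close>.\<close>
  define c :: "real ^ 'n" where "c = (\<chi> i. 1)"
  have "(\<lambda>x. \<chi> i. c $ i * U x) = (\<lambda>x. \<chi> i. U x)" by (simp add: c_def)
  then have c: "positive_vector_solution \<Omega> lam A (\<lambda>x. \<chi> i. c $ i * U x)
      \<and> morse_index \<Omega> lam A (\<lambda>x. \<chi> i. c $ i * U x) = enat (CARD('n) - 2)"
    using positive_vector_solution_U[OF sum] morse by simp
  show ?thesis
    by (intro exI[of _ A] conjI allI impI A exI[of _ c] c[THEN conjunct1] c[THEN conjunct2])
qed

end
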